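(* Let $(M,g)$ be a connected and complete $n$-dimensional Riemannian manifold with Riemannian distance $\rho$, let $D\subseteq M$ be open, let $f:[0,+\infty)\times D\times\mathbb R^m\to TM$ satisfy $f(t,x,u)\in T_xM$ for all $(t,x,u)$, and let $x^*\in D$ be an equilibrium point, i.e. $f(t,x^*,0)=0$ for all $t\in[0,+\infty)$. Assume that $f$ satisfies Assumption (A) (stated in the context). Set $$r_0=\sup\{r>0\mid B_{x^*}(r)\subseteq D\}\in(0,+\infty].$$ Suppose that there exists an ISS-Lyapunov function $V:[0,+\infty)\times B_{x^*}(r_0)\to\mathbb R$ for the system $\dot x(t)=f(t,x(t),u(t))$, with $\mathcal K$-functions $\alpha_1,\alpha_2,\alpha_3:[0,r_0)\to[0,+\infty)$, $\alpha_4:[0,\delta_V)\to[0,r_0)$ and $\delta_V\in(0,+\infty]$ (see the context). Set $$r_V=\lim_{r\to r_0^-}\alpha_2^{-1}\circ\alpha_1(r),\qquad \hat r_V=\sup\{s\in[0,\delta_V)\mid \alpha_4(s)<r_V\}.$$ Then $\hat r_V>0$. Moreover, the system is regionally ISS in $B_{x^*}(r_V)$; that is, there exist a $\mathcal{KL}$-function $\beta:[0,r_V)\times[0,+\infty)\to[0,+\infty)$ and a $\mathcal K$-function $\gamma:[0,\hat r_V)\to[0,+\infty)$ such that, for every $t_0\ge 0$, every $x_0\in B_{x^*}(r_V)$ and every $u(\cdot)\in L^\infty([0,+\infty);\mathbb R^m)$ with $\|u\|_{\infty,t_0}<\hat r_V$, every maximal solution $x_u(\cdot)$ of the system corresponding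 to $u(\cdot)$ with $x_u(t_0)=x_0$ is defined on $[t_0,+\infty)$ and satisfies $$\rho(x_u(t),x^* )\le\beta\bigl(\rho(x_u(t_0),x^* ),t-t_0\bigr)+\gamma\bigl(\|u\|_{\infty,t_0}\bigr),\qquad\forall\,t\ge t_0.$$ Moreover, $\rho(x^*,x_u(t))<r_0$ for all $t\in[t_0,+\infty)$.
   Context: Here $m,n\ge1$ are integers. $|\cdot|$ denotes the Euclidean norm on Euclidean spaces and the norm induced by $g$ on tangent vectors. For $x\in M$ and $r\ge0$, $B_x(r)=\{y\in M\mid\rho(x,y)<r\}$ (with $B_x(+\infty)=M$). When $r_0=+\infty$, limits as $r\to r_0^-$ are understood as limits as $r\to+\infty$. For $u(\cdot)\in L^\infty([0,+\infty);\mathbb R^m)$ and $t_0\geq 0$, $\|u\|_{\infty,t_0}=\operatorname{ess\,sup}_{\tau\ge t_0}|u(\tau)|$. Comparison functions. For $r\in(0,+\infty]$, $\alpha:[0,r)\to[0,+\infty)$ is a $\mathcal K$-function if it is continuous, strictly increasing and $\alpha(0)=0$. A continuous function $\beta:[0,r)\times[0,+\infty)\to[0,+\infty)$ is a $\mathcal{KL}$-function if $\beta(\cdot,t)$ is a $\mathcal K$-function for each $t\ge0$, and for each $s\in[0,r)$ the function $\beta(s,\cdot)$ is decreasing with $\lim_{t\to+\infty}\beta(s,t)=0$. Assumption (A). (1) For each $(x,u)\in D\times\mathbb R^m$, $t\mapsto f(t,x,u)$ is measurable. (2) For each $(t,u)\in[0,+\infty)\times\mathbb R^m$ and each coordinate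 chart $\varphi:U\to\mathbb R^n$ in $D$, the map $z\mapsto d\varphi_{\varphi^{-1}(z)}\bigl(f(t,\varphi^{-1}(z),u)\bigr)$ is locally Lipschitz continuous on $\varphi(U)$. (3) For each $(t,x)\in[0,+\infty)\times D$, $u\mapsto f(t,x,u)$ is continuous. (4) For every $R,r>0$ there exists $I_{R,r}\in L^1_{\mathrm{loc}}([0,+\infty))$ such that $|f(t,x,u)|\le I_{R,r}(t)$ for a.e. $t\in[0,+\infty)$ and all $(x,u)\in D\times\mathbb R^m$ with $\rho(x,x^* )\le R$, $|u|\le r$. Solutions. A map $x:[a,b]\to M$ is absolutely continuous if there is $m\in L^1(a,b)$ with $\rho(x(s),x(t))\le\int_s^t m(\tau)\,d\tau$ for $a\le s\le t\le b$; a curve on an open or half-open interval is locally absolutely continuous if its restriction to each compact subinterval is absolutely continuous. The velocity $\dot x(t)\in T_{x(t)}M$ is defined, at each $t$ where the coordinate representation $\varphi\circ x$ in a chart $\varphi$ about $x(t)$ is differentiable, by $\dot x(t)=d(\varphi^{-1})_{\varphi(x(t))}\bigl((\varphi\circ x)'(t)\bigr)$. For an input $u(\cdot)\in L^\infty([0,+\infty);\mathbb R^m)$, $t_0\ge0$ and $T\in(t_0,+\infty]$, a solution on $[t_0,T)$ is a locally absolutely continuous curve $x:[t_0,T)\to D$ with $\dot x(t)=f(t,x(t),u(t))$ for a.e. $t\in(t_0,T)$. It is a maximal solution if there is no $\widetilde T>T$, $\widetilde T\in(t_0,+\infty]$, and solution $\widetilde x:[t_0,\widetilde T)\to D$ with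 $\widetilde x=x$ on $[t_0,T)$. Regional ISS. The system is regionally ISS in a set $D_1\subseteq D$ containing $x^*$ as an interior point if there exist $\delta>0$, a $\mathcal{KL}$-function $\beta$ whose first-variable domain contains $\{\rho(x,x^* )\mid x\in D_1\}$ and a $\mathcal K$-function $\gamma:[0,\delta)\to[0,+\infty)$ such that for every $t_0\ge0$, every $x_u(t_0)\in D_1$ and every $u(\cdot)\in L^\infty([0,+\infty);\mathbb R^m)$ with $\|u\|_{\infty,t_0}<\delta$, every corresponding maximal solution $x_u(\cdot)$ is defined on $[t_0,+\infty)$ and satisfies $\rho(x_u(t),x^* )\le\beta(\rho(x_u(t_0),x^* ),t-t_0)+\gamma(\|u\|_{\infty,t_0})$ for all $t\ge t_0$. ISS-Lyapunov function. A $C^1$ function $V:[0,+\infty)\times B_{x^*}(r_0)\to\mathbb R$, with time derivative $V_t$ and differential in $x$ denoted $d_xV$, is an ISS-Lyapunov function if there exist $\delta_V\in(0,+\infty]$ and $\mathcal K$-functions $\alpha_1,\alpha_2,\alpha_3:[0,r_0)\to[0,+\infty)$, $\alpha_4:[0,\delta_V)\to[0,r_0)$ such that $\alpha_1(r)\le\alpha_2(r)$ for all $r\in[0,r_0)$; $\alpha_1(\rho(x,x^* ))\le V(t,x)\le\alpha_2(\rho(x,x^* ))$ for all $(t,x)\in[0,+\infty)\times B_{x^*}(r_0)$; and $V_t(t,x)+d_xV(t,x)(f(t,x,u))\le-\alpha_3(\rho(x,x^* ))$ for all $(t,x,u)\in[0,+\infty)\times B_{x^*}(r_0)\times\mathbb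 R^m$ with $|u|<\delta_V$ and $\rho(x,x^* )\ge\alpha_4(|u|)$. *)

theory Defs
  imports "HOL-Analysis.Analysis" "HOL-Probability.Essential_Supremum"
begin

subsection \<open>Smooth manifolds\<close>

text \<open>
  A manifold is a Hausdorff, second countable type \<open>'a\<close> together with a maximal smooth atlas.
  A chart \<open>(U, \<phi>)\<close> consists of its domain and its coordinate map; the values of
  \<open>\<phi>\<close> outside \<open>U\<close> are irrelevant, and the inverse of the chart is
  \<open>inv_into U \<phi>\<close>.
\<close>

type_synonym ('a, 'e) chart = "'a set \<times> ('a \<Rightarrow> 'e)"

text \<open>The next two notions are meant for open sets \<open>S\<close> only.\<close>

primrec C_k_on :: "nat \<Rightarrow> 'e::euclidean_space set \<Rightarrow> ('e \<Rightarrow> 'f::euclidean_space) \<Rightarrow> bool" where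
  "C_k_on 0 S h \<longleftrightarrow> continuous_on S h"
| "C_k_on (Suc k) S h \<longleftrightarrow> (\<forall>z\<in>S. h differentiable (at z)) \<and>
     (\<forall>e. C_k_on k S (\<lambda>z. frechet_derivative h (at z) e))"

definition smooth_on :: "'e::euclidean_space set \<Rightarrow> ('e \<Rightarrow> 'f::euclidean_space) \<Rightarrow> bool" where
  "smooth_on S h \<longleftrightarrow> (\<forall>k. C_k_on k S h)"

definition topological_chart :: "('a::topological_space, 'e::euclidean_space) chart \<Rightarrow> bool" where
  "topological_chart c \<longleftrightarrow> (case c of (U, \<phi>) \<Rightarrow>
     open U \<and> open (\<phi> ` U) \<and> homeomorphism U (\<phi> ` U) \<phi> (inv_into U \<phi>))"

definition smoothly_compatible ::
    "('a, 'e::euclidean_space) chart \<Rightarrow> ('a, 'e) chart \<Rightarrow> bool" where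
  "smoothly_compatible c d \<longleftrightarrow> (case c of (U, \<phi>) \<Rightarrow> case d of (W, \<psi>) \<Rightarrow>
     smooth_on (\<phi> ` (U \<inter> W)) (\<psi> \<circ> inv_into U \<phi>) \<and>
     smooth_on (\<psi> ` (U \<inter> W)) (\<phi> \<circ> inv_into W \<psi>))"

definition smooth_structure :: "('a::topological_space, 'e::euclidean_space) chart set \<Rightarrow> bool" where
  "smooth_structure A \<longleftrightarrow>
     (\<forall>c\<in>A. topological_chart c) \<and>
     (\<Union>(U, \<phi>)\<in>A. U) = UNIV \<and>
     (\<forall>c\<in>A. \<forall>d\<in>A. smoothly_compatible c d) \<and>
     (\<forall>c. topological_chart c \<and> (\<forall>d\<in>A. smoothly_compatible c d) \<longrightarrow> c \<in> A)"


subsection \<open>Tangent vectors\<close>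

text \<open>
  A tangent vector at \<open>x\<close> is the family of its coordinate vectors in all charts about
  \<open>x\<close>, related by the derivatives of the transition maps (and extended by \<open>0\<close> to
  the other indices, so that \<open>\<lambda>_. 0\<close> is the zero vector and the vector space operations
  are pointwise). Thus \<open>d\<phi>\<^sub>x(v)\<close> is \<open>v (U, \<phi>)\<close>, and each
  \<open>v \<mapsto> v (U, \<phi>)\<close> is a linear isomorphism of the tangent space onto
  \<open>'e\<close>.
\<close>

type_synonym ('a, 'e) tangent = "('a, 'e) chart \<Rightarrow> 'e"

definition charts_at :: "('a, 'e) chart set \<Rightarrow> 'a \<Rightarrow> ('a, 'e) chart set" where
  "charts_at A x = {c \<in> A. x \<in> fst c}"

definition tangent_space ::
    "('a, 'e::euclidean_space) chart set \<Rightarrow> 'a \<Rightarrow> ('a, 'e) tangent set" where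
  "tangent_space A x = {v.
     (\<forall>c. c \<notin> charts_at A x \<longrightarrow> v c = 0) \<and>
     (\<forall>(U, \<phi>)\<in>charts_at A x. \<forall>(W, \<psi>)\<in>charts_at A x.
        v (W, \<psi>) = frechet_derivative (\<psi> \<circ> inv_into U \<phi>) (at (\<phi> x)) (v (U, \<phi>)))}"

text \<open>\<open>coord_vector A c x e\<close> is the image of \<open>e\<close> under the differential of the
  inverse of the chart \<open>c\<close> at the coordinates of \<open>x\<close>.\<close>

definition coord_vector ::
    "('a, 'e::euclidean_space) chart set \<Rightarrow> ('a, 'e) chart \<Rightarrow> 'a \<Rightarrow> 'e \<Rightarrow> ('a, 'e) tangent" where
  "coord_vector A c x e = (THE v. v \<in> tangent_space A x \<and> v c = e)"

definition has_velocity ::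
    "('a, 'e::euclidean_space) chart set \<Rightarrow> (real \<Rightarrow> 'a) \<Rightarrow> real \<Rightarrow> ('a, 'e) tangent \<Rightarrow> bool" where
  "has_velocity A x t v \<longleftrightarrow> v \<in> tangent_space A (x t) \<and>
     (\<exists>(U, \<phi>)\<in>charts_at A (x t). ((\<phi> \<circ> x) has_vector_derivative v (U, \<phi>)) (at t))"

definition velocity ::
    "('a, 'e::euclidean_space) chart set \<Rightarrow> (real \<Rightarrow> 'a) \<Rightarrow> real \<Rightarrow> ('a, 'e) tangent" where
  "velocity A x t = (THE v. has_velocity A x t v)"

text \<open>The value does not depend on the chosen chart if \<open>F\<close> is differentiable at \<open>x\<close>.\<close>

definition differential ::
    "('a, 'e::euclidean_space) chart set \<Rightarrow> ('a \<Rightarrow> real) \<Rightarrow> 'a \<Rightarrow> ('a, 'e) tangent \<Rightarrow> real" where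
  "differential A F x v = (let c = (SOME c. c \<in> charts_at A x) in
     frechet_derivative (F \<circ> inv_into (fst c) (snd c)) (at (snd c x)) (v c))"


subsection \<open>Riemannian metric and distance\<close>

type_synonym ('a, 'e) metric = "'a \<Rightarrow> ('a, 'e) tangent \<Rightarrow> ('a, 'e) tangent \<Rightarrow> real"

definition riemannian_metric ::
    "('a::topological_space, 'e::euclidean_space) chart set \<Rightarrow> ('a, 'e) metric \<Rightarrow> bool" where
  "riemannian_metric A g \<longleftrightarrow>
     (\<forall>x. \<forall>v\<in>tangent_space A x. \<forall>w\<in>tangent_space A x. g x v w = g x w v) \<and>
     (\<forall>x. \<forall>v\<in>tangent_space A x. \<forall>w\<in>tangent_space A x. \<forall>z\<in>tangent_space A x. \<forall>a b.
        g x (\<lambda>c. a *\<^sub>R v c + b *\<^sub>R w c) z = a * g x v z + b * g x w z) \<and>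
     (\<forall>x. \<forall>v\<in>tangent_space A x. v \<noteq> (\<lambda>_. 0) \<longrightarrow> 0 < g x v v) \<and>
     (\<forall>(U, \<phi>)\<in>A. \<forall>e e'. smooth_on (\<phi> ` U) (\<lambda>z. let y = inv_into U \<phi> z in
        g y (coord_vector A (U, \<phi>) y e) (coord_vector A (U, \<phi>) y e')))"

definition tnorm :: "('a, 'e) metric \<Rightarrow> 'a \<Rightarrow> ('a, 'e) tangent \<Rightarrow> real" where
  "tnorm g x v = sqrt (g x v v)"

definition C1_curve ::
    "('a::topological_space, 'e::euclidean_space) chart set \<Rightarrow> real \<Rightarrow> real \<Rightarrow> (real \<Rightarrow> 'a) \<Rightarrow> bool" where
  "C1_curve A a b p \<longleftrightarrow> continuous_on {a..b} p \<and>
     (\<forall>(U, \<phi>)\<in>A. let S = {t \<in> {a..b}. p t \<in> U} in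
        \<exists>q. continuous_on S q \<and> (\<forall>t\<in>S. ((\<phi> \<circ> p) has_vector_derivative q t) (at t within S)))"

text \<open>\<open>N\<close> is the set of break points.\<close>

definition piecewise_C1_curve ::
    "('a::topological_space, 'e::euclidean_space) chart set \<Rightarrow> (real \<Rightarrow> 'a) \<Rightarrow> bool" where
  "piecewise_C1_curve A p \<longleftrightarrow> continuous_on {0..1} p \<and>
     (\<exists>N. finite N \<and>
        (\<forall>a b. 0 \<le> a \<and> a < b \<and> b \<le> 1 \<and> {a<..<b} \<inter> N = {} \<longrightarrow> C1_curve A a b p))"

definition curve_length ::
    "('a, 'e::euclidean_space) chart set \<Rightarrow> ('a, 'e) metric \<Rightarrow> (real \<Rightarrow> 'a) \<Rightarrow> real" where
  "curve_length A g p = integral {0..1} (\<lambda>t. tnorm g (p t) (velocity A p t))"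

definition riem_dist ::
    "('a::topological_space, 'e::euclidean_space) chart set \<Rightarrow> ('a, 'e) metric \<Rightarrow> 'a \<Rightarrow> 'a \<Rightarrow> real" where
  "riem_dist A g x y =
     Inf {curve_length A g p | p. piecewise_C1_curve A p \<and> p 0 = x \<and> p 1 = y}"

definition rball ::
    "('a::topological_space, 'e::euclidean_space) chart set \<Rightarrow> ('a, 'e) metric \<Rightarrow> 'a \<Rightarrow> ereal \<Rightarrow> 'a set" where
  "rball A g x r = {y. ereal (riem_dist A g x y) < r}"

definition connected_complete_riemannian ::
    "('a::{t2_space, second_countable_topology}, 'e::euclidean_space) chart set \<Rightarrow> ('a, 'e) metric \<Rightarrow> bool" where
  "connected_complete_riemannian A g \<longleftrightarrow>
     smooth_structure A \<and> riemannian_metric A g \<and>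
     connected (UNIV :: 'a set) \<and> Metric_space.mcomplete UNIV (riem_dist A g)"


subsection \<open>Comparison functions\<close>

definition dom0 :: "ereal \<Rightarrow> real set" where
  "dom0 r = {s. 0 \<le> s \<and> ereal s < r}"

definition K_function :: "ereal \<Rightarrow> (real \<Rightarrow> real) \<Rightarrow> bool" where
  "K_function r \<alpha> \<longleftrightarrow> 0 < r \<and>
     continuous_on (dom0 r) \<alpha> \<and> strict_mono_on (dom0 r) \<alpha> \<and> \<alpha> 0 = 0"

text \<open>Monotonicity in the second variable is not strict: \<open>\<beta> 0\<close> vanishes identically.\<close>

definition KL_function :: "ereal \<Rightarrow> (real \<Rightarrow> real \<Rightarrow> real) \<Rightarrow> bool" where
  "KL_function r \<beta> \<longleftrightarrow>
     continuous_on (dom0 r \<times> {0..}) (\<lambda>(s, t). \<beta> s t) \<and>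
     (\<forall>t\<ge>0. K_function r (\<lambda>s. \<beta> s t)) \<and>
     (\<forall>s\<in>dom0 r. antimono_on {0..} (\<beta> s) \<and> (\<beta> s \<longlongrightarrow> 0) at_top)"


subsection \<open>Inputs and solutions\<close>

definition L_infinity :: "(real \<Rightarrow> 'u::euclidean_space) \<Rightarrow> bool" where
  "L_infinity u \<longleftrightarrow> u \<in> borel_measurable (lebesgue_on {0..}) \<and>
     (\<exists>C. AE t in lebesgue_on {0..}. norm (u t) \<le> C)"

definition Linf_norm :: "real \<Rightarrow> (real \<Rightarrow> 'u::euclidean_space) \<Rightarrow> real" where
  "Linf_norm t\<^sub>0 u = real_of_ereal (esssup (lebesgue_on {t\<^sub>0..}) (\<lambda>t. ereal (norm (u t))))"

text \<open>
  Measurability and continuity of \<open>T\<^sub>xM\<close>-valued maps are expressed in the coordinates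
  \<open>v \<mapsto> v c\<close>. In the second clause \<open>local_lipschitz {t}\<close> is local Lipschitz
  continuity in \<open>z\<close> for the fixed time \<open>t\<close>.
\<close>

definition assumption_A ::
    "('a::topological_space, 'e::euclidean_space) chart set \<Rightarrow> ('a, 'e) metric \<Rightarrow> 'a set \<Rightarrow>
     (real \<Rightarrow> 'a \<Rightarrow> 'u::euclidean_space \<Rightarrow> ('a, 'e) tangent) \<Rightarrow> 'a \<Rightarrow> bool" where
  "assumption_A A g D f xs \<longleftrightarrow>
     (\<forall>x\<in>D. \<forall>u. \<forall>c\<in>charts_at A x. (\<lambda>t. f t x u c) \<in> borel_measurable (lebesgue_on {0..})) \<and>
     (\<forall>t\<ge>0. \<forall>u. \<forall>(U, \<phi>)\<in>A. U \<subseteq> D \<longrightarrow>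
        local_lipschitz {t} (\<phi> ` U) (\<lambda>s z. f s (inv_into U \<phi> z) u (U, \<phi>))) \<and>
     (\<forall>t\<ge>0. \<forall>x\<in>D. \<forall>c\<in>charts_at A x. continuous_on UNIV (\<lambda>u. f t x u c)) \<and>
     (\<forall>R>0. \<forall>r>0. \<exists>I. (\<forall>b\<ge>0. set_integrable lebesgue {0..b} I) \<and>
        (AE t in lebesgue_on {0..}. \<forall>x\<in>D. \<forall>u.
           riem_dist A g x xs \<le> R \<and> norm u \<le> r \<longrightarrow> tnorm g x (f t x u) \<le> I t))"

definition abs_continuous ::
    "('a::topological_space, 'e::euclidean_space) chart set \<Rightarrow> ('a, 'e) metric \<Rightarrow>
     real \<Rightarrow> real \<Rightarrow> (real \<Rightarrow> 'a) \<Rightarrow> bool" where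
  "abs_continuous A g a b x \<longleftrightarrow> (\<exists>k. set_integrable lebesgue {a..b} k \<and>
     (\<forall>s t. a \<le> s \<and> s \<le> t \<and> t \<le> b \<longrightarrow>
        riem_dist A g (x s) (x t) \<le> set_lebesgue_integral lebesgue {s..t} k))"

text \<open>In the following, only the values of \<open>x\<close> on \<open>[t\<^sub>0, T)\<close> matter.\<close>

definition is_solution ::
    "('a::topological_space, 'e::euclidean_space) chart set \<Rightarrow> ('a, 'e) metric \<Rightarrow> 'a set \<Rightarrow>
     (real \<Rightarrow> 'a \<Rightarrow> 'u::euclidean_space \<Rightarrow> ('a, 'e) tangent) \<Rightarrow>
     (real \<Rightarrow> 'u) \<Rightarrow> real \<Rightarrow> ereal \<Rightarrow> (real \<Rightarrow> 'a) \<Rightarrow> bool" where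
  "is_solution A g D f u t\<^sub>0 T x \<longleftrightarrow> ereal t\<^sub>0 < T \<and>
     (\<forall>t. t\<^sub>0 \<le> t \<and> ereal t < T \<longrightarrow> x t \<in> D) \<and>
     (\<forall>a b. t\<^sub>0 \<le> a \<and> a \<le> b \<and> ereal b < T \<longrightarrow> abs_continuous A g a b x) \<and>
     (AE t in lebesgue. t\<^sub>0 < t \<and> ereal t < T \<longrightarrow> has_velocity A x t (f t (x t) (u t)))"

definition maximal_solution ::
    "('a::topological_space, 'e::euclidean_space) chart set \<Rightarrow> ('a, 'e) metric \<Rightarrow> 'a set \<Rightarrow>
     (real \<Rightarrow> 'a \<Rightarrow> 'u::euclidean_space \<Rightarrow> ('a, 'e) tangent) \<Rightarrow>
     (real \<Rightarrow> 'u) \<Rightarrow> real \<Rightarrow> ereal \<Rightarrow> (real \<Rightarrow> 'a) \<Rightarrow> bool" where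
  "maximal_solution A g D f u t\<^sub>0 T x \<longleftrightarrow> is_solution A g D f u t\<^sub>0 T x \<and>
     \<not> (\<exists>T' x'. T < T' \<and> is_solution A g D f u t\<^sub>0 T' x' \<and>
          (\<forall>t. t\<^sub>0 \<le> t \<and> ereal t < T \<longrightarrow> x' t = x t))"


subsection \<open>Regional ISS and ISS-Lyapunov functions\<close>

definition regionally_ISS ::
    "('a::topological_space, 'e::euclidean_space) chart set \<Rightarrow> ('a, 'e) metric \<Rightarrow> 'a set \<Rightarrow>
     (real \<Rightarrow> 'a \<Rightarrow> 'u::euclidean_space \<Rightarrow> ('a, 'e) tangent) \<Rightarrow> 'a \<Rightarrow> 'a set \<Rightarrow> bool" where
  "regionally_ISS A g D f xs D\<^sub>1 \<longleftrightarrow> D\<^sub>1 \<subseteq> D \<and> xs \<in> interior D\<^sub>1 \<and>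
     (\<exists>\<delta> r \<beta> \<gamma>. KL_function r \<beta> \<and> (\<forall>x\<in>D\<^sub>1. riem_dist A g x xs \<in> dom0 r) \<and> K_function \<delta> \<gamma> \<and>
        (\<forall>t\<^sub>0\<ge>0. \<forall>u T x. L_infinity u \<and> ereal (Linf_norm t\<^sub>0 u) < \<delta> \<and>
           maximal_solution A g D f u t\<^sub>0 T x \<and> x t\<^sub>0 \<in> D\<^sub>1 \<longrightarrow>
           T = \<infinity> \<and>
           (\<forall>t\<ge>t\<^sub>0. riem_dist A g (x t) xs
              \<le> \<beta> (riem_dist A g (x t\<^sub>0) xs) (t - t\<^sub>0) + \<gamma> (Linf_norm t\<^sub>0 u))))"

text \<open>At the boundary points \<open>t = 0\<close> of \<open>[0, \<infinity>) \<times> B\<close> the derivatives are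
  one-sided in time.\<close>

definition C1_on :: "'e::euclidean_space set \<Rightarrow> ('e \<Rightarrow> real) \<Rightarrow> bool" where
  "C1_on S h \<longleftrightarrow> (\<exists>h'. continuous_on S h' \<and>
     (\<forall>p\<in>S. (h has_derivative blinfun_apply (h' p)) (at p within S)))"

definition C1_time_space ::
    "('a::topological_space, 'e::euclidean_space) chart set \<Rightarrow> 'a set \<Rightarrow> (real \<Rightarrow> 'a \<Rightarrow> real) \<Rightarrow> bool" where
  "C1_time_space A B V \<longleftrightarrow> (\<forall>(U, \<phi>)\<in>A. U \<subseteq> B \<longrightarrow>
     C1_on ({0..} \<times> \<phi> ` U) (\<lambda>(t, z). V t (inv_into U \<phi> z)))"

definition time_derivative :: "(real \<Rightarrow> 'a \<Rightarrow> real) \<Rightarrow> real \<Rightarrow> 'a \<Rightarrow> real" where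
  "time_derivative V t x = vector_derivative (\<lambda>s. V s x) (at t within {0..})"

definition r_zero ::
    "('a::topological_space, 'e::euclidean_space) chart set \<Rightarrow> ('a, 'e) metric \<Rightarrow> 'a set \<Rightarrow> 'a \<Rightarrow> ereal" where
  "r_zero A g D xs = Sup {r. 0 < r \<and> rball A g xs r \<subseteq> D}"

definition ISS_Lyapunov ::
    "('a::topological_space, 'e::euclidean_space) chart set \<Rightarrow> ('a, 'e) metric \<Rightarrow>
     (real \<Rightarrow> 'a \<Rightarrow> 'u::euclidean_space \<Rightarrow> ('a, 'e) tangent) \<Rightarrow> 'a \<Rightarrow> ereal \<Rightarrow>
     (real \<Rightarrow> 'a \<Rightarrow> real) \<Rightarrow> ereal \<Rightarrow>
     (real \<Rightarrow> real) \<Rightarrow> (real \<Rightarrow> real) \<Rightarrow> (real \<Rightarrow> real) \<Rightarrow> (real \<Rightarrow> real) \<Rightarrow> bool" where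
  "ISS_Lyapunov A g f xs r\<^sub>0 V \<delta> \<alpha>\<^sub>1 \<alpha>\<^sub>2 \<alpha>\<^sub>3 \<alpha>\<^sub>4 \<longleftrightarrow>
     C1_time_space A (rball A g xs r\<^sub>0) V \<and>
     K_function r\<^sub>0 \<alpha>\<^sub>1 \<and> K_function r\<^sub>0 \<alpha>\<^sub>2 \<and> K_function r\<^sub>0 \<alpha>\<^sub>3 \<and>
     K_function \<delta> \<alpha>\<^sub>4 \<and> \<alpha>\<^sub>4 ` dom0 \<delta> \<subseteq> dom0 r\<^sub>0 \<and>
     (\<forall>r\<in>dom0 r\<^sub>0. \<alpha>\<^sub>1 r \<le> \<alpha>\<^sub>2 r) \<and>
     (\<forall>t\<ge>0. \<forall>x\<in>rball A g xs r\<^sub>0.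
        \<alpha>\<^sub>1 (riem_dist A g x xs) \<le> V t x \<and> V t x \<le> \<alpha>\<^sub>2 (riem_dist A g x xs)) \<and>
     (\<forall>t\<ge>0. \<forall>x\<in>rball A g xs r\<^sub>0. \<forall>u.
        ereal (norm u) < \<delta> \<and> \<alpha>\<^sub>4 (norm u) \<le> riem_dist A g x xs \<longrightarrow>
        time_derivative V t x + differential A (V t) x (f t x u) \<le> - \<alpha>\<^sub>3 (riem_dist A g x xs))"

text \<open>The limit is taken in the extended reals, so \<open>at_left \<infinity>\<close> stands for
  \<open>r \<rightarrow> +\<infinity>\<close> and \<open>+\<infinity>\<close> is an admissible value.\<close>

definition r_V :: "ereal \<Rightarrow> (real \<Rightarrow> real) \<Rightarrow> (real \<Rightarrow> real) \<Rightarrow> ereal" where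
  "r_V r\<^sub>0 \<alpha>\<^sub>1 \<alpha>\<^sub>2 =
     Lim (at_left r\<^sub>0) (\<lambda>r. ereal (inv_into (dom0 r\<^sub>0) \<alpha>\<^sub>2 (\<alpha>\<^sub>1 (real_of_ereal r))))"

definition r_V_hat :: "ereal \<Rightarrow> (real \<Rightarrow> real) \<Rightarrow> ereal \<Rightarrow> ereal" where
  "r_V_hat \<delta> \<alpha>\<^sub>4 rV = Sup (ereal ` {s \<in> dom0 \<delta>. ereal (\<alpha>\<^sub>4 s) < rV})"

end

theory Submission
  imports Defs "HOL-Complex_Analysis.Great_Picard"
begin

text \<open>
  Along a trajectory the function \<open>W t = V t (x t)\<close> is absolutely continuous, and while it stays
  above the level \<open>\<mu> = \<alpha>\<^sub>2 (\<alpha>\<^sub>4 \<parallel>u\<parallel>)\<close> it decreases at rate at least \<open>\<alpha>\<^sub>3 (\<alpha>\<^sub>2\<^sup>-\<^sup>1 W)\<close>. This rate is nondecreasing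
  in \<open>W\<close>, so before the level \<open>\<mu>\<close> is reached \<open>W t + (t - t\<^sub>0) * \<alpha>\<^sub>3 (\<alpha>\<^sub>2\<^sup>-\<^sup>1 (W t)) \<le> W t\<^sub>0\<close>. Solving this
  inequality for \<open>W t\<close> gives an explicit \<open>\<K>\<L>\<close>-bound, without a scalar comparison equation, and the
  invariance of the sublevel set of \<open>\<mu>\<close> gives the gain \<open>\<alpha>\<^sub>1\<^sup>-\<^sup>1 \<circ> \<alpha>\<^sub>2 \<circ> \<alpha>\<^sub>4\<close>. Hence the trajectory stays in
  a closed metric ball inside \<open>D\<close>. There the speed is bounded by a locally integrable function of
  time, so by completeness a solution on a bounded time interval has a limit in \<open>D\<close>, and
  Caratheodory's existence theorem in a chart about the limit continues it: maximal solutions are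
  global.
\<close>

subsection \<open>Real analysis in one variable\<close>

text \<open>A solution has a velocity only almost everywhere, and a derivative bound off a null set
  controls increments only together with an integrable majorant of them; the Cantor function is the
  warning. Hence the monotonicity steps go through
  \<open>absolutely_continuous_increment_le\<close>, and the functions it is applied to must first
  be shown locally Lipschitz in time and distance. Absolute continuity is measured by the Riemannian
  distance, while the equation is solved in charts. A local bi-Lipschitz comparison links the two;
  its lower half must also handle curves that leave the chart. Assumption (A) gives local Lipschitz
  constants for each separate time and input value, without integrability in time, so a contraction
  argument is out of reach and existence rests on compactness. The estimates for \<open>W\<close>
  presuppose that the trajectory lies in the ball where \<open>V\<close> lives. The strict
  inequality \<alpha>2 s < \<alpha>1 r, available for some r < r0 whenever s < r_V, breaks this
  circle: at a first exit time from radius r the estimate would already give a radius below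
  r.\<close>

text \<open>The Vitali theorem extracts disjoint intervals on which the integral misses its tagged
  value by more than length over \<open>n\<close>. A finite subfamily is a fine tagged partial
  division, so Henstock's lemma bounds its summed errors by \<open>e / n\<close> and hence its total
  length by \<open>e\<close>.\<close>

lemma negligible_henstock_small:
  fixes f :: "real \<Rightarrow> 'e::euclidean_space"
  assumes f: "f integrable_on {a..b}" and "0 < e" and "0 < n"
    and S: "S \<subseteq> {a<..<b}"
    and bad: "\<And>x d. x \<in> S \<Longrightarrow> 0 < d \<Longrightarrow>
      \<exists>u v. u < v \<and> u \<le> x \<and> x \<le> v \<and> x - d < u \<and> v < x + d \<and> a \<le> u \<and> v \<le> b \<and>
        (v - u) / n < norm ((v - u) *\<^sub>R f x - integral {u..v} f)"
  shows "\<exists>T. S \<subseteq> T \<and> T \<in> lmeasurable \<and> measure lebesgue T \<le> e"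
proof -
  have en: "0 < e / n"
    using \<open>0 < e\<close> \<open>0 < n\<close> by simp
  have "f integrable_on cbox a b"
    using f by simp
  from Henstock_lemma[OF this en] obtain \<gamma> where \<gamma>: "gauge \<gamma>"
    and hen: "\<And>p. p tagged_partial_division_of cbox a b \<Longrightarrow> \<gamma> fine p \<Longrightarrow>
      (\<Sum>(x,k)\<in>p. norm (measure lborel k *\<^sub>R f x - integral k f)) < e / n"
    by blast
  \<comment> \<open>An index is a tag together with the endpoints of its interval. Keeping only
    intervals inside \<open>\<gamma> x\<close> makes every finite subfamily fine; the centre
    \<open>c\<close> and radius \<open>r\<close> present the interval as the closed ball that the
    Vitali theorem expects.\<close>
  define I where "I = {(x, u, v). x \<in> S \<and> u < v \<and> u \<le> x \<and> x \<le> v \<and> a \<le> u \<and> v \<le> b \<and> {u..v} \<subseteq> \<gamma> x \<and>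
        (v - u) / n < norm ((v - u) *\<^sub>R f x - integral {u..v} f)}"
  define c where "c = (\<lambda>(x::real, u, v). (u + v) / 2 :: real)"
  define r where "r = (\<lambda>(x::real, u, v). (v - u) / 2 :: real)"
  have cb: "cball (c i) (r i) = {fst (snd i)..snd (snd i)}" for i
    by (cases i) (auto simp: c_def r_def cball_eq_atLeastAtMost field_simps)
  have "\<And>i. i \<in> I \<Longrightarrow> 0 < r i"
    by (auto simp: I_def r_def)
  moreover have "\<exists>i. i \<in> I \<and> x \<in> cball (c i) (r i) \<and> r i < d" if x: "x \<in> S" and d: "0 < d" for x d
  proof -
    have "open (\<gamma> x)" "x \<in> \<gamma> x"
      using \<gamma> by (auto simp: gauge_def)
    then obtain d' where d': "0 < d'" "ball x d' \<subseteq> \<gamma> x"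
      using open_contains_ball by blast
    have "0 < min d d'"
      using d d' by simp
    from bad[OF x this] obtain u v where uv: "u < v" "u \<le> x" "x \<le> v" "x - min d d' < u" "v < x + min d d'"
        "a \<le> u" "v \<le> b" "(v - u) / n < norm ((v - u) *\<^sub>R f x - integral {u..v} f)"
      by blast
    have "{u..v} \<subseteq> ball x d'"
      using uv by (auto simp: dist_real_def)
    then have "(x, u, v) \<in> I"
      using x uv d' unfolding I_def by blast
    moreover have "x \<in> cball (c (x, u, v)) (r (x, u, v))"
      using uv by (simp add: cb)
    moreover have "r (x, u, v) < d"
      using uv by (simp add: r_def)
    ultimately show ?thesis
      by blast
  qed
  ultimately obtain C where C: "countable C" "C \<subseteq> I"
      "pairwise (\<lambda>i j. disjnt (cball (c i) (r i)) (cball (c j) (r j))) C"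
      "negligible (S - (\<Union>i\<in>C. cball (c i) (r i)))"
    by (rule Vitali_covering_theorem_cballs[of I r S c]) blast+
  define J where "J i = {fst (snd i)..snd (snd i)}" for i :: "real \<times> real \<times> real"
  have le: "measure lebesgue (\<Union>i\<in>F. J i) \<le> e" if F: "F \<subseteq> C" "finite F" for F
  proof -
    define p where "p = (\<lambda>i. (fst i, J i)) ` F"
    have inI: "i \<in> I" if "i \<in> F" for i
      using that F C by blast
    have dj: "J i \<inter> J j = {}" if "i \<in> F" "j \<in> F" "i \<noteq> j" for i j
      using C(3) that F unfolding pairwise_def disjnt_def cb J_def by blast
    have ne: "J i \<noteq> {}" if "i \<in> F" for i
      using inI[OF that] by (auto simp: J_def I_def)
    \<comment> \<open>Disjoint nonempty intervals are distinct, so passing from indices to tagged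
      pairs loses nothing and the Henstock sum can be reindexed.\<close>
    have inj: "inj_on (\<lambda>i. (fst i, J i)) F"
      using dj ne unfolding inj_on_def by (metis inf.idem snd_conv)
    have "p tagged_partial_division_of cbox a b"
      unfolding tagged_partial_division_of_def
    proof (intro conjI allI impI)
      show "finite p"
        using F by (simp add: p_def)
    next
      fix x K assume "(x, K) \<in> p"
      then obtain i where i: "i \<in> F" "x = fst i" "K = J i"
        by (auto simp: p_def)
      show "x \<in> K" "K \<subseteq> cbox a b" "\<exists>a b. K = cbox a b"
        using inI[OF i(1)] i by (auto simp: I_def J_def intro: exI)
    next
      fix x1 K1 x2 K2 assume *: "(x1, K1) \<in> p \<and> (x2, K2) \<in> p \<and> (x1, K1) \<noteq> (x2, K2)"
      obtain i where "i \<in> F" "(x1, K1) = (fst i, J i)"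
        using * unfolding p_def by blast
      moreover obtain j where "j \<in> F" "(x2, K2) = (fst j, J j)"
        using * unfolding p_def by blast
      moreover note *
      ultimately have "K1 \<inter> K2 = {}"
        using dj[of i j] by auto
      then show "interior K1 \<inter> interior K2 = {}"
        using interior_subset by blast
    qed
    moreover have "\<gamma> fine p"
      unfolding fine_def p_def using inI by (fastforce simp: I_def J_def)
    ultimately have "(\<Sum>(x,k)\<in>p. norm (measure lborel k *\<^sub>R f x - integral k f)) < e / n"
      by (rule hen)
    then have s: "(\<Sum>i\<in>F. norm (measure lborel (J i) *\<^sub>R f (fst i) - integral (J i) f)) < e / n"
      unfolding p_def by (subst (asm) sum.reindex[OF inj]) (simp add: o_def)
    have "measure lebesgue (\<Union>i\<in>F. J i) \<le> (\<Sum>i\<in>F. measure lebesgue (J i))"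
      by (rule measure_UNION_le) (auto simp: F J_def)
    also have "\<dots> \<le> (\<Sum>i\<in>F. n * norm (measure lborel (J i) *\<^sub>R f (fst i) - integral (J i) f))"
    proof (rule sum_mono)
      fix i assume i: "i \<in> F"
      show "measure lebesgue (J i) \<le> n * norm (measure lborel (J i) *\<^sub>R f (fst i) - integral (J i) f)"
        using inI[OF i] \<open>0 < n\<close> by (cases i) (auto simp: I_def J_def field_simps)
    qed
    also have "\<dots> \<le> n * (e / n)"
      unfolding sum_distrib_left[symmetric] using s \<open>0 < n\<close> by (intro mult_left_mono) auto
    finally show ?thesis
      using \<open>0 < n\<close> by simp
  qed
  have U: "(\<Union>i\<in>C. J i) \<in> lmeasurable" "measure lebesgue (\<Union>i\<in>C. J i) \<le> e"
    using fmeasurable_UN_bound[of C J lebesgue e] measure_UN_bound[of C J lebesgue e] le C(1) \<open>0 < e\<close>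
    by (auto simp: J_def)
  let ?N = "S - (\<Union>i\<in>C. J i)"
  have N: "negligible ?N"
    using C(4) by (simp add: cb J_def)
  show ?thesis
  proof (intro exI[of _ "(\<Union>i\<in>C. J i) \<union> ?N"] conjI)
    show "(\<Union>i\<in>C. J i) \<union> ?N \<in> lmeasurable"
      by (intro fmeasurable.Un U negligible_imp_measurable N)
    have "measure lebesgue ((\<Union>i\<in>C. J i) \<union> ?N) \<le> measure lebesgue (\<Union>i\<in>C. J i) + measure lebesgue ?N"
      by (intro measure_Un_le fmeasurableD U negligible_imp_measurable N)
    then show "measure lebesgue ((\<Union>i\<in>C. J i) \<union> ?N) \<le> e"
      using U negligible_imp_measure0[OF N] by simp
  qed auto
qed

text \<open>Lebesgue differentiation for the gauge integral. Where the derivative fails, some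
  threshold \<open>1 / (k + 1)\<close> is exceeded on arbitrarily short intervals around the point;
  each threshold contributes a negligible set and there are countably many of them.\<close>

theorem integral_has_vector_derivative_AE:
  fixes f :: "real \<Rightarrow> 'e::euclidean_space"
  assumes f: "f integrable_on {a..b}"
  shows "negligible {x \<in> {a<..<b}. \<not> ((\<lambda>t. integral {a..t} f) has_vector_derivative f x) (at x)}"
proof -
  define bad where "bad k x u v \<longleftrightarrow> u < v \<and> u \<le> x \<and> x \<le> v \<and> a \<le> u \<and> v \<le> b \<and>
      (v - u) / real (Suc k) < norm ((v - u) *\<^sub>R f x - integral {u..v} f)" for k x u v
  define S where "S k = {x \<in> {a<..<b}. \<forall>d>0. \<exists>u v. x - d < u \<and> v < x + d \<and> bad k x u v}" for k
  have "negligible (S k)" for k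
    unfolding negligible_outer_le
  proof (intro allI impI)
    fix e :: real assume "0 < e"
    show "\<exists>T. S k \<subseteq> T \<and> T \<in> lmeasurable \<and> measure lebesgue T \<le> e"
    proof (rule negligible_henstock_small[OF f \<open>0 < e\<close>, of "real (Suc k)"])
      fix x d :: real assume "x \<in> S k" "0 < d"
      then obtain u v where "x - d < u" "v < x + d" "bad k x u v"
        unfolding S_def by blast
      then show "\<exists>u v. u < v \<and> u \<le> x \<and> x \<le> v \<and> x - d < u \<and> v < x + d \<and> a \<le> u \<and> v \<le> b \<and>
          (v - u) / real (Suc k) < norm ((v - u) *\<^sub>R f x - integral {u..v} f)"
        unfolding bad_def by blast
    qed (auto simp: S_def)
  qed
  then have neg: "negligible (\<Union>k. S k)"
    by (intro negligible_countable_Union) auto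
  have der: "((\<lambda>t. integral {a..t} f) has_vector_derivative f x) (at x)"
    if x: "x \<in> {a<..<b}" "x \<notin> (\<Union>k. S k)" for x
    unfolding has_vector_derivative_def has_derivative_at_alt
  proof (intro conjI allI impI)
    show "bounded_linear (\<lambda>h. h *\<^sub>R f x)"
      by (rule bounded_linear_scaleR_left)
    fix e :: real assume "0 < e"
    then obtain k where k: "1 / real (Suc k) < e"
      using nat_approx_posE by blast
    have "x \<notin> S k"
      using x by blast
    then obtain d where d: "0 < d" and nb: "\<And>u v. x - d < u \<Longrightarrow> v < x + d \<Longrightarrow> \<not> bad k x u v"
      using x(1) unfolding S_def by blast
    have good: "u < v \<Longrightarrow> u \<le> x \<Longrightarrow> x \<le> v \<Longrightarrow> x - d < u \<Longrightarrow> v < x + d \<Longrightarrow>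
      a \<le> u \<Longrightarrow> v \<le> b \<Longrightarrow> norm ((v - u) *\<^sub>R f x - integral {u..v} f) \<le> (v - u) / real (Suc k)" for u v
      using nb[of u v] unfolding bad_def by linarith
    show "\<exists>d>0. \<forall>y. norm (y - x) < d \<longrightarrow>
        norm (integral {a..y} f - integral {a..x} f - (y - x) *\<^sub>R f x) \<le> e * norm (y - x)"
    proof (intro exI[of _ "min d (min (x - a) (b - x))"] conjI allI impI)
      show "0 < min d (min (x - a) (b - x))"
        using d x by auto
      fix y assume y: "norm (y - x) < min d (min (x - a) (b - x))"
      have int: "f integrable_on {u..v}" if "a \<le> u" "v \<le> b" for u v
        using integrable_subinterval_real[OF f] that by auto
      have le: "t / real (Suc k) \<le> e * t" if "0 \<le> t" for t
      proof -
        have "1 / real (Suc k) * t \<le> e * t"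
          using k that by (intro mult_right_mono) auto
        then show ?thesis by simp
      qed
      consider "x < y" | "y < x" | "x = y" by linarith
      then show "norm (integral {a..y} f - integral {a..x} f - (y - x) *\<^sub>R f x) \<le> e * norm (y - x)"
      proof cases
        case 1
        then have c: "integral {a..y} f = integral {a..x} f + integral {x..y} f"
          using Henstock_Kurzweil_Integration.integral_combine[of a x y f] x y int[of a y] by (auto simp: abs_if)
        have "norm ((y - x) *\<^sub>R f x - integral {x..y} f) \<le> (y - x) / real (Suc k)"
          using 1 x y by (intro good) (auto simp: abs_if)
        then have "norm ((y - x) *\<^sub>R f x - integral {x..y} f) \<le> e * (y - x)"
          using le[of "y - x"] 1 by linarith
        then show ?thesis
          using 1 by (simp add: c norm_minus_commute)
      next
        case 2
        then have c: "integral {a..x} f = integral {a..y} f + integral {y..x} f"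
          using Henstock_Kurzweil_Integration.integral_combine[of a y x f] x y int[of a x] by (auto simp: abs_if)
        have "norm ((x - y) *\<^sub>R f x - integral {y..x} f) \<le> (x - y) / real (Suc k)"
          using 2 x y by (intro good) (auto simp: abs_if)
        then have "norm ((x - y) *\<^sub>R f x - integral {y..x} f) \<le> e * (x - y)"
          using le[of "x - y"] 2 by linarith
        then show ?thesis
          using 2 by (simp add: c algebra_simps)
      qed simp
    qed
  qed
  show ?thesis
    by (rule negligible_subset[OF neg]) (use der in blast)
qed

text \<open>The Henstock gauge of \<open>k\<close>, set to zero on the exceptional set, bounds the contribution of the
  subintervals tagged there.\<close>

theorem absolutely_continuous_increment_le:
  fixes w k J :: "real \<Rightarrow> real"
  assumes ab: "a \<le> b" and k: "k integrable_on {a..b}" and J: "J integrable_on {a..b}"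
    and ac: "\<And>s t. a \<le> s \<Longrightarrow> s \<le> t \<Longrightarrow> t \<le> b \<Longrightarrow> \<bar>w t - w s\<bar> \<le> integral {s..t} k"
    and N: "negligible N"
    and dini: "\<And>t e. t \<in> {a..b} - N \<Longrightarrow> 0 < e \<Longrightarrow>
      \<exists>d>0. \<forall>u v. u \<le> t \<and> t \<le> v \<and> t - d < u \<and> v < t + d \<and> a \<le> u \<and> v \<le> b \<longrightarrow> w v - w u \<le> (J t + e) * (v - u)"
  shows "w b - w a \<le> integral {a..b} J"
proof (rule field_le_epsilon)
  fix e0 :: real assume "0 < e0"
  \<comment> \<open>The two Henstock sums cost \<open>e\<close> each, and the slack in the increment
    bound costs \<open>e\<close> times the length \<open>b - a\<close>.\<close>
  define e where "e = e0 / (2 + (b - a))"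
  have e: "0 < e" "e0 = e * (2 + (b - a))"
    using \<open>0 < e0\<close> ab by (auto simp: e_def)
  define k' where "k' t = (if t \<in> N then 0 else k t)" for t
  define J' where "J' t = (if t \<in> N then 0 else J t)" for t
  have k'i: "k' integrable_on cbox a b" and J'i: "J' integrable_on cbox a b"
    using integrable_spike[OF k N, of k'] integrable_spike[OF J N, of J'] by (auto simp: k'_def J'_def)
  have ik: "integral S k' = integral S k" for S
    by (rule integral_spike[OF N]) (simp add: k'_def)
  have iJ: "integral S J' = integral S J" for S
    by (rule integral_spike[OF N]) (simp add: J'_def)
  from Henstock_lemma[OF k'i \<open>0 < e\<close>] obtain g1 where g1: "gauge g1"
    "\<And>p. p tagged_partial_division_of cbox a b \<Longrightarrow> g1 fine p \<Longrightarrow>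
      (\<Sum>(x,K)\<in>p. norm (measure lborel K *\<^sub>R k' x - integral K k')) < e" by blast
  from Henstock_lemma[OF J'i \<open>0 < e\<close>] obtain g2 where g2: "gauge g2"
    "\<And>p. p tagged_partial_division_of cbox a b \<Longrightarrow> g2 fine p \<Longrightarrow>
      (\<Sum>(x,K)\<in>p. norm (measure lborel K *\<^sub>R J' x - integral K J')) < e" by blast
  have "\<forall>t. \<exists>d>0. t \<in> {a..b} - N \<longrightarrow> (\<forall>u v. u \<le> t \<and> t \<le> v \<and> t - d < u \<and> v < t + d \<and> a \<le> u \<and> v \<le> b \<longrightarrow>
      w v - w u \<le> (J t + e) * (v - u))"
    using dini \<open>0 < e\<close> by (metis zero_less_one)
  then obtain d where d: "\<And>t. 0 < d t" "\<And>t u v. t \<in> {a..b} - N \<Longrightarrow> u \<le> t \<Longrightarrow> t \<le> v \<Longrightarrow> t - d t < u \<Longrightarrow> v < t + d t \<Longrightarrow>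
      a \<le> u \<Longrightarrow> v \<le> b \<Longrightarrow> w v - w u \<le> (J t + e) * (v - u)"
    by metis
  have g3: "gauge (\<lambda>t. ball t (d t))"
    using d(1) by (intro gauge_ball_dependent) auto
  have "gauge (\<lambda>t. g1 t \<inter> (g2 t \<inter> ball t (d t)))"
    using g1 g2 g3 by (intro gauge_Int)
  from fine_division_exists_real[OF this] obtain p where p: "p tagged_division_of {a..b}"
    "(\<lambda>t. g1 t \<inter> (g2 t \<inter> ball t (d t))) fine p" by blast
  have pp: "p tagged_partial_division_of cbox a b"
    using p(1) by (auto simp: tagged_division_of_def)
  have f12: "g1 fine p" "g2 fine p"
    using p(2) by (auto simp: fine_def)
  let ?h = "\<lambda>(x,K). norm (measure lborel K *\<^sub>R k' x - integral K k') + norm (measure lborel K *\<^sub>R J' x - integral K J')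
      + integral K J' + e * measure lborel K"
  have "w b - w a = (\<Sum>(x,K)\<in>p. w (Sup K) - w (Inf K))"
    using additive_tagged_division_1[OF ab p(1), of w] by simp
  also have "\<dots> \<le> (\<Sum>i\<in>p. ?h i)"
  proof (rule sum_mono, clarify)
    fix x K assume xK: "(x, K) \<in> p"
    obtain u v where K: "K = {u..v}" "u \<le> v" "x \<in> {u..v}" "{u..v} \<subseteq> {a..b}"
      using tagged_division_ofD(2,3,4)[OF p(1) xK] by (auto simp: box_real)
    have S: "Sup K = v" "Inf K = u" "measure lborel K = v - u"
      using K by auto
    have ac': "w v - w u \<le> integral {u..v} k"
      using ac[of u v] K by auto
    show "w (Sup K) - w (Inf K) \<le> norm (measure lborel K *\<^sub>R k' x - integral K k') + norm (measure lborel K *\<^sub>R J' x - integral K J')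
      + integral K J' + e * measure lborel K"
    proof (cases "x \<in> N")
      \<comment> \<open>Here \<open>k' x\<close> and \<open>J' x\<close> vanish, so the first
        Henstock error is the absolute value of the integral of \<open>k\<close> over
        \<open>K\<close>, which dominates the increment; the second one offsets a possibly negative
        integral of \<open>J\<close>.\<close>
      case True
      have "0 \<le> e * measure lborel K"
        using e by simp
      then show ?thesis
        unfolding S using True ac' by (simp add: K k'_def[of x] J'_def[of x] ik)
    next
      case False
      have "K \<subseteq> ball x (d x)"
        using p(2) xK by (auto simp: fine_def)
      then have "u \<in> ball x (d x)" "v \<in> ball x (d x)" "u \<in> {a..b}" "v \<in> {a..b}"
        using K by (auto simp del: mem_ball)
      then have "w v - w u \<le> (J x + e) * (v - u)"
        using K False by (intro d(2)) (auto simp: dist_real_def)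
      also have "\<dots> = measure lborel K *\<^sub>R J' x + e * measure lborel K"
        using False by (simp add: S J'_def algebra_simps)
      finally show ?thesis
        unfolding S(1,2) by (smt (verit) norm_ge_zero real_norm_def)
    qed
  qed
  also have "\<dots> = (\<Sum>(x,K)\<in>p. norm (measure lborel K *\<^sub>R k' x - integral K k'))
      + (\<Sum>(x,K)\<in>p. norm (measure lborel K *\<^sub>R J' x - integral K J')) + (\<Sum>(x,K)\<in>p. integral K J') + e * (\<Sum>(x,K)\<in>p. measure lborel K)"
    by (simp add: split_def sum.distrib sum_distrib_left)
  also have "(\<Sum>(x,K)\<in>p. measure lborel K) = b - a"
    using additive_content_tagged_division[of p a b] p(1) ab by simp
  also have "(\<Sum>(x,K)\<in>p. integral K J') = integral {a..b} J"
    using integral_combine_tagged_division_topdown[of J' a b p] J'i p(1) by (simp add: iJ)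
  also have "(\<Sum>(x,K)\<in>p. norm (measure lborel K *\<^sub>R k' x - integral K k')) < e"
    using f12 by (intro g1(2)[OF pp])
  also have "(\<Sum>(x,K)\<in>p. norm (measure lborel K *\<^sub>R J' x - integral K J')) < e"
    using f12 by (intro g2(2)[OF pp])
  finally show "w b - w a \<le> integral {a..b} J + e0"
    unfolding e(2) by (simp add: algebra_simps)
qed

section \<open>Caratheodory's existence theorem in Euclidean space\<close>

text \<open>Along a simple function the composition is measurable, since only finitely many of the
  maps \<open>\<lambda>t. F t z\<close> are involved; continuity in the second argument carries this
  to the pointwise limit of simple functions.\<close>

lemma borel_measurable_caratheodory:
  fixes F :: "'x \<Rightarrow> 'e::euclidean_space \<Rightarrow> 'f::euclidean_space"
  assumes meas: "\<And>z. (\<lambda>t. F t z) \<in> borel_measurable M"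
    and cont: "\<And>t. t \<in> space M \<Longrightarrow> continuous_on UNIV (F t)"
    and y: "y \<in> borel_measurable M"
  shows "(\<lambda>t. F t (y t)) \<in> borel_measurable M"
proof -
  obtain S where S: "\<And>i. simple_function M (S i)" "\<And>x. x \<in> space M \<Longrightarrow> (\<lambda>i. S i x) \<longlonglongrightarrow> y x"
    using borel_measurable_implies_sequence_metric[OF y] by blast
  show ?thesis
  proof (rule borel_measurable_LIMSEQ_metric)
    fix i
    have fin: "finite (S i ` space M)"
      using S(1) by (rule simple_functionD)
    have "S i \<in> measurable M (count_space (S i ` space M))"
      unfolding measurable_count_space_eq2[OF fin] using S(1)[of i] by (auto simp: simple_function_def)
    then show "(\<lambda>t. F t (S i t)) \<in> borel_measurable M"
      using measurable_compose_countable'[of "S i ` space M" "\<lambda>z t. F t z" M borel "S i"] meas fin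
      by (simp add: countable_finite)
  next
    fix t assume t: "t \<in> space M"
    show "(\<lambda>i. F t (S i t)) \<longlonglongrightarrow> F t (y t)"
      by (rule continuous_on_tendsto_compose[OF cont[OF t] S(2)[OF t]]) auto
  qed
qed

lemma continuous_imp_caratheodory_integrable:
  fixes F :: "real \<Rightarrow> 'e::euclidean_space \<Rightarrow> 'f::euclidean_space"
  assumes meas: "\<And>z. (\<lambda>t. F t z) \<in> borel_measurable (lebesgue_on {a..b})"
    and cont: "\<And>t. t \<in> {a..b} \<Longrightarrow> continuous_on UNIV (F t)"
    and m: "m integrable_on {a..b}"
    and bound: "\<And>t z. t \<in> {a..b} \<Longrightarrow> norm (F t z) \<le> m t"
    and y: "continuous_on {a..b} y"
  shows "(\<lambda>s. F s (y s)) absolutely_integrable_on {a..b}"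
proof (rule measurable_bounded_by_integrable_imp_absolutely_integrable[OF _ _ m])
  show "(\<lambda>s. F s (y s)) \<in> borel_measurable (lebesgue_on {a..b})"
  proof (rule borel_measurable_caratheodory[OF meas])
    show "continuous_on UNIV (F t)" if "t \<in> space (lebesgue_on {a..b})" for t
      using cont that by simp
    show "y \<in> borel_measurable (lebesgue_on {a..b})"
      by (rule continuous_imp_measurable_on_sets_lebesgue[OF y]) simp
  qed
qed (auto simp: bound)

text \<open>The method of steps: at time \<open>t\<close> the right-hand side sees \<open>y\<close>
  only up to \<open>t - h\<close>, so each application of the integral operator makes the iterate
  correct on a further interval of length \<open>h\<close>, and finitely many applications reach
  \<open>b\<close>.\<close>

lemma delayed_integral_equation:
  fixes F :: "real \<Rightarrow> 'e::euclidean_space \<Rightarrow> 'e"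
  assumes int: "\<And>y. continuous_on {a..b} y \<Longrightarrow> (\<lambda>s. F s (y s)) integrable_on {a..b}"
    and h: "0 < h"
  obtains y where "continuous_on {a..b} y"
    "\<And>t. t \<in> {a..b} \<Longrightarrow> y t = c + integral {a..max a (t - h)} (\<lambda>s. F s (y s))"
proof -
  define \<Phi> where "\<Phi> y t = c + integral {a..max a (t - h)} (\<lambda>s. F s (y s))" for y t
  have cont: "continuous_on {a..b} (\<Phi> y)" if "continuous_on {a..b} y" for y
  proof -
    have "continuous_on {a..b} (\<lambda>t. integral {a..t} (\<lambda>s. F s (y s)))"
      by (rule indefinite_integral_continuous_1[OF int[OF that]])
    then have "continuous_on {a..b} (\<lambda>t. integral {a..max a (t - h)} (\<lambda>s. F s (y s)))"
      by (rule continuous_on_compose2) (use h in \<open>auto intro!: continuous_intros\<close>)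
    then show ?thesis
      unfolding \<Phi>_def by (intro continuous_intros)
  qed
  define Y where "Y k = (\<Phi> ^^ k) (\<lambda>_. c)" for k
  have Y: "continuous_on {a..b} (Y k)" for k
    by (induction k) (auto simp: Y_def cont)
  have agree: "\<Phi> (Y k) t = Y k t" if "t \<in> {a..b}" "t \<le> a + real k * h" for k t
    using that
  proof (induction k arbitrary: t)
    case 0
    then show ?case
      using h by (simp add: Y_def \<Phi>_def max_def)
  next
    case (Suc k)
    have "integral {a..max a (t - h)} (\<lambda>s. F s (\<Phi> (Y k) s)) = integral {a..max a (t - h)} (\<lambda>s. F s (Y k s))"
    proof (rule integral_cong)
      fix s assume "s \<in> {a..max a (t - h)}"
      then have "s \<in> {a..b}" "s \<le> a + real k * h"
        using Suc.prems h by (auto simp: max_def algebra_simps split: if_splits)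
      then show "F s (\<Phi> (Y k) s) = F s (Y k s)"
        using Suc.IH by simp
    qed
    moreover have "Y (Suc k) = \<Phi> (Y k)"
      by (simp add: Y_def)
    ultimately show ?case
      by (simp add: \<Phi>_def)
  qed
  obtain k where "(b - a) / h \<le> real k"
    using real_arch_simple by blast
  then have "b \<le> a + real k * h"
    using h by (simp add: field_simps)
  then have "Y k t = c + integral {a..max a (t - h)} (\<lambda>s. F s (Y k s))" if "t \<in> {a..b}" for t
    using agree[of t k] that by (simp add: \<Phi>_def)
  with Y show ?thesis
    by (rule that)
qed

text \<open>Tonelli's approximation by delayed equations.\<close>

theorem caratheodory_existence:
  fixes F :: "real \<Rightarrow> 'e::euclidean_space \<Rightarrow> 'e"
  assumes ab: "a \<le> b"
    and meas: "\<And>z. (\<lambda>t. F t z) \<in> borel_measurable (lebesgue_on {a..b})"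
    and cont: "\<And>t. t \<in> {a..b} \<Longrightarrow> continuous_on UNIV (F t)"
    and m: "m integrable_on {a..b}"
    and bound: "\<And>t z. t \<in> {a..b} \<Longrightarrow> norm (F t z) \<le> m t"
  obtains y where "continuous_on {a..b} y" "(\<lambda>s. F s (y s)) absolutely_integrable_on {a..b}"
    "\<And>t. t \<in> {a..b} \<Longrightarrow> y t = z0 + integral {a..t} (\<lambda>s. F s (y s))"
proof -
  have absint: "(\<lambda>s. F s (y s)) absolutely_integrable_on {a..b}" if "continuous_on {a..b} y" for y
    using meas cont m bound that by (rule continuous_imp_caratheodory_integrable)
  then have int: "(\<lambda>s. F s (y s)) integrable_on {a..b}" if "continuous_on {a..b} y" for y
    using that set_lebesgue_integral_eq_integral(1) by blast
  define M where "M t = integral {a..t} m" for t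
  have sub: "f integrable_on {s..t}" if "f integrable_on {a..b}" "a \<le> s" "t \<le> b"
    for f :: "real \<Rightarrow> 'x::euclidean_space" and s t
    using integrable_subinterval_real[OF that(1)] that by auto
  have Mcont: "continuous_on {a..b} M"
    unfolding M_def by (rule indefinite_integral_continuous_1[OF m])
  \<comment> \<open>The increments of \<open>M\<close> bound those of the integral along every
    continuous \<open>y\<close>. This one modulus of continuity makes the delayed solutions
    equicontinuous, and it also controls the effect of the vanishing delay.\<close>
  have diff: "norm (integral {a..t} (\<lambda>s. F s (y s)) - integral {a..s} (\<lambda>s. F s (y s))) \<le> \<bar>M t - M s\<bar>"
    if "continuous_on {a..b} y" "s \<in> {a..b}" "t \<in> {a..b}" for y s t
  proof -
    have *: "norm (integral {a..t} (\<lambda>s. F s (y s)) - integral {a..s} (\<lambda>s. F s (y s))) \<le> M t - M s"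
      if st: "a \<le> s" "s \<le> t" "t \<le> b" for s t
    proof -
      note i = int[OF \<open>continuous_on {a..b} y\<close>]
      have "integral {a..t} (\<lambda>s. F s (y s)) - integral {a..s} (\<lambda>s. F s (y s)) = integral {s..t} (\<lambda>s. F s (y s))"
        using Henstock_Kurzweil_Integration.integral_combine[OF st(1,2) sub[OF i order_refl st(3)]] by (simp add: algebra_simps)
      moreover have "M t - M s = integral {s..t} m"
        using Henstock_Kurzweil_Integration.integral_combine[OF st(1,2) sub[OF m order_refl st(3)]] by (simp add: M_def)
      moreover have "norm (integral {s..t} (\<lambda>s. F s (y s))) \<le> integral {s..t} m"
        by (rule integral_norm_bound_integral) (use st bound sub[OF i st(1,3)] sub[OF m st(1,3)] in auto)
      ultimately show ?thesis
        by simp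
    qed
    show ?thesis
      using *[of s t] *[of t s] that by (cases "s \<le> t") (auto simp: norm_minus_commute)
  qed
  define h where "h n = 1 / real (Suc n)" for n
  have h: "0 < h n" for n
    by (simp add: h_def)
  have "\<exists>y. continuous_on {a..b} y \<and>
      (\<forall>t\<in>{a..b}. y t = z0 + integral {a..max a (t - h n)} (\<lambda>s. F s (y s)))" for n
  proof (rule delayed_integral_equation[OF int h[of n], where c = z0])
    fix y assume "continuous_on {a..b} y"
      "\<And>t. t \<in> {a..b} \<Longrightarrow> y t = z0 + integral {a..max a (t - h n)} (\<lambda>s. F s (y s))"
    then show ?thesis
      by (intro exI[of _ y] conjI ballI)
  qed
  then obtain Y where "\<forall>n. continuous_on {a..b} (Y n) \<and>
      (\<forall>t\<in>{a..b}. Y n t = z0 + integral {a..max a (t - h n)} (\<lambda>s. F s (Y n s)))"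
    by (rule exE[OF choice[OF allI]]) (rule that)
  then have Y: "\<And>n. continuous_on {a..b} (Y n)"
    and Yeq: "\<And>n t. t \<in> {a..b} \<Longrightarrow> Y n t = z0 + integral {a..max a (t - h n)} (\<lambda>s. F s (Y n s))"
    by blast+
  have in_ab: "max a (t - h n) \<in> {a..b}" if "t \<in> {a..b}" for t n
    using that h[of n] by auto
  have ucont: "uniformly_continuous_on {a..b} M"
    using Mcont by (intro compact_uniformly_continuous) auto
  have "bounded (M ` {a..b})"
    by (intro compact_imp_bounded compact_continuous_image[OF Mcont]) simp
  then obtain B where B: "\<And>t. t \<in> {a..b} \<Longrightarrow> norm (M t) \<le> B"
    unfolding bounded_iff by blast
  obtain g k where g: "continuous_on {a..b} g" "strict_mono (k :: nat \<Rightarrow> nat)"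
    and conv: "\<And>e. 0 < e \<Longrightarrow> \<exists>N. \<forall>n t. n \<ge> N \<and> t \<in> {a..b} \<longrightarrow> norm (Y (k n) t - g t) < e"
  proof (rule Arzela_Ascoli[of "{a..b}" Y])
    show "compact {a..b}"
      by simp
    show "norm (Y n t) \<le> norm z0 + B" if "t \<in> {a..b}" for n t
    proof -
      have "norm (integral {a..max a (t - h n)} (\<lambda>s. F s (Y n s))) \<le> B"
        using diff[OF Y[of n], of a "max a (t - h n)"] B[OF in_ab[OF that], of n] in_ab[OF that, of n] ab
        by (simp add: M_def)
      then show ?thesis
        using norm_triangle_ineq[of z0 "integral {a..max a (t - h n)} (\<lambda>s. F s (Y n s))"]
        unfolding Yeq[OF that, of n] by linarith
    qed
    fix t :: real and e :: real assume t: "t \<in> {a..b}" and e: "0 < e"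
    obtain d where d: "0 < d" "\<And>p q. p \<in> {a..b} \<Longrightarrow> q \<in> {a..b} \<Longrightarrow> dist q p < d \<Longrightarrow> dist (M q) (M p) < e"
      using uniformly_continuous_onE[OF ucont e] by metis
    show "\<exists>d. 0 < d \<and> (\<forall>n s. s \<in> {a..b} \<and> norm (t - s) < d \<longrightarrow> norm (Y n t - Y n s) < e)"
    proof (intro exI[of _ d] conjI allI impI d(1))
      fix n s assume s: "s \<in> {a..b} \<and> norm (t - s) < d"
      let ?p = "max a (t - h n)" and ?q = "max a (s - h n)"
      have "norm (Y n t - Y n s) \<le> \<bar>M ?p - M ?q\<bar>"
        using Yeq[OF t, of n] Yeq[of s n] s diff[OF Y[of n] in_ab[of s n] in_ab[OF t, of n]] by simp
      also have "\<dots> < e"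
        using d(2)[of ?q ?p] s t in_ab[of t n] in_ab[of s n] by (auto simp: dist_real_def max_def split: if_splits)
      finally show "norm (Y n t - Y n s) < e" .
    qed
  qed blast
  have lim: "(\<lambda>n. Y (k n) t) \<longlonglongrightarrow> g t" if "t \<in> {a..b}" for t
    unfolding LIMSEQ_iff using conv that by blast
  have h0: "(\<lambda>n. h (k n)) \<longlonglongrightarrow> 0"
    using LIMSEQ_subseq_LIMSEQ[OF LIMSEQ_inverse_real_of_nat g(2)] by (simp add: h_def[abs_def] o_def inverse_eq_divide)
  have "g t = z0 + integral {a..t} (\<lambda>s. F s (g s))" if t: "t \<in> {a..b}" for t
  proof -
    have "(\<lambda>n. integral {a..t} (\<lambda>s. F s (Y (k n) s))) \<longlonglongrightarrow> integral {a..t} (\<lambda>s. F s (g s))"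
    proof (rule dominated_convergence(2))
      show "(\<lambda>s. F s (Y (k n) s)) integrable_on {a..t}" for n
        using sub[OF int[OF Y]] t by auto
      show "m integrable_on {a..t}"
        using sub[OF m] t by auto
      show "norm (F s (Y (k n) s)) \<le> m s" if "s \<in> {a..t}" for n s
        using bound that t by auto
      show "(\<lambda>n. F s (Y (k n) s)) \<longlonglongrightarrow> F s (g s)" if "s \<in> {a..t}" for s
        using that t by (intro continuous_on_tendsto_compose[OF cont lim]) auto
    qed
    \<comment> \<open>The delayed equation integrates only up to \<open>t - h (k n)\<close>; what is
      missing is bounded by an increment of \<open>M\<close> over an interval that shrinks to a
      point.\<close>
    moreover have "(\<lambda>n. Y (k n) t - (z0 + integral {a..t} (\<lambda>s. F s (Y (k n) s)))) \<longlonglongrightarrow> 0"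
    proof (rule Lim_null_comparison)
      show "\<forall>\<^sub>F n in sequentially. norm (Y (k n) t - (z0 + integral {a..t} (\<lambda>s. F s (Y (k n) s))))
          \<le> \<bar>M (max a (t - h (k n))) - M t\<bar>"
        using diff[OF Y t in_ab[OF t]] Yeq[OF t] by (intro always_eventually) auto
      have "(\<lambda>n. max a (t - h (k n))) \<longlonglongrightarrow> max a (t - 0)"
        using h0 by (intro tendsto_intros)
      then have "(\<lambda>n. M (max a (t - h (k n)))) \<longlonglongrightarrow> M t"
        using t in_ab[OF t] by (intro continuous_on_tendsto_compose[OF Mcont]) (auto simp: max_def)
      then show "(\<lambda>n. \<bar>M (max a (t - h (k n))) - M t\<bar>) \<longlonglongrightarrow> 0"
        using tendsto_rabs_zero LIM_zero by blast
    qed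
    ultimately have "(\<lambda>n. (Y (k n) t - (z0 + integral {a..t} (\<lambda>s. F s (Y (k n) s)))) + (z0 + integral {a..t} (\<lambda>s. F s (Y (k n) s))))
        \<longlonglongrightarrow> 0 + (z0 + integral {a..t} (\<lambda>s. F s (g s)))"
      by (intro tendsto_intros)
    then show ?thesis
      using lim[OF t] LIMSEQ_unique by simp
  qed
  then show ?thesis
    using that g(1) absint by blast
qed

subsection \<open>Charts, tangent vectors and velocities\<close>

lemma C_k_on_subset: "C_k_on k S h \<Longrightarrow> T \<subseteq> S \<Longrightarrow> C_k_on k T h"
  by (induction k arbitrary: h) (auto intro: continuous_on_subset)

lemma C_k_on_cong:
  assumes "open S" "C_k_on k S h" "\<And>z. z \<in> S \<Longrightarrow> h z = h' z"
  shows "C_k_on k S h'"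
  using assms(2,3)
proof (induction k arbitrary: h h')
  case 0
  then show ?case
    using continuous_on_cong[of S S h h'] by auto
next
  case (Suc k)
  have der: "(h' has_derivative frechet_derivative h (at z)) (at z)" if "z \<in> S" for z
  proof -
    have "(h has_derivative frechet_derivative h (at z)) (at z)"
      using Suc.prems(1) that by (simp add: frechet_derivative_works)
    then show ?thesis
      by (rule has_derivative_transform_within_open) (use that assms(1) Suc.prems(2) in auto)
  qed
  have "C_k_on k S (\<lambda>z. frechet_derivative h' (at z) e)" for e
  proof (rule Suc.IH[of "\<lambda>z. frechet_derivative h (at z) e"])
    show "C_k_on k S (\<lambda>z. frechet_derivative h (at z) e)"
      using Suc.prems(1) by simp
    show "frechet_derivative h (at z) e = frechet_derivative h' (at z) e" if "z \<in> S" for z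
      using frechet_derivative_at[OF der[OF that]] by simp
  qed
  moreover have "h' differentiable at z" if "z \<in> S" for z
    using der[OF that] by (rule differentiableI)
  ultimately show ?case
    by simp
qed

lemma smooth_on_subset: "smooth_on S h \<Longrightarrow> T \<subseteq> S \<Longrightarrow> smooth_on T h"
  unfolding smooth_on_def using C_k_on_subset by blast

lemma smooth_on_cong:
  "smooth_on S h \<Longrightarrow> open S \<Longrightarrow> (\<And>z. z \<in> S \<Longrightarrow> h z = h' z) \<Longrightarrow> smooth_on S h'"
  unfolding smooth_on_def using C_k_on_cong by blast

lemma smooth_on_imp_continuous_on: "smooth_on S h \<Longrightarrow> continuous_on S h"
  unfolding smooth_on_def by (metis C_k_on.simps(1))

lemma smooth_on_imp_has_derivative:
  assumes "smooth_on S h" "z \<in> S"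
  shows "(h has_derivative frechet_derivative h (at z)) (at z)"
  using assms C_k_on.simps(2)[of 0 S h] unfolding smooth_on_def frechet_derivative_works by blast

lemma smooth_on_imp_continuous_derivative:
  assumes "smooth_on S h"
  shows "continuous_on S (\<lambda>z. frechet_derivative h (at z) e)"
  using assms C_k_on.simps(2)[of 0 S h] unfolding smooth_on_def by simp

locale smooth_manifold =
  fixes A :: "('a::topological_space, 'e::euclidean_space) chart set"
  assumes smooth: "smooth_structure A"
begin

lemma chart_at: obtains U \<phi> where "(U, \<phi>) \<in> A" "x \<in> U"
proof -
  have "x \<in> (\<Union>(U, \<phi>)\<in>A. U)"
    using smooth by (simp add: smooth_structure_def)
  then show ?thesis
    using that by auto
qed

lemma maximal_atlas: "topological_chart c \<Longrightarrow> (\<forall>d\<in>A. smoothly_compatible c d) \<Longrightarrow> c \<in> A"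
proof -
  assume "topological_chart c" "\<forall>d\<in>A. smoothly_compatible c d"
  moreover have "\<forall>c. topological_chart c \<and> (\<forall>d\<in>A. smoothly_compatible c d) \<longrightarrow> c \<in> A"
    using smooth unfolding smooth_structure_def by (elim conjE)
  ultimately show ?thesis
    by iprover
qed

context
  fixes U \<phi>
  assumes c: "(U, \<phi>) \<in> A"
begin

lemma chart_homeomorphism: "homeomorphism U (\<phi> ` U) \<phi> (inv_into U \<phi>)"
  and open_chart_domain: "open U"
  and open_chart_image: "open (\<phi> ` U)"
  using c smooth by (fastforce simp: smooth_structure_def topological_chart_def)+

lemma continuous_on_chart: "continuous_on U \<phi>"
  and continuous_on_chart_inverse: "continuous_on (\<phi> ` U) (inv_into U \<phi>)"
  and chart_inverse: "x \<in> U \<Longrightarrow> inv_into U \<phi> (\<phi> x) = x"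
  using chart_homeomorphism by (auto simp: homeomorphism_def)

lemma inj_on_chart: "inj_on \<phi> U"
  by (metis chart_inverse inj_onI)

lemma open_chart_image_Int: "open W \<Longrightarrow> open (\<phi> ` (U \<inter> W))"
proof -
  assume "open W"
  then have "openin (top_of_set U) (U \<inter> W)"
    by (simp add: openin_open_Int)
  then have "openin (top_of_set (\<phi> ` U)) (\<phi> ` (U \<inter> W))"
    by (rule homeomorphism_imp_open_map[OF chart_homeomorphism])
  then show ?thesis
    using open_chart_image openin_open_trans by blast
qed

lemma open_chart_preimage:
  assumes "open S"
  shows "open {x \<in> U. \<phi> x \<in> S}"
  using continuous_open_preimage[OF continuous_on_chart open_chart_domain assms]
  by (simp add: vimage_def Int_def)

end

lemma smooth_transition:
  assumes "(U, \<phi>) \<in> A" "(W, \<psi>) \<in> A"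
  shows "smooth_on (\<phi> ` (U \<inter> W)) (\<psi> \<circ> inv_into U \<phi>)"
  using assms smooth by (fastforce simp: smooth_structure_def smoothly_compatible_def)

text \<open>Here the maximality of the atlas enters. The regularity conditions on \<open>f\<close>
  and \<open>V\<close> speak only of charts contained in a given open set, so arbitrarily small
  charts must belong to \<open>A\<close>. The two inverses agree only on the image of the smaller
  domain, whence the congruence arguments.\<close>

lemma restrict_chart:
  assumes c: "(U, \<phi>) \<in> A" and W: "open W"
  shows "(U \<inter> W, \<phi>) \<in> A"
proof -
  have inv: "inv_into (U \<inter> W) \<phi> z = inv_into U \<phi> z" if z: "z \<in> \<phi> ` (U \<inter> W)" for z
  proof -
    obtain x where x: "x \<in> U \<inter> W" "z = \<phi> x"
      using z by blast
    have "inj_on \<phi> (U \<inter> W)"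
      using inj_on_chart[OF c] by (rule inj_on_subset) simp
    then show ?thesis
      using x chart_inverse[OF c] by simp
  qed
  have "homeomorphism (U \<inter> W) (\<phi> ` (U \<inter> W)) \<phi> (inv_into U \<phi>)"
    by (rule homeomorphism_of_subsets[OF chart_homeomorphism[OF c]]) auto
  then have "homeomorphism (U \<inter> W) (\<phi> ` (U \<inter> W)) \<phi> (inv_into (U \<inter> W) \<phi>)"
    by (rule homeomorphism_cong) (use inv in auto)
  then have "topological_chart (U \<inter> W, \<phi>)"
    using open_chart_domain[OF c] open_chart_image_Int[OF c W] W by (simp add: topological_chart_def open_Int)
  moreover have "smoothly_compatible (U \<inter> W, \<phi>) (W', \<psi>)" if d: "(W', \<psi>) \<in> A" for W' \<psi>
  proof -
    have "smooth_on (\<phi> ` (U \<inter> W \<inter> W')) (\<psi> \<circ> inv_into U \<phi>)"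
      by (rule smooth_on_subset[OF smooth_transition[OF c d]]) auto
    then have "smooth_on (\<phi> ` (U \<inter> W \<inter> W')) (\<psi> \<circ> inv_into (U \<inter> W) \<phi>)"
    proof (rule smooth_on_cong)
      show "open (\<phi> ` (U \<inter> W \<inter> W'))"
        using open_chart_image_Int[OF c, of "W \<inter> W'"] W open_chart_domain[OF d] by (simp add: open_Int Int_assoc)
      show "(\<psi> \<circ> inv_into U \<phi>) z = (\<psi> \<circ> inv_into (U \<inter> W) \<phi>) z" if "z \<in> \<phi> ` (U \<inter> W \<inter> W')" for z
        using inv[of z] that by auto
    qed
    moreover have "smooth_on (\<psi> ` (W' \<inter> U)) (\<phi> \<circ> inv_into W' \<psi>)"
      by (rule smooth_transition[OF d c])
    then have "smooth_on (\<psi> ` (U \<inter> W \<inter> W')) (\<phi> \<circ> inv_into W' \<psi>)"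
      by (rule smooth_on_subset) auto
    ultimately show ?thesis
      by (simp add: smoothly_compatible_def)
  qed
  ultimately show ?thesis
    by (intro maximal_atlas) auto
qed

lemma chart_within:
  assumes "open W" "x \<in> W"
  obtains U \<phi> where "(U, \<phi>) \<in> A" "x \<in> U" "U \<subseteq> W"
proof -
  obtain U \<phi> where c: "(U, \<phi>) \<in> A" "x \<in> U"
    by (rule chart_at)
  from restrict_chart[OF c(1) assms(1)] show ?thesis
    by (rule that) (use c(2) assms(2) in auto)
qed

section \<open>Tangent vectors and derivatives of transition maps\<close>

definition trans_deriv :: "('a, 'e) chart \<Rightarrow> ('a, 'e) chart \<Rightarrow> 'a \<Rightarrow> 'e \<Rightarrow> 'e" where
  "trans_deriv c d x = frechet_derivative (snd d \<circ> inv_into (fst c) (snd c)) (at (snd c x))"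

lemma transition_has_derivative:
  assumes "(U, \<phi>) \<in> A" "(W, \<psi>) \<in> A" "x \<in> U" "x \<in> W"
  shows "((\<psi> \<circ> inv_into U \<phi>) has_derivative trans_deriv (U, \<phi>) (W, \<psi>) x) (at (\<phi> x))"
  unfolding trans_deriv_def
  using smooth_on_imp_has_derivative[OF smooth_transition[OF assms(1,2)], of "\<phi> x"] assms(3,4) by simp

text \<open>With \<open>F\<close> a chart map this yields the cocycle identity of the transition
  derivatives; with \<open>F\<close> a real function it yields the independence of the differential
  from the chart.\<close>

lemma chart_change_derivative:
  assumes c: "(U, \<phi>) \<in> A" and d: "(W, \<psi>) \<in> A" and x: "x \<in> U" "x \<in> W"
    and F: "((F \<circ> inv_into W \<psi>) has_derivative L) (at (\<psi> x))"
  shows "((F \<circ> inv_into U \<phi>) has_derivative (L \<circ> trans_deriv (U, \<phi>) (W, \<psi>) x)) (at (\<phi> x))"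
proof -
  have "(\<psi> \<circ> inv_into U \<phi>) (\<phi> x) = \<psi> x"
    using chart_inverse[OF c x(1)] by simp
  then have "((F \<circ> inv_into W \<psi>) has_derivative L) (at ((\<psi> \<circ> inv_into U \<phi>) (\<phi> x)))"
    using F by simp
  then have "((F \<circ> inv_into W \<psi>) \<circ> (\<psi> \<circ> inv_into U \<phi>) has_derivative
      (L \<circ> trans_deriv (U, \<phi>) (W, \<psi>) x)) (at (\<phi> x))"
    by (rule diff_chain_at[OF transition_has_derivative[OF c d x]])
  then show ?thesis
  proof (rule has_derivative_transform_within_open)
    show "open (\<phi> ` (U \<inter> W))"
      by (rule open_chart_image_Int[OF c open_chart_domain[OF d]])
    show "\<phi> x \<in> \<phi> ` (U \<inter> W)"
      using x by simp
    show "((F \<circ> inv_into W \<psi>) \<circ> (\<psi> \<circ> inv_into U \<phi>)) z = (F \<circ> inv_into U \<phi>) z"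
      if "z \<in> \<phi> ` (U \<inter> W)" for z
      using that chart_inverse[OF c] chart_inverse[OF d] by auto
  qed
qed

lemma trans_deriv_compose:
  assumes "(U, \<phi>) \<in> A" "(W, \<psi>) \<in> A" "(Y, \<eta>) \<in> A" "x \<in> U" "x \<in> W" "x \<in> Y"
  shows "trans_deriv (U, \<phi>) (Y, \<eta>) x = trans_deriv (W, \<psi>) (Y, \<eta>) x \<circ> trans_deriv (U, \<phi>) (W, \<psi>) x"
  using transition_has_derivative[OF assms(1,3,4,6)]
    chart_change_derivative[OF assms(1,2,4,5) transition_has_derivative[OF assms(2,3,5,6)]]
  by (rule has_derivative_unique)

lemma trans_deriv_restrict:
  assumes "(U, \<phi>) \<in> A" "(W, \<phi>) \<in> A" "x \<in> U" "x \<in> W" "W \<subseteq> U"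
  shows "trans_deriv (U, \<phi>) (W, \<phi>) x = (\<lambda>e. e)"
proof -
  have "((\<lambda>z. z) has_derivative (\<lambda>e. e)) (at (\<phi> x))"
    by (rule has_derivative_ident)
  then have "((\<phi> \<circ> inv_into U \<phi>) has_derivative (\<lambda>e. e)) (at (\<phi> x))"
    by (rule has_derivative_transform_within_open[OF _ open_chart_image[OF assms(1)]])
      (use assms chart_inverse[OF assms(1)] in auto)
  then show ?thesis
    using has_derivative_unique transition_has_derivative[OF assms(1-4)] by blast
qed

lemma tangent_space_iff:
  "v \<in> tangent_space A x \<longleftrightarrow> (\<forall>c. c \<notin> charts_at A x \<longrightarrow> v c = 0) \<and>
     (\<forall>c\<in>charts_at A x. \<forall>d\<in>charts_at A x. v d = trans_deriv c d x (v c))"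
  unfolding tangent_space_def trans_deriv_def by (simp add: split_beta)

lemma tangent_spaceD:
  "v \<in> tangent_space A x \<Longrightarrow> c \<in> charts_at A x \<Longrightarrow> d \<in> charts_at A x \<Longrightarrow> v d = trans_deriv c d x (v c)"
  unfolding tangent_space_iff by blast

lemma tangent_space_outside: "v \<in> tangent_space A x \<Longrightarrow> c \<notin> charts_at A x \<Longrightarrow> v c = 0"
  unfolding tangent_space_iff by blast

lemma linear_trans_deriv:
  "c \<in> charts_at A x \<Longrightarrow> d \<in> charts_at A x \<Longrightarrow> linear (trans_deriv c d x)"
  using transition_has_derivative[of "fst c" "snd c" "fst d" "snd d" x, THEN has_derivative_linear]
  by (auto simp: charts_at_def)

text \<open>A vector given in one chart is transported to all others by the transition derivatives,
  and the cocycle identity makes the resulting family consistent. This justifies the definite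
  description in \<open>coord_vector\<close>.\<close>

lemma coord_vector_ex1:
  assumes c: "c \<in> charts_at A x"
  shows "\<exists>!v. v \<in> tangent_space A x \<and> v c = e"
proof
  define v where "v d = (if d \<in> charts_at A x then trans_deriv c d x e else 0)" for d
  have "v d' = trans_deriv d d' x (v d)" if "d \<in> charts_at A x" "d' \<in> charts_at A x" for d d'
    using trans_deriv_compose[of "fst c" "snd c" "fst d" "snd d" "fst d'" "snd d'" x] that c
    by (simp add: v_def charts_at_def)
  moreover have "v c = e"
    using c trans_deriv_restrict[of "fst c" "snd c" "fst c" x] by (simp add: v_def charts_at_def)
  moreover have "v d = 0" if "d \<notin> charts_at A x" for d
    using that by (simp add: v_def)
  ultimately show "v \<in> tangent_space A x \<and> v c = e"
    unfolding tangent_space_iff by blast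
  fix w assume w: "w \<in> tangent_space A x \<and> w c = e"
  show "w = v"
  proof
    fix d
    show "w d = v d"
    proof (cases "d \<in> charts_at A x")
      case True
      then show ?thesis
        using tangent_spaceD[of w x c d] w c by (simp add: v_def)
    next
      case False
      then show ?thesis
        using tangent_space_outside[of w x d] w by (simp add: v_def)
    qed
  qed
qed

lemma coord_vector:
  assumes "c \<in> charts_at A x"
  shows coord_vector_in: "coord_vector A c x e \<in> tangent_space A x"
    and coord_vector_coord: "coord_vector A c x e c = e"
  using theI'[OF coord_vector_ex1[OF assms]] unfolding coord_vector_def by auto

lemma coord_vector_eqI:
  "c \<in> charts_at A x \<Longrightarrow> v \<in> tangent_space A x \<Longrightarrow> v c = e \<Longrightarrow> coord_vector A c x e = v"
  using coord_vector_ex1 coord_vector by blast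

lemma tangent_space_lincomb:
  assumes "v \<in> tangent_space A x" "w \<in> tangent_space A x"
  shows "(\<lambda>c. a *\<^sub>R v c + b *\<^sub>R w c) \<in> tangent_space A x"
  unfolding tangent_space_iff
proof (intro conjI ballI allI impI)
  fix c assume "c \<notin> charts_at A x"
  then show "a *\<^sub>R v c + b *\<^sub>R w c = 0"
    using assms by (simp add: tangent_space_outside)
next
  fix c d assume cd: "c \<in> charts_at A x" "d \<in> charts_at A x"
  interpret linear "trans_deriv c d x"
    by (rule linear_trans_deriv[OF cd])
  show "a *\<^sub>R v d + b *\<^sub>R w d = trans_deriv c d x (a *\<^sub>R v c + b *\<^sub>R w c)"
    using tangent_spaceD[OF assms(1) cd] tangent_spaceD[OF assms(2) cd] by (simp add: add scaleR)
qed

lemma coord_vector_lincomb: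
  assumes "c \<in> charts_at A x"
  shows "coord_vector A c x (a *\<^sub>R e + b *\<^sub>R e') =
    (\<lambda>d. a *\<^sub>R coord_vector A c x e d + b *\<^sub>R coord_vector A c x e' d)"
  using assms by (intro coord_vector_eqI tangent_space_lincomb coord_vector_in) (simp_all add: coord_vector_coord)

lemma zero_in_tangent_space: "(\<lambda>_. 0) \<in> tangent_space A x"
  unfolding tangent_space_iff
proof (intro conjI ballI allI impI refl)
  fix c d assume "c \<in> charts_at A x" "d \<in> charts_at A x"
  then show "0 = trans_deriv c d x 0"
    using linear_0[OF linear_trans_deriv] by simp
qed

section \<open>Velocities of curves\<close>

text \<open>The definition of \<open>has_velocity\<close> provides a derivative in a single chart. A
  coordinate map has arbitrary values outside its domain, so continuity of the curve is what keeps
  it inside that chart near \<open>t\<close> and lets the transition map act.\<close>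

lemma has_velocity_chart:
  assumes v: "has_velocity A p t v" and cont: "isCont p t" and c: "(U, \<phi>) \<in> A" "p t \<in> U"
  shows "((\<phi> \<circ> p) has_vector_derivative v (U, \<phi>)) (at t)"
proof -
  obtain W \<psi> where d: "(W, \<psi>) \<in> A" "p t \<in> W" and der: "((\<psi> \<circ> p) has_vector_derivative v (W, \<psi>)) (at t)"
    and vt: "v \<in> tangent_space A (p t)"
    using v by (auto simp: has_velocity_def charts_at_def)
  have "((\<phi> \<circ> inv_into W \<psi>) has_derivative trans_deriv (W, \<psi>) (U, \<phi>) (p t)) (at ((\<psi> \<circ> p) t))"
    using transition_has_derivative[OF d(1) c(1) d(2) c(2)] by simp
  from diff_chain_at[OF der[unfolded has_vector_derivative_def] this]
  have "((\<phi> \<circ> inv_into W \<psi>) \<circ> (\<psi> \<circ> p) has_derivative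
      (trans_deriv (W, \<psi>) (U, \<phi>) (p t) \<circ> (\<lambda>s. s *\<^sub>R v (W, \<psi>)))) (at t)" .
  also have "trans_deriv (W, \<psi>) (U, \<phi>) (p t) \<circ> (\<lambda>s. s *\<^sub>R v (W, \<psi>)) = (\<lambda>s. s *\<^sub>R v (U, \<phi>))"
    using tangent_spaceD[OF vt, of "(W, \<psi>)" "(U, \<phi>)"] c d
      linear_cmul[OF linear_trans_deriv[of "(W, \<psi>)" "p t" "(U, \<phi>)"]]
    by (auto simp: charts_at_def)
  finally have "((\<phi> \<circ> inv_into W \<psi>) \<circ> (\<psi> \<circ> p) has_vector_derivative v (U, \<phi>)) (at t)"
    by (simp only: has_vector_derivative_def)
  moreover have "\<forall>\<^sub>F s in at t. ((\<phi> \<circ> inv_into W \<psi>) \<circ> (\<psi> \<circ> p)) s = (\<phi> \<circ> p) s"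
  proof -
    have "\<forall>\<^sub>F s in at t. p s \<in> W"
      using cont open_chart_domain[OF d(1)] d(2) unfolding isCont_def by (rule topological_tendstoD)
    then show ?thesis
      by (rule eventually_mono) (simp add: chart_inverse[OF d(1)])
  qed
  ultimately show ?thesis
    unfolding has_vector_derivative_def
    by (rule has_derivative_transform_eventually) (use chart_inverse[OF d(1)] d(2) in auto)
qed

lemma has_velocity_velocity:
  assumes v: "has_velocity A p t v" and cont: "isCont p t"
  shows "velocity A p t = v"
  unfolding velocity_def
proof (rule the_equality)
  show "has_velocity A p t v"
    by (rule v)
  fix w assume w: "has_velocity A p t w"
  obtain U \<phi> where c: "(U, \<phi>) \<in> A" "p t \<in> U"
    by (rule chart_at)
  then have at: "(U, \<phi>) \<in> charts_at A (p t)"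
    by (simp add: charts_at_def)
  have "v (U, \<phi>) = w (U, \<phi>)"
    using has_velocity_chart[OF v cont c] has_velocity_chart[OF w cont c] by (rule vector_derivative_unique_at)
  then show "w = v"
    using coord_vector_eqI[OF at, of w "w (U, \<phi>)"] coord_vector_eqI[OF at, of v "w (U, \<phi>)"] v w
    by (simp add: has_velocity_def)
qed

lemma has_velocityI:
  assumes "(U, \<phi>) \<in> A" "p t \<in> U" "((\<phi> \<circ> p) has_vector_derivative e) (at t)"
  shows "has_velocity A p t (coord_vector A (U, \<phi>) (p t) e)"
proof -
  have "(U, \<phi>) \<in> charts_at A (p t)"
    using assms by (simp add: charts_at_def)
  then show ?thesis
    unfolding has_velocity_def using assms coord_vector[of "(U, \<phi>)" "p t" e] by (intro conjI bexI[of _ "(U, \<phi>)"]) auto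
qed

text \<open>Concatenation and reversal of paths reparametrize time affinely; this gives the factor
  \<open>m\<close> in their speeds.\<close>

lemma has_velocity_affine:
  assumes v: "has_velocity A p (m * t + c) v"
  shows "has_velocity A (\<lambda>s. p (m * s + c)) t (\<lambda>d. m *\<^sub>R v d)"
proof -
  obtain U \<phi> where d: "(U, \<phi>) \<in> A" "p (m * t + c) \<in> U"
    and der: "((\<phi> \<circ> p) has_vector_derivative v (U, \<phi>)) (at (m * t + c))"
    and vt: "v \<in> tangent_space A (p (m * t + c))"
    using v by (auto simp: has_velocity_def charts_at_def)
  have "((\<lambda>s. m * s + c) has_vector_derivative m) (at t)"
    by (auto intro!: derivative_eq_intros)
  from vector_diff_chain_at[OF this der]
  have "(\<phi> \<circ> (\<lambda>s. p (m * s + c)) has_vector_derivative m *\<^sub>R v (U, \<phi>)) (at t)"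
    by (simp add: o_def)
  moreover have "(\<lambda>d. m *\<^sub>R v d) \<in> tangent_space A (p (m * t + c))"
    using tangent_space_lincomb[OF vt vt, of m 0] by simp
  ultimately show ?thesis
    unfolding has_velocity_def using d by (auto simp: charts_at_def)
qed

lemma has_velocity_cong:
  assumes v: "has_velocity A p t v" and "open S" "t \<in> S" "\<And>s. s \<in> S \<Longrightarrow> p s = q s"
  shows "has_velocity A q t v"
proof -
  obtain U \<phi> where d: "(U, \<phi>) \<in> A" "p t \<in> U"
    and der: "((\<phi> \<circ> p) has_vector_derivative v (U, \<phi>)) (at t)"
    and vt: "v \<in> tangent_space A (p t)"
    using v by (auto simp: has_velocity_def charts_at_def)
  have "((\<phi> \<circ> q) has_vector_derivative v (U, \<phi>)) (at t)"
    by (rule has_vector_derivative_transform_within_open[OF der assms(2,3)]) (simp add: assms(4))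
  then show ?thesis
    using d vt assms(3,4) unfolding has_velocity_def by (auto simp: charts_at_def)
qed

lemma velocity_cong:
  assumes "open S" "t \<in> S" "\<And>s. s \<in> S \<Longrightarrow> p s = q s"
  shows "velocity A q t = velocity A p t"
proof -
  have "has_velocity A q t v \<longleftrightarrow> has_velocity A p t v" for v
    using has_velocity_cong[of p t v S q] has_velocity_cong[of q t v S p] assms by auto
  then show ?thesis
    by (simp add: velocity_def)
qed

end

subsection \<open>The metric in coordinates\<close>

lemma abs_inner_mult_le: "i \<in> Basis \<Longrightarrow> j \<in> Basis \<Longrightarrow> \<bar>(e \<bullet> i) * (e \<bullet> j)\<bar> \<le> (norm e)\<^sup>2"
  using mult_mono[OF Basis_le_norm[of i e] Basis_le_norm[of j e]] by (simp add: abs_mult power2_eq_square)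

locale riemannian = smooth_manifold A
  for A :: "('a::{t2_space, second_countable_topology}, 'e::euclidean_space) chart set" +
  fixes g :: "('a, 'e) metric"
  assumes riem: "riemannian_metric A g" and conn: "connected (UNIV :: 'a set)"
begin

lemma metric_commute:
  "v \<in> tangent_space A x \<Longrightarrow> w \<in> tangent_space A x \<Longrightarrow> g x v w = g x w v"
  using riem unfolding riemannian_metric_def by blast

lemma metric_lincomb:
  "v \<in> tangent_space A x \<Longrightarrow> w \<in> tangent_space A x \<Longrightarrow> z \<in> tangent_space A x \<Longrightarrow>
    g x (\<lambda>c. a *\<^sub>R v c + b *\<^sub>R w c) z = a * g x v z + b * g x w z"
  using riem unfolding riemannian_metric_def by blast

lemma metric_pos: "v \<in> tangent_space A x \<Longrightarrow> v \<noteq> (\<lambda>_. 0) \<Longrightarrow> 0 < g x v v"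
  using riem unfolding riemannian_metric_def by blast

lemma metric_zero: "g x (\<lambda>_. 0) (\<lambda>_. 0) = 0"
  using metric_lincomb[OF zero_in_tangent_space zero_in_tangent_space zero_in_tangent_space, of x 0 0] by simp

lemma metric_nonneg: "v \<in> tangent_space A x \<Longrightarrow> 0 \<le> g x v v"
  using metric_pos[of v x] metric_zero by fastforce

lemma tnorm_scale:
  assumes v: "v \<in> tangent_space A x"
  shows "tnorm g x (\<lambda>d. m *\<^sub>R v d) = \<bar>m\<bar> * tnorm g x v"
proof -
  have mv: "(\<lambda>d. m *\<^sub>R v d) \<in> tangent_space A x"
    using tangent_space_lincomb[OF v v, of m 0] by simp
  have "g x (\<lambda>d. m *\<^sub>R v d) (\<lambda>d. m *\<^sub>R v d) = m * g x v (\<lambda>d. m *\<^sub>R v d)"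
    using metric_lincomb[OF v v mv, of m 0] by simp
  also have "g x v (\<lambda>d. m *\<^sub>R v d) = m * g x v v"
    using metric_lincomb[OF v v v, of m 0] metric_commute[OF v mv] by simp
  finally show ?thesis
    by (simp add: tnorm_def real_sqrt_mult flip: power2_eq_square mult.assoc)
qed

definition coord_metric :: "('a, 'e) chart \<Rightarrow> 'a \<Rightarrow> 'e \<Rightarrow> 'e \<Rightarrow> real" where
  "coord_metric c x e e' = g x (coord_vector A c x e) (coord_vector A c x e')"

lemma coord_metric_lincomb:
  assumes "c \<in> charts_at A x"
  shows "coord_metric c x (a *\<^sub>R e + b *\<^sub>R e') z = a * coord_metric c x e z + b * coord_metric c x e' z"
  using assms unfolding coord_metric_def
  by (simp add: coord_vector_lincomb metric_lincomb coord_vector_in)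

lemma coord_metric_commute:
  "c \<in> charts_at A x \<Longrightarrow> coord_metric c x e e' = coord_metric c x e' e"
  unfolding coord_metric_def by (intro metric_commute coord_vector_in)

lemma bilinear_coord_metric:
  assumes c: "c \<in> charts_at A x"
  shows "bilinear (coord_metric c x)"
proof -
  have l: "linear (\<lambda>e. coord_metric c x e z)" for z
    using coord_metric_lincomb[OF c, of 1 _ 1 _ z] coord_metric_lincomb[OF c, of _ _ 0 0 z]
    by (intro linearI) simp_all
  then show ?thesis
    unfolding bilinear_def using coord_metric_commute[OF c] by simp
qed

text \<open>The metric as a quadratic form in coordinates: the squared length of the tangent vector
  with coordinates \<open>e\<close> at the point with coordinates \<open>z\<close>. The comparison
  of \<open>g\<close> with the Euclidean norm is carried out on this form.\<close>

definition coord_form :: "'a set \<Rightarrow> ('a \<Rightarrow> 'e) \<Rightarrow> 'e \<Rightarrow> 'e \<Rightarrow> real" where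
  "coord_form U \<phi> z e = coord_metric (U, \<phi>) (inv_into U \<phi> z) e e"

context
  fixes U \<phi>
  assumes c: "(U, \<phi>) \<in> A"
begin

lemma chart_in_charts_at: "z \<in> \<phi> ` U \<Longrightarrow> (U, \<phi>) \<in> charts_at A (inv_into U \<phi> z)"
  using c by (auto simp: charts_at_def inv_into_into)

lemma continuous_on_coord_metric: "continuous_on (\<phi> ` U) (\<lambda>z. coord_metric (U, \<phi>) (inv_into U \<phi> z) e e')"
proof -
  have "smooth_on (\<phi> ` U) (\<lambda>z. let y = inv_into U \<phi> z in
        g y (coord_vector A (U, \<phi>) y e) (coord_vector A (U, \<phi>) y e'))"
    using riem c unfolding riemannian_metric_def by blast
  then show ?thesis
    using smooth_on_imp_continuous_on by (simp add: coord_metric_def Let_def)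
qed

lemma coord_form_expand:
  assumes "z \<in> \<phi> ` U"
  shows "coord_form U \<phi> z e = (\<Sum>(i,j)\<in>Basis \<times> Basis. (e \<bullet> i) * (e \<bullet> j) * coord_metric (U, \<phi>) (inv_into U \<phi> z) i j)"
proof -
  note b = bilinear_coord_metric[OF chart_in_charts_at[OF assms]]
  have "coord_form U \<phi> z e = coord_metric (U, \<phi>) (inv_into U \<phi> z) (\<Sum>i\<in>Basis. (e \<bullet> i) *\<^sub>R i) (\<Sum>i\<in>Basis. (e \<bullet> i) *\<^sub>R i)"
    by (simp add: coord_form_def euclidean_representation)
  also have "\<dots> = (\<Sum>(i,j)\<in>Basis \<times> Basis. coord_metric (U, \<phi>) (inv_into U \<phi> z) ((e \<bullet> i) *\<^sub>R i) ((e \<bullet> j) *\<^sub>R j))"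
    by (rule bilinear_sum[OF b]) 
  finally show ?thesis
    by (simp add: bilinear_lmul[OF b] bilinear_rmul[OF b] mult_ac)
qed

text \<open>Smoothness of \<open>g\<close> is assumed for fixed pairs of coordinate vectors.
  Expanding in the basis upgrades this to joint continuity in point and vector, as the compactness
  argument over the unit sphere requires.\<close>

lemma continuous_on_coord_form: "continuous_on (\<phi> ` U \<times> UNIV) (\<lambda>p. coord_form U \<phi> (fst p) (snd p))"
proof -
  have "continuous_on (\<phi> ` U \<times> UNIV) (\<lambda>p. \<Sum>k\<in>Basis \<times> Basis. (snd p \<bullet> fst k) * (snd p \<bullet> snd k)
      * coord_metric (U, \<phi>) (inv_into U \<phi> (fst p)) (fst k) (snd k))"
    by (intro continuous_intros continuous_on_compose2[OF continuous_on_coord_metric]) auto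
  then show ?thesis
    by (rule continuous_on_eq) (auto simp: coord_form_expand split_beta)
qed

lemma coord_form_scale:
  assumes "z \<in> \<phi> ` U"
  shows "coord_form U \<phi> z (s *\<^sub>R e) = s\<^sup>2 * coord_form U \<phi> z e"
  using bilinear_coord_metric[OF chart_in_charts_at[OF assms]]
  by (simp add: coord_form_def bilinear_lmul bilinear_rmul power2_eq_square)

lemma coord_form_zero: "z \<in> \<phi> ` U \<Longrightarrow> coord_form U \<phi> z 0 = 0"
  using coord_form_scale[of z 0 0] by simp

lemma coord_form_pos:
  assumes "z \<in> \<phi> ` U" "e \<noteq> 0"
  shows "0 < coord_form U \<phi> z e"
  unfolding coord_form_def coord_metric_def
proof (rule metric_pos)
  note at = chart_in_charts_at[OF assms(1)]
  show "coord_vector A (U, \<phi>) (inv_into U \<phi> z) e \<in> tangent_space A (inv_into U \<phi> z)"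
    by (rule coord_vector_in[OF at])
  show "coord_vector A (U, \<phi>) (inv_into U \<phi> z) e \<noteq> (\<lambda>_. 0)"
    using coord_vector_coord[OF at, of e] assms(2) by auto
qed

lemma coord_form_nonneg: "z \<in> \<phi> ` U \<Longrightarrow> 0 \<le> coord_form U \<phi> z e"
  using coord_form_pos[of z e] coord_form_zero[of z] by (cases "e = 0") auto

lemma sqrt_coord_form_scale:
  "z \<in> \<phi> ` U \<Longrightarrow> sqrt (coord_form U \<phi> z (s *\<^sub>R e)) = \<bar>s\<bar> * sqrt (coord_form U \<phi> z e)"
  by (simp add: coord_form_scale real_sqrt_mult)

lemma tnorm_chart:
  assumes "v \<in> tangent_space A x" "x \<in> U"
  shows "tnorm g x v = sqrt (coord_form U \<phi> (\<phi> x) (v (U, \<phi>)))"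
proof -
  have "(U, \<phi>) \<in> charts_at A x"
    using c assms by (simp add: charts_at_def)
  from coord_vector_eqI[OF this assms(1) refl] show ?thesis
    by (simp add: tnorm_def coord_form_def coord_metric_def chart_inverse[OF c assms(2)])
qed

text \<open>A positive continuous function on the compact set \<open>K\<close> times the unit sphere
  has a positive minimum and a finite maximum; homogeneity extends the two bounds to all
  vectors.\<close>

lemma coord_form_bounds:
  assumes K: "compact K" "K \<subseteq> \<phi> ` U"
  obtains a b where "0 < a" "0 < b"
    "\<forall>z\<in>K. \<forall>e. a * norm e \<le> sqrt (coord_form U \<phi> z e)"
    "\<forall>z\<in>K. \<forall>e. sqrt (coord_form U \<phi> z e) \<le> b * norm e"
proof (cases "K = {}")
  case True
  then show ?thesis
    using that[of 1 1] by simp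
next
  case False
  define f where "f p = sqrt (coord_form U \<phi> (fst p) (snd p))" for p
  let ?S = "K \<times> sphere (0::'e) 1"
  have S: "compact ?S" "?S \<noteq> {}"
    using K False by (auto intro!: compact_Times)
  have f: "continuous_on ?S f"
    unfolding f_def using K by (intro continuous_intros continuous_on_subset[OF continuous_on_coord_form]) auto
  obtain p where p: "p \<in> ?S" "\<And>y. y \<in> ?S \<Longrightarrow> f p \<le> f y"
    using continuous_attains_inf[OF S f] by blast
  obtain p' where p': "p' \<in> ?S" "\<And>y. y \<in> ?S \<Longrightarrow> f y \<le> f p'"
    using continuous_attains_sup[OF S f] by blast
  have pos: "0 < f p"
  proof -
    have "fst p \<in> \<phi> ` U" "snd p \<noteq> 0"
      using p(1) K by auto
    then show ?thesis
      by (simp add: f_def coord_form_pos)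
  qed
  then have pos': "0 < f p'"
    using p(2)[OF p'(1)] by simp
  have "f p * norm e \<le> sqrt (coord_form U \<phi> z e) \<and> sqrt (coord_form U \<phi> z e) \<le> f p' * norm e" if z: "z \<in> K" for z e
  proof (cases "e = 0")
    case True
    then show ?thesis
      using z K by (auto simp: coord_form_zero subset_eq)
  next
    case False
    then have "sqrt (coord_form U \<phi> z e) = norm e * f (z, (1 / norm e) *\<^sub>R e)"
      using sqrt_coord_form_scale[of z "norm e" "(1 / norm e) *\<^sub>R e"] z K by (auto simp: f_def)
    moreover have "(z, (1 / norm e) *\<^sub>R e) \<in> ?S"
      using z False by simp
    ultimately show ?thesis
      using p(2)[of "(z, (1 / norm e) *\<^sub>R e)"] p'(2)[of "(z, (1 / norm e) *\<^sub>R e)"]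
      by (auto simp: mult.commute[of _ "norm e"] intro!: mult_left_mono)
  qed
  with pos pos' show ?thesis
    by (intro that[of "f p" "f p'"]) auto
qed

text \<open>If the coefficients move by at most \<open>3 * a\<^sup>2\<close> in total, the form
  moves by at most \<open>3 * (a * norm e)\<^sup>2\<close>, that is by three times its value at
  \<open>z0\<close>. The sum is four times that value, whose root gives the factor 2.\<close>

lemma coord_form_near:
  assumes z0: "z0 \<in> \<phi> ` U"
  obtains r where "0 < r" "cball z0 r \<subseteq> \<phi> ` U"
    "\<forall>z\<in>cball z0 r. \<forall>e. sqrt (coord_form U \<phi> z e) \<le> 2 * sqrt (coord_form U \<phi> z0 e)"
proof -
  obtain r0 where r0: "0 < r0" "cball z0 r0 \<subseteq> \<phi> ` U"
    using open_chart_image[OF c] z0 open_contains_cball by blast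
  obtain a where a: "0 < a" "\<And>e. a * norm e \<le> sqrt (coord_form U \<phi> z0 e)"
  proof (rule coord_form_bounds[of "{z0}"])
    show "compact {z0}" "{z0} \<subseteq> \<phi> ` U"
      using z0 by simp_all
    fix a b :: real assume "0 < a" "\<forall>z\<in>{z0}. \<forall>e. a * norm e \<le> sqrt (coord_form U \<phi> z e)"
    then show thesis
      by (intro that[of a]) simp_all
  qed
  define D where "D z = (\<Sum>k\<in>Basis \<times> Basis. \<bar>coord_metric (U, \<phi>) (inv_into U \<phi> z) (fst k) (snd k)
      - coord_metric (U, \<phi>) (inv_into U \<phi> z0) (fst k) (snd k)\<bar>)" for z
  have "continuous_on (\<phi> ` U) D"
    unfolding D_def by (intro continuous_intros continuous_on_coord_metric)
  then have "isCont D z0"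
    using open_chart_image[OF c] z0 continuous_on_eq_continuous_at by blast
  moreover have "0 < 3 * a\<^sup>2"
    using a(1) by simp
  ultimately obtain d where d: "0 < d" "\<And>z. dist z z0 < d \<Longrightarrow> dist (D z) (D z0) < 3 * a\<^sup>2"
    unfolding continuous_at_eps_delta by blast
  define r where "r = min r0 (d / 2)"
  have r: "0 < r" "cball z0 r \<subseteq> \<phi> ` U"
    using r0 d(1) by (auto simp: r_def)
  have "sqrt (coord_form U \<phi> z e) \<le> 2 * sqrt (coord_form U \<phi> z0 e)" if z: "z \<in> cball z0 r" for z e
  proof -
    have zU: "z \<in> \<phi> ` U"
      using z r by blast
    have Dz: "D z \<le> 3 * a\<^sup>2"
    proof -
      have "dist (D z) (D z0) < 3 * a\<^sup>2"
        using z d(1) by (intro d(2)) (auto simp: r_def dist_commute)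
      moreover have "D z0 = 0"
        by (simp add: D_def)
      ultimately show ?thesis
        by (simp add: dist_real_def)
    qed
    have "coord_form U \<phi> z e - coord_form U \<phi> z0 e = (\<Sum>k\<in>Basis \<times> Basis. (e \<bullet> fst k) * (e \<bullet> snd k) *
        (coord_metric (U, \<phi>) (inv_into U \<phi> z) (fst k) (snd k) - coord_metric (U, \<phi>) (inv_into U \<phi> z0) (fst k) (snd k)))"
      unfolding coord_form_expand[OF zU] coord_form_expand[OF z0]
      by (simp add: split_beta right_diff_distrib sum_subtractf)
    also have "\<dots> \<le> (\<Sum>k\<in>Basis \<times> Basis. (norm e)\<^sup>2 *
        \<bar>coord_metric (U, \<phi>) (inv_into U \<phi> z) (fst k) (snd k) - coord_metric (U, \<phi>) (inv_into U \<phi> z0) (fst k) (snd k)\<bar>)"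
    proof (rule sum_mono)
      fix k :: "'e \<times> 'e" assume k: "k \<in> Basis \<times> Basis"
      let ?m = "coord_metric (U, \<phi>) (inv_into U \<phi> z) (fst k) (snd k) - coord_metric (U, \<phi>) (inv_into U \<phi> z0) (fst k) (snd k)"
      have "(e \<bullet> fst k) * (e \<bullet> snd k) * ?m \<le> \<bar>(e \<bullet> fst k) * (e \<bullet> snd k)\<bar> * \<bar>?m\<bar>"
        by (metis abs_ge_self abs_mult)
      also have "\<dots> \<le> (norm e)\<^sup>2 * \<bar>?m\<bar>"
        using k by (intro mult_right_mono abs_inner_mult_le) auto
      finally show "(e \<bullet> fst k) * (e \<bullet> snd k) * ?m \<le> (norm e)\<^sup>2 * \<bar>?m\<bar>" .
    qed
    also have "\<dots> = (norm e)\<^sup>2 * D z"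
      by (simp add: D_def sum_distrib_left)
    also have "\<dots> \<le> (norm e)\<^sup>2 * (3 * a\<^sup>2)"
      using Dz by (rule mult_left_mono) simp
    also have "\<dots> = 3 * (a * norm e)\<^sup>2"
      by (simp add: power_mult_distrib)
    also have "\<dots> \<le> 3 * (sqrt (coord_form U \<phi> z0 e))\<^sup>2"
      using a by (intro mult_left_mono power_mono) auto
    also have "\<dots> = 3 * coord_form U \<phi> z0 e"
      using coord_form_nonneg[OF z0] by simp
    finally have "coord_form U \<phi> z e \<le> 2\<^sup>2 * coord_form U \<phi> z0 e"
      by simp
    then have "sqrt (coord_form U \<phi> z e) \<le> sqrt (2\<^sup>2 * coord_form U \<phi> z0 e)"
      by (rule real_sqrt_le_mono)
    then show ?thesis
      by (simp add: real_sqrt_mult)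
  qed
  then show ?thesis
    using r by (intro that) auto
qed

end

section \<open>C1 curves under congruence and affine reparametrization\<close>

lemma C1_curve_cong:
  assumes "C1_curve A a b p" "\<And>t. t \<in> {a..b} \<Longrightarrow> p t = q t"
  shows "C1_curve A a b q"
  unfolding C1_curve_def
proof (intro conjI ballI)
  show "continuous_on {a..b} q"
    using assms continuous_on_cong[of "{a..b}" "{a..b}" p q] by (simp add: C1_curve_def)
  fix c assume "c \<in> A"
  moreover obtain U \<phi> where Uc: "c = (U, \<phi>)"
    by (cases c)
  ultimately obtain r where r: "continuous_on {t \<in> {a..b}. p t \<in> U} r"
      "\<And>t. t \<in> {t \<in> {a..b}. p t \<in> U} \<Longrightarrow> ((\<phi> \<circ> p) has_vector_derivative r t) (at t within {t \<in> {a..b}. p t \<in> U})"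
    using assms(1) unfolding C1_curve_def Let_def by blast
  have S: "{t \<in> {a..b}. p t \<in> U} = {t \<in> {a..b}. q t \<in> U}"
    using assms(2) by auto
  have "((\<phi> \<circ> q) has_vector_derivative r t) (at t within {t \<in> {a..b}. q t \<in> U})"
    if t: "t \<in> {t \<in> {a..b}. q t \<in> U}" for t
    by (rule has_vector_derivative_transform[OF t _ r(2)[of t, unfolded S, OF t]]) (simp add: assms(2))
  then show "case c of (U, \<phi>) \<Rightarrow> let S = {t \<in> {a..b}. q t \<in> U} in
      \<exists>r. continuous_on S r \<and> (\<forall>t\<in>S. ((\<phi> \<circ> q) has_vector_derivative r t) (at t within S))"
    using r(1) unfolding Uc S by (auto simp: Let_def)
qed

lemma C1_curve_affine:
  assumes p: "C1_curve A a' b' p" and sub: "(\<lambda>t. m * t + c) ` {a..b} \<subseteq> {a'..b'}"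
  shows "C1_curve A a b (\<lambda>t. p (m * t + c))"
  unfolding C1_curve_def
proof (intro conjI ballI)
  show "continuous_on {a..b} (\<lambda>t. p (m * t + c))"
  proof (rule continuous_on_compose2[OF _ _ sub])
    show "continuous_on {a'..b'} p"
      using p by (simp add: C1_curve_def)
  qed (intro continuous_intros)
  fix d assume "d \<in> A"
  obtain U \<phi> where Uc: "d = (U, \<phi>)"
    by (cases d)
  let ?S = "{t \<in> {a'..b'}. p t \<in> U}" and ?T = "{t \<in> {a..b}. p (m * t + c) \<in> U}"
  from \<open>d \<in> A\<close> obtain r where r: "continuous_on ?S r"
      "\<And>t. t \<in> ?S \<Longrightarrow> ((\<phi> \<circ> p) has_vector_derivative r t) (at t within ?S)"
    using p unfolding C1_curve_def Let_def Uc by blast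
  have im: "(\<lambda>t. m * t + c) ` ?T \<subseteq> ?S"
    using sub unfolding image_subset_iff by simp
  have "continuous_on ?T (\<lambda>t. m *\<^sub>R r (m * t + c))"
  proof (rule continuous_on_scaleR[OF continuous_on_const])
    show "continuous_on ?T (\<lambda>t. r (m * t + c))"
      by (rule continuous_on_compose2[OF r(1) _ im]) (intro continuous_intros)
  qed
  moreover have "(\<phi> \<circ> (\<lambda>t. p (m * t + c)) has_vector_derivative m *\<^sub>R r (m * t + c)) (at t within ?T)" if t: "t \<in> ?T" for t
  proof -
    have "((\<lambda>t. m * t + c) has_vector_derivative m) (at t within ?T)"
      by (auto intro!: derivative_eq_intros)
    moreover have "((\<phi> \<circ> p) has_vector_derivative r (m * t + c)) (at (m * t + c) within (\<lambda>t. m * t + c) ` ?T)"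
      by (rule has_vector_derivative_within_subset[OF r(2) im]) (use im t in auto)
    ultimately have "((\<phi> \<circ> p) \<circ> (\<lambda>t. m * t + c) has_vector_derivative m *\<^sub>R r (m * t + c)) (at t within ?T)"
      by (rule vector_diff_chain_within)
    then show ?thesis
      by (simp add: o_def)
  qed
  ultimately show "case d of (U, \<phi>) \<Rightarrow> let S = {t \<in> {a..b}. p (m * t + c) \<in> U} in
      \<exists>r. continuous_on S r \<and> (\<forall>t\<in>S. (\<phi> \<circ> (\<lambda>t. p (m * t + c)) has_vector_derivative r t) (at t within S))"
    unfolding Uc Let_def split_conv by blast
qed

lemma C1_curve_has_velocity:
  assumes p: "C1_curve A a b p" and t: "t \<in> {a<..<b}"
  shows "isCont p t \<and> has_velocity A p t (velocity A p t)"
proof -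
  have cp: "continuous_on {a..b} p"
    using p by (simp add: C1_curve_def)
  have ct: "isCont p t"
    by (rule continuous_on_interior[OF cp]) (use t in simp)
  obtain U \<phi> where d: "(U, \<phi>) \<in> A" "p t \<in> U"
    by (rule chart_at)
  let ?S = "{t \<in> {a..b}. p t \<in> U}"
  obtain r where r: "\<And>t. t \<in> ?S \<Longrightarrow> ((\<phi> \<circ> p) has_vector_derivative r t) (at t within ?S)"
    using p d(1) unfolding C1_curve_def Let_def by blast
  have "continuous_on {a<..<b} p"
    by (rule continuous_on_subset[OF cp]) auto
  then have "open ({a<..<b} \<inter> p -` U)"
    by (rule continuous_open_preimage) (use open_chart_domain[OF d(1)] in auto)
  moreover have "t \<in> {a<..<b} \<inter> p -` U"
    using t d(2) by simp
  ultimately have "at t within {a<..<b} \<inter> p -` U = at t"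
    by (intro at_within_open)
  moreover have "((\<phi> \<circ> p) has_vector_derivative r t) (at t within {a<..<b} \<inter> p -` U)"
    by (rule has_vector_derivative_within_subset[OF r]) (use t d(2) in auto)
  ultimately have "((\<phi> \<circ> p) has_vector_derivative r t) (at t)"
    by simp
  then have hv: "has_velocity A p t (coord_vector A (U, \<phi>) (p t) (r t))"
    by (rule has_velocityI[where p = p and t = t, OF d])
  show ?thesis
    using ct hv unfolding has_velocity_velocity[OF hv ct] by (rule conjI)
qed

end

subsection \<open>Lengths of curves\<close>

context riemannian
begin

abbreviation speed :: "(real \<Rightarrow> 'a) \<Rightarrow> real \<Rightarrow> real" where
  "speed p t \<equiv> tnorm g (p t) (velocity A p t)"

lemma speed_nonneg: "has_velocity A p t (velocity A p t) \<Longrightarrow> 0 \<le> speed p t"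
  by (simp add: tnorm_def has_velocity_def metric_nonneg)

text \<open>The end points 0 and 1 join the break points because a velocity is a two-sided
  derivative.\<close>

lemma piecewise_C1_velocity:
  assumes p: "piecewise_C1_curve A p"
  obtains N where "finite N" "0 \<in> N" "1 \<in> N"
    "\<forall>t\<in>{0..1} - N. isCont p t \<and> has_velocity A p t (velocity A p t)"
proof -
  obtain N where N: "finite N" "\<And>a b. 0 \<le> a \<Longrightarrow> a < b \<Longrightarrow> b \<le> 1 \<Longrightarrow> {a<..<b} \<inter> N = {} \<Longrightarrow> C1_curve A a b p"
    using p unfolding piecewise_C1_curve_def by blast
  show ?thesis
  proof (rule that[of "insert 0 (insert 1 N)"])
    show "\<forall>t\<in>{0..1} - insert 0 (insert 1 N). isCont p t \<and> has_velocity A p t (velocity A p t)"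
    proof
    fix t :: real assume t: "t \<in> {0..1} - insert 0 (insert 1 N)"
    have "open ({0<..<1} - N)" "t \<in> {0<..<1} - N"
      using N(1) t by (auto intro!: open_Diff finite_imp_closed)
    then obtain e where e: "0 < e" "ball t e \<subseteq> {0<..<1} - N"
      using open_contains_ball by blast
    have sub: "{t - e / 2..t + e / 2} \<subseteq> {0<..<1} - N"
      using e by (intro order.trans[OF _ e(2)]) (auto simp: dist_real_def)
    have "t - e / 2 \<in> {0<..<1} - N" "t + e / 2 \<in> {0<..<1} - N"
      by (rule subsetD[OF sub], use e(1) in simp)+
    moreover have "{t - e / 2<..<t + e / 2} \<subseteq> {t - e / 2..t + e / 2}"
      by auto
    then have "{t - e / 2<..<t + e / 2} \<inter> N = {}"
      using sub by blast
    ultimately have "C1_curve A (t - e / 2) (t + e / 2) p"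
      using e(1) by (intro N(2)) simp_all
    then show "isCont p t \<and> has_velocity A p t (velocity A p t)"
      by (rule C1_curve_has_velocity) (use e(1) in auto)
    qed
  qed (use N in auto)
qed

text \<open>In a single chart the speed coincides, off the two end points, with a continuous
  function built from the one-sided coordinate derivative and the form of the metric.\<close>

lemma speed_integrable_chart:
  assumes p: "C1_curve A u v p" and c: "(U, \<phi>) \<in> A" and sub: "p ` {u..v} \<subseteq> U"
  shows "speed p integrable_on {u..v}"
proof -
  have S: "{t \<in> {u..v}. p t \<in> U} = {u..v}"
    using sub by auto
  have "\<exists>r. continuous_on {t \<in> {u..v}. p t \<in> U} r \<and> (\<forall>t\<in>{t \<in> {u..v}. p t \<in> U}.
      ((\<phi> \<circ> p) has_vector_derivative r t) (at t within {t \<in> {u..v}. p t \<in> U}))"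
    using p c unfolding C1_curve_def Let_def by blast
  then obtain r where r: "continuous_on {u..v} r"
      "\<And>t. t \<in> {u..v} \<Longrightarrow> ((\<phi> \<circ> p) has_vector_derivative r t) (at t within {u..v})"
    unfolding S by blast
  have "continuous_on {u..v} (\<lambda>t. \<phi> (p t))"
    using p sub unfolding C1_curve_def by (intro continuous_on_compose2[OF continuous_on_chart[OF c]]) auto
  then have "continuous_on {u..v} (\<lambda>t. (\<phi> (p t), r t))"
    using r(1) by (rule continuous_on_Pair)
  then have "continuous_on {u..v} (\<lambda>t. coord_form U \<phi> (fst (\<phi> (p t), r t)) (snd (\<phi> (p t), r t)))"
    by (rule continuous_on_compose2[OF continuous_on_coord_form[OF c]]) (use sub in auto)
  then have i1: "(\<lambda>t. sqrt (coord_form U \<phi> (\<phi> (p t)) (r t))) integrable_on {u..v}"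
    by (intro integrable_continuous_real continuous_intros) simp
  have i2: "speed p t = sqrt (coord_form U \<phi> (\<phi> (p t)) (r t))" if t: "t \<in> {u..v} - {u, v}" for t
  proof -
    have t': "t \<in> {u<..<v}"
      using t by auto
    note v = C1_curve_has_velocity[OF p t', THEN conjunct2] and ct = C1_curve_has_velocity[OF p t', THEN conjunct1]
    have pU: "p t \<in> U"
      using sub t by auto
    have "((\<phi> \<circ> p) has_vector_derivative velocity A p t (U, \<phi>)) (at t)"
      by (rule has_velocity_chart[OF v ct c pU])
    moreover have "((\<phi> \<circ> p) has_vector_derivative r t) (at t)"
      using r(2)[of t] t' by (simp add: at_within_Icc_at)
    ultimately have "velocity A p t (U, \<phi>) = r t"
      by (rule vector_derivative_unique_at)
    then show ?thesis
      using tnorm_chart[OF c _ pU, of "velocity A p t"] v by (simp add: has_velocity_def)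
  qed
  show ?thesis
    by (rule integrable_spike_finite[where S = "{u, v}", OF _ i2 i1]) simp_all
qed

text \<open>Integrability must be secured because \<open>integral\<close> takes a default value
  otherwise, and lengths would lose their meaning. It is a local property, so a compactness argument
  reduces it to short intervals lying in one chart.\<close>

lemma speed_integrable:
  assumes p: "piecewise_C1_curve A p"
  shows "speed p integrable_on {0..1}"
proof -
  obtain N where N: "finite N" "\<And>a b. 0 \<le> a \<Longrightarrow> a < b \<Longrightarrow> b \<le> 1 \<Longrightarrow> {a<..<b} \<inter> N = {} \<Longrightarrow> C1_curve A a b p"
    and cont: "continuous_on {0..1} p"
    using p unfolding piecewise_C1_curve_def by blast
  have "speed p integrable_on cbox 0 1"
  proof (rule integrable_on_little_subintervals, intro ballI)
    fix x :: real assume x: "x \<in> cbox 0 1"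
    obtain U \<phi> where c: "(U, \<phi>) \<in> A" "p x \<in> U"
      by (rule chart_at)
    have "openin (top_of_set {0..1}) ({0..1} \<inter> p -` U)"
      by (rule continuous_openin_preimage_gen[OF cont open_chart_domain[OF c(1)]])
    moreover have "x \<in> {0..1} \<inter> p -` U"
      using x c(2) by simp
    ultimately obtain d1 where d1: "0 < d1" "ball x d1 \<inter> {0..1} \<subseteq> {0..1} \<inter> p -` U"
      unfolding openin_contains_ball by blast
    obtain d2 where d2: "0 < d2" "\<And>y. y \<in> N \<Longrightarrow> y \<noteq> x \<Longrightarrow> d2 \<le> dist x y"
      using finite_set_avoid[OF N(1), of x] by blast
    \<comment> \<open>The centre \<open>x\<close> may itself be a break point, so only intervals
      without \<open>x\<close> in their interior are treated; the two sides of \<open>x\<close> are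
      glued afterwards.\<close>
    have int: "speed p integrable_on {u..v}"
      if "u < v" "{u..v} \<subseteq> ball x (min d1 d2)" "{u..v} \<subseteq> {0..1}" "x \<notin> {u<..<v}" for u v
    proof (rule speed_integrable_chart[OF _ c(1)])
      have "y \<notin> {u<..<v}" if y: "y \<in> N" for y
      proof
        assume "y \<in> {u<..<v}"
        then have "y \<in> ball x (min d1 d2)" "y \<noteq> x"
          using \<open>{u..v} \<subseteq> ball x (min d1 d2)\<close> \<open>x \<notin> {u<..<v}\<close> greaterThanLessThan_subseteq_atLeastAtMost_iff by (auto simp del: mem_ball)
        then show False
          using d2(2)[OF y] by simp
      qed
      then show "C1_curve A u v p"
        using that by (intro N(2)) auto
      show "p ` {u..v} \<subseteq> U"
      proof
        fix z assume "z \<in> p ` {u..v}"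
        then obtain y where "y \<in> {u..v}" "z = p y" by blast
        then have "y \<in> ball x d1 \<inter> {0..1}"
          using that(2,3) by auto
        then show "z \<in> U"
          using d1(2) \<open>z = p y\<close> by blast
      qed
    qed
    show "\<exists>d>0. \<forall>u v. x \<in> cbox u v \<and> cbox u v \<subseteq> ball x d \<and> cbox u v \<subseteq> cbox 0 1 \<longrightarrow> speed p integrable_on cbox u v"
    proof (intro exI[of _ "min d1 d2"] conjI allI impI)
      show "0 < min d1 d2"
        using d1 d2 by simp
      fix u v assume uv: "x \<in> cbox u v \<and> cbox u v \<subseteq> ball x (min d1 d2) \<and> cbox u v \<subseteq> cbox 0 1"
      have sub: "{u..x} \<subseteq> {u..v}" "{x..v} \<subseteq> {u..v}"
        using uv by auto
      have "speed p integrable_on {u..x}"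
      proof (cases "u < x")
        case True
        then show ?thesis
          using uv sub by (intro int) (auto simp del: mem_ball)
      next
        case False
        then have "cbox x x = {u..x}"
          using uv by auto
        then show ?thesis
          using integrable_on_refl[of "speed p" x] by (simp only:)
      qed
      moreover have "speed p integrable_on {x..v}"
      proof (cases "x < v")
        case True
        then show ?thesis
          using uv sub by (intro int) (auto simp del: mem_ball)
      next
        case False
        then have "cbox x x = {x..v}"
          using uv by auto
        then show ?thesis
          using integrable_on_refl[of "speed p" x] by (simp only:)
      qed
      ultimately show "speed p integrable_on cbox u v"
        using Henstock_Kurzweil_Integration.integrable_combine[of u x v "speed p"] uv by auto
    qed
  qed
  then show ?thesis by simp
qed

lemma speed_has_integral: "piecewise_C1_curve A p \<Longrightarrow> (speed p has_integral curve_length A g p) {0..1}"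
  unfolding curve_length_def by (intro integrable_integral speed_integrable)

lemma curve_length_nonneg:
  assumes p: "piecewise_C1_curve A p"
  shows "0 \<le> curve_length A g p"
proof -
  obtain N where N: "finite N" "0 \<in> N" "1 \<in> N" "\<forall>t\<in>{0..1} - N. isCont p t \<and> has_velocity A p t (velocity A p t)"
    by (rule piecewise_C1_velocity[OF p])
  have "((\<lambda>t. if t \<in> N then 0 else speed p t) has_integral curve_length A g p) {0..1}"
    by (rule has_integral_spike_finite[OF N(1) _ speed_has_integral[OF p]]) simp
  then show ?thesis
    by (rule has_integral_nonneg) (use N(4) speed_nonneg in simp)
qed

text \<open>One change of variables serves both halves of a concatenation and the reversal: the
  factor \<open>\<bar>m\<bar>\<close> in the speed cancels the one from the substitution. The image
  equation is kept in the shape produced by \<open>has_integral_affinity\<close>.\<close>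

lemma speed_affine_has_integral:
  assumes p: "piecewise_C1_curve A p" and m: "m \<noteq> 0"
    and im: "{a..b} = (\<lambda>x. (1 / m) *\<^sub>R x + - ((1 / m) *\<^sub>R c)) ` {0..1}"
    and q: "\<And>t. t \<in> {a<..<b} \<Longrightarrow> q t = p (m * t + c)"
  shows "(speed q has_integral curve_length A g p) {a..b}"
proof -
  obtain N where N: "finite N" "0 \<in> N" "1 \<in> N" "\<forall>t\<in>{0..1} - N. isCont p t \<and> has_velocity A p t (velocity A p t)"
    by (rule piecewise_C1_velocity[OF p])
  have "(speed p has_integral curve_length A g p) (cbox 0 1)"
    using speed_has_integral[OF p] by simp
  from has_integral_mult_right[OF has_integral_affinity[OF this m, of c], of "\<bar>m\<bar>"]
  have "((\<lambda>t. \<bar>m\<bar> * speed p (m * t + c)) has_integral curve_length A g p) {a..b}"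
    using m by (simp add: im)
  then show ?thesis
  proof (rule has_integral_spike_finite[rotated 2])
    show "finite ({a, b} \<union> (\<lambda>x. (x - c) / m) ` N)"
      using N(1) by simp
    fix t assume t: "t \<in> {a..b} - ({a, b} \<union> (\<lambda>x. (x - c) / m) ` N)"
    let ?s = "m * t + c"
    have "t \<in> (\<lambda>x. (1 / m) *\<^sub>R x + - ((1 / m) *\<^sub>R c)) ` {0..1}"
      using t im by simp
    then have s01: "?s \<in> {0..1}"
      using m by (auto simp: field_simps)
    have "?s \<notin> N"
    proof
      assume "?s \<in> N"
      then have "(?s - c) / m \<in> (\<lambda>x. (x - c) / m) ` N"
        by blast
      then show False
        using t m by simp
    qed
    then have cs: "isCont p ?s" and vs: "has_velocity A p ?s (velocity A p ?s)"
      using N(4) s01 by auto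
    have t': "t \<in> {a<..<b}"
      using t by auto
    have "isCont (\<lambda>t. p (m * t + c)) t"
      by (rule isCont_o2[of t "\<lambda>t. m * t + c" p]) (use cs in auto)
    then have "velocity A (\<lambda>t. p (m * t + c)) t = (\<lambda>d. m *\<^sub>R velocity A p ?s d)"
      by (rule has_velocity_velocity[OF has_velocity_affine[OF vs]])
    moreover have "velocity A q t = velocity A (\<lambda>t. p (m * t + c)) t"
      by (rule velocity_cong[of "{a<..<b}"]) (use t' q in auto)
    ultimately show "speed q t = \<bar>m\<bar> * speed p ?s"
      using q[OF t'] vs tnorm_scale by (simp add: has_velocity_def)
  qed
qed

lemma piecewise_C1_joinpaths:
  assumes p: "piecewise_C1_curve A p" and q: "piecewise_C1_curve A q" and pq: "p 1 = q 0"
  shows "piecewise_C1_curve A (p +++ q)"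
proof -
  obtain N1 where N1: "finite N1" "\<And>a b. 0 \<le> a \<Longrightarrow> a < b \<Longrightarrow> b \<le> 1 \<Longrightarrow> {a<..<b} \<inter> N1 = {} \<Longrightarrow> C1_curve A a b p"
    and c1: "continuous_on {0..1} p"
    using p unfolding piecewise_C1_curve_def by blast
  obtain N2 where N2: "finite N2" "\<And>a b. 0 \<le> a \<Longrightarrow> a < b \<Longrightarrow> b \<le> 1 \<Longrightarrow> {a<..<b} \<inter> N2 = {} \<Longrightarrow> C1_curve A a b q"
    and c2: "continuous_on {0..1} q"
    using q unfolding piecewise_C1_curve_def by blast
  define N where "N = insert (1/2) ((\<lambda>x. x / 2) ` N1 \<union> (\<lambda>x. (x + 1) / 2) ` N2)"
  have "C1_curve A a b (p +++ q)" if ab: "0 \<le> a" "a < b" "b \<le> 1" "{a<..<b} \<inter> N = {}" for a b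
  proof -
    have nN: "x \<notin> N" if "a < x" "x < b" for x
      using ab(4) that by auto
    have "1/2 \<in> N"
      by (simp add: N_def)
    then consider "b \<le> 1/2" | "1/2 \<le> a"
      using nN[of "1/2"] by linarith
    then show ?thesis
    proof cases
      case 1
      have "x \<notin> N1" if "2 * a < x" "x < 2 * b" for x
        using nN[of "x / 2"] that unfolding N_def by auto
      then have "C1_curve A (2 * a) (2 * b) p"
        using ab 1 by (intro N1(2)) auto
      then have "C1_curve A a b (\<lambda>t. p (2 * t + 0))"
        by (rule C1_curve_affine) auto
      then show ?thesis
        by (rule C1_curve_cong) (use 1 in \<open>auto simp: joinpaths_def\<close>)
    next
      case 2
      have "x \<notin> N2" if "2 * a - 1 < x" "x < 2 * b - 1" for x
        using nN[of "(x + 1) / 2"] that unfolding N_def by auto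
      then have "C1_curve A (2 * a - 1) (2 * b - 1) q"
        using ab 2 by (intro N2(2)) auto
      then have "C1_curve A a b (\<lambda>t. q (2 * t + - 1))"
        by (rule C1_curve_affine) auto
      then show ?thesis
      proof (rule C1_curve_cong)
        fix t assume "t \<in> {a..b}"
        show "q (2 * t + - 1) = (p +++ q) t"
        proof (cases "t = 1/2")
          case True
          then have "2 * t = 1" "2 * t + - 1 = 0" "t \<le> 1/2" by simp_all
          then show ?thesis
            unfolding joinpaths_def using pq by (simp only: if_True)
        next
          case False
          then show ?thesis
            using 2 \<open>t \<in> {a..b}\<close> by (simp add: joinpaths_def)
        qed
      qed
    qed
  qed
  moreover have "continuous_on {0..1} (p +++ q)"
    using path_join_imp[of p q] c1 c2 pq by (simp add: path_def pathfinish_def pathstart_def)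
  moreover have "finite N"
    using N1 N2 by (simp add: N_def)
  ultimately show ?thesis
    unfolding piecewise_C1_curve_def by blast
qed

lemma curve_length_joinpaths:
  assumes p: "piecewise_C1_curve A p" and q: "piecewise_C1_curve A q"
  shows "curve_length A g (p +++ q) = curve_length A g p + curve_length A g q"
proof -
  have im1: "{0..1/2} = (\<lambda>x. (1 / 2) *\<^sub>R x + - ((1 / 2) *\<^sub>R 0)) ` {0..1::real}"
    using image_affinity_atLeastAtMost[of "1/2" 0 0 "1::real"] by simp
  have 1: "(speed (p +++ q) has_integral curve_length A g p) {0..1/2}"
    by (rule speed_affine_has_integral[OF p _ im1]) (auto simp: joinpaths_def)
  have im2: "{1/2..1} = (\<lambda>x. (1 / 2) *\<^sub>R x + - ((1 / 2) *\<^sub>R - 1)) ` {0..1::real}"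
    using image_affinity_atLeastAtMost[of "1/2" "1/2" 0 "1::real"] by simp
  have 2: "(speed (p +++ q) has_integral curve_length A g q) {1/2..1}"
    by (rule speed_affine_has_integral[OF q _ im2]) (auto simp: joinpaths_def)
  have "(speed (p +++ q) has_integral curve_length A g p + curve_length A g q) {0..1}"
    by (rule has_integral_combine[OF _ _ 1 2]) auto
  then show ?thesis
    unfolding curve_length_def by (rule integral_unique)
qed

lemma piecewise_C1_reversepath:
  assumes p: "piecewise_C1_curve A p"
  shows "piecewise_C1_curve A (reversepath p)"
proof -
  obtain N where N: "finite N" "\<And>a b. 0 \<le> a \<Longrightarrow> a < b \<Longrightarrow> b \<le> 1 \<Longrightarrow> {a<..<b} \<inter> N = {} \<Longrightarrow> C1_curve A a b p"
    and c: "continuous_on {0..1} p"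
    using p unfolding piecewise_C1_curve_def by blast
  have "C1_curve A a b (reversepath p)" if ab: "0 \<le> a" "a < b" "b \<le> 1" "{a<..<b} \<inter> (\<lambda>x. 1 - x) ` N = {}" for a b
  proof -
    have "x \<notin> N" if "1 - b < x" "x < 1 - a" for x
    proof
      assume "x \<in> N"
      then have "1 - x \<in> {a<..<b} \<inter> (\<lambda>x. 1 - x) ` N"
        using that by auto
      then show False
        using ab(4) by blast
    qed
    then have "C1_curve A (1 - b) (1 - a) p"
      using ab by (intro N(2)) auto
    then have "C1_curve A a b (\<lambda>t. p (- 1 * t + 1))"
      by (rule C1_curve_affine) auto
    then show ?thesis
      by (rule C1_curve_cong) (simp add: reversepath_def)
  qed
  moreover have "continuous_on {0..1} (reversepath p)"
    using c path_reversepath[of p] by (simp add: path_def)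
  moreover have "finite ((\<lambda>x. 1 - x) ` N)"
    using N by simp
  ultimately show ?thesis
    unfolding piecewise_C1_curve_def by blast
qed

lemma curve_length_reversepath:
  assumes p: "piecewise_C1_curve A p"
  shows "curve_length A g (reversepath p) = curve_length A g p"
proof -
  have im: "{0..1} = (\<lambda>x. (1 / - 1) *\<^sub>R x + - ((1 / - 1) *\<^sub>R 1)) ` {0..1::real}"
    using image_affinity_atLeastAtMost[of "-1" 1 0 "1::real"] by simp
  have "(speed (reversepath p) has_integral curve_length A g p) {0..1}"
    by (rule speed_affine_has_integral[OF p _ im]) (auto simp: reversepath_def)
  then show ?thesis
    unfolding curve_length_def by (rule integral_unique)
qed

end

subsection \<open>The Riemannian distance\<close>

context riemannian
begin

abbreviation \<rho> :: "'a \<Rightarrow> 'a \<Rightarrow> real" where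
  "\<rho> \<equiv> riem_dist A g"

text \<open>The straight segment in coordinates is pulled back to the manifold. Its coordinate
  velocity is the constant \<open>\<phi> y - \<phi> x\<close>, so its speed is the form evaluated at
  the moving point of the segment.\<close>

lemma segment_curve:
  assumes c: "(U, \<phi>) \<in> A" and xy: "x \<in> U" "y \<in> U" and sub: "closed_segment (\<phi> x) (\<phi> y) \<subseteq> \<phi> ` U"
    and bound: "\<And>z. z \<in> closed_segment (\<phi> x) (\<phi> y) \<Longrightarrow> sqrt (coord_form U \<phi> z (\<phi> y - \<phi> x)) \<le> B"
  obtains p where "piecewise_C1_curve A p" "p 0 = x" "p 1 = y" "curve_length A g p \<le> B"
proof -
  define l where "l t = \<phi> x + t *\<^sub>R (\<phi> y - \<phi> x)" for t
  define p where "p t = inv_into U \<phi> (l t)" for t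
  have l_seg: "l t \<in> closed_segment (\<phi> x) (\<phi> y)" if "t \<in> {0..1}" for t
    using that unfolding in_segment l_def by (intro exI[of _ t]) (simp add: algebra_simps)
  have l_in: "l t \<in> \<phi> ` U" if "t \<in> {0..1}" for t
    using l_seg[OF that] sub by blast
  have p_in: "p t \<in> U" if "t \<in> {0..1}" for t
    using l_in[OF that] unfolding p_def by (rule inv_into_into)
  have \<phi>p: "\<phi> (p t) = l t" if "t \<in> {0..1}" for t
    using l_in[OF that] unfolding p_def by (rule f_inv_into_f)
  have lcont: "continuous_on S l" for S
    unfolding l_def by (intro continuous_intros)
  have lder: "(l has_vector_derivative (\<phi> y - \<phi> x)) (at t within S)" for t S
    unfolding l_def by (auto intro!: derivative_eq_intros)
  have pcont: "continuous_on {0..1} p"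
    unfolding p_def by (rule continuous_on_compose2[OF continuous_on_chart_inverse[OF c] lcont]) (use l_in in auto)
  have "C1_curve A 0 1 p"
    unfolding C1_curve_def
  proof (intro conjI pcont ballI)
    fix d assume dA: "d \<in> A"
    obtain W \<psi> where d: "d = (W, \<psi>)"
      by (cases d)
    have dA: "(W, \<psi>) \<in> A"
      using dA d by simp
    let ?S = "{t \<in> {0..1}. p t \<in> W}"
    have l_im: "l t \<in> \<phi> ` (U \<inter> W)" if "t \<in> ?S" for t
      using p_in[of t] \<phi>p[of t] that by (metis (no_types, lifting) IntI image_eqI mem_Collect_eq)
    \<comment> \<open>The derivative in another chart is the image of the constant coordinate
      velocity under the derivative of the transition map, and it is continuous because that map is
      smooth.\<close>
    define r where "r t = frechet_derivative (\<psi> \<circ> inv_into U \<phi>) (at (l t)) (\<phi> y - \<phi> x)" for t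
    have "continuous_on ?S r"
      unfolding r_def
      by (rule continuous_on_compose2[OF smooth_on_imp_continuous_derivative[OF smooth_transition[OF c dA]] lcont])
        (use l_im in auto)
    moreover have "((\<psi> \<circ> p) has_vector_derivative r t) (at t within ?S)" if t: "t \<in> ?S" for t
    proof -
      have D: "((\<psi> \<circ> inv_into U \<phi>) has_derivative frechet_derivative (\<psi> \<circ> inv_into U \<phi>) (at (l t))) (at (l t))"
        by (rule smooth_on_imp_has_derivative[OF smooth_transition[OF c dA] l_im[OF t]])
      have "((\<psi> \<circ> inv_into U \<phi>) \<circ> l has_derivative
          (frechet_derivative (\<psi> \<circ> inv_into U \<phi>) (at (l t)) \<circ> (\<lambda>s. s *\<^sub>R (\<phi> y - \<phi> x)))) (at t within ?S)"
        by (rule diff_chain_within[OF lder[unfolded has_vector_derivative_def] has_derivative_at_withinI[OF D]])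
      also have "frechet_derivative (\<psi> \<circ> inv_into U \<phi>) (at (l t)) \<circ> (\<lambda>s. s *\<^sub>R (\<phi> y - \<phi> x)) = (\<lambda>s. s *\<^sub>R r t)"
        using linear_cmul[OF has_derivative_linear[OF D]] by (auto simp: r_def)
      finally show ?thesis
        unfolding has_vector_derivative_def by (simp add: p_def o_def)
    qed
    ultimately show "case d of (U, \<phi>) \<Rightarrow> let S = {t \<in> {0..1}. p t \<in> U} in
      \<exists>r. continuous_on S r \<and> (\<forall>t\<in>S. ((\<phi> \<circ> p) has_vector_derivative r t) (at t within S))"
      unfolding d Let_def split_conv by blast
  qed
  note C1 = this
  have sub1: "C1_curve A a b p" if "0 \<le> a" "b \<le> 1" for a b
  proof -
    have "(\<lambda>t. 1 * t + 0) ` {a..b} \<subseteq> {0..1::real}"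
      using that by auto
    from C1_curve_affine[OF C1 this] show ?thesis
      by simp
  qed
  have pw: "piecewise_C1_curve A p"
    unfolding piecewise_C1_curve_def using pcont sub1 by (intro conjI exI[of _ "{}"]) auto
  have speed: "speed p t \<le> B" if t: "t \<in> {0<..<1}" for t
  proof -
    have t': "t \<in> {0..1}"
      using t by auto
    note v = C1_curve_has_velocity[OF C1 t]
    have "((\<phi> \<circ> p) has_vector_derivative velocity A p t (U, \<phi>)) (at t)"
      using v by (intro has_velocity_chart c p_in t') auto
    moreover have "((\<phi> \<circ> p) has_vector_derivative (\<phi> y - \<phi> x)) (at t)"
      by (rule has_vector_derivative_transform_within_open[OF lder, of "{0<..<1}"]) (use t \<phi>p in auto)
    ultimately have "velocity A p t (U, \<phi>) = \<phi> y - \<phi> x"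
      by (rule vector_derivative_unique_at)
    then show ?thesis
      using tnorm_chart[OF c _ p_in[OF t'], of "velocity A p t"] v bound[OF l_seg[OF t']] \<phi>p[OF t']
      by (simp add: has_velocity_def)
  qed
  have "curve_length A g p = integral {0<..<1} (speed p)"
    unfolding curve_length_def by (simp add: integral_open_interval_real)
  also have "\<dots> \<le> integral {0<..<1} (\<lambda>t::real. B)"
    by (rule integral_le) (use speed speed_integrable[OF pw] in \<open>auto simp: integrable_on_open_interval_real\<close>)
  also have "\<dots> = B"
    using integral_open_interval_real[of 0 1 "\<lambda>t. B"] by simp
  finally have "curve_length A g p \<le> B" .
  moreover have "p 0 = x" "p 1 = y"
    using chart_inverse[OF c] xy by (simp_all add: p_def l_def)
  ultimately show ?thesis
    using pw by (intro that)
qed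

definition joined :: "'a \<Rightarrow> 'a \<Rightarrow> bool" where
  "joined x y \<longleftrightarrow> (\<exists>p. piecewise_C1_curve A p \<and> p 0 = x \<and> p 1 = y)"

lemma joined_chart_ball:
  obtains W where "open W" "x \<in> W" "\<forall>y\<in>W. joined x y"
proof -
  obtain U \<phi> where c: "(U, \<phi>) \<in> A" "x \<in> U"
    by (rule chart_at)
  obtain r where r: "0 < r" "cball (\<phi> x) r \<subseteq> \<phi> ` U"
    using open_chart_image[OF c(1)] c(2) open_contains_cball by blast
  show ?thesis
  proof (rule that)
    show "open {y \<in> U. \<phi> y \<in> ball (\<phi> x) r}"
      by (rule open_chart_preimage[OF c(1)]) simp
    show "x \<in> {y \<in> U. \<phi> y \<in> ball (\<phi> x) r}"
      using c r by simp
    show "\<forall>y\<in>{y \<in> U. \<phi> y \<in> ball (\<phi> x) r}. joined x y"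
    proof
      fix y assume y: "y \<in> {y \<in> U. \<phi> y \<in> ball (\<phi> x) r}"
      have sub: "closed_segment (\<phi> x) (\<phi> y) \<subseteq> cball (\<phi> x) r"
        using y r by (intro closed_segment_subset) auto
      obtain a b where "0 < a" "0 < b" "\<forall>z\<in>cball (\<phi> x) r. \<forall>e. a * norm e \<le> sqrt (coord_form U \<phi> z e)"
        and b: "\<forall>z\<in>cball (\<phi> x) r. \<forall>e. sqrt (coord_form U \<phi> z e) \<le> b * norm e"
        by (rule coord_form_bounds[OF c(1) compact_cball r(2)])
      show "joined x y"
      proof (rule segment_curve[OF c])
        show "y \<in> U" using y by simp
        show "closed_segment (\<phi> x) (\<phi> y) \<subseteq> \<phi> ` U"
          using sub r(2) by blast
        show "sqrt (coord_form U \<phi> z (\<phi> y - \<phi> x)) \<le> b * norm (\<phi> y - \<phi> x)"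
          if "z \<in> closed_segment (\<phi> x) (\<phi> y)" for z
          using that sub b by blast
      qed (auto simp: joined_def)
    qed
  qed
qed

text \<open>Being joined is an equivalence relation with open classes, so connectedness leaves one
  class. Consequently the set of lengths whose infimum is the distance is never empty, and lower
  bounds on lengths are lower bounds on the distance.\<close>

lemma joined: "joined x y"
proof (rule connected_equivalence_relation[OF conn])
  show "joined y x" if j: "joined x y" for x y
  proof -
    obtain p where "piecewise_C1_curve A p" "p 0 = x" "p 1 = y"
      using j unfolding joined_def by blast
    then show ?thesis
      unfolding joined_def using piecewise_C1_reversepath by (intro exI[of _ "reversepath p"]) (simp add: reversepath_def)
  qed
  show "joined x z" if j: "joined x y" "joined y z" for x y z
  proof -
    obtain p q where "piecewise_C1_curve A p" "p 0 = x" "p 1 = y" "piecewise_C1_curve A q" "q 0 = y" "q 1 = z"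
      using j unfolding joined_def by blast
    then show ?thesis
      unfolding joined_def using piecewise_C1_joinpaths[of p q] by (intro exI[of _ "p +++ q"]) (simp add: joinpaths_def)
  qed
  show "\<exists>T. openin (top_of_set UNIV) T \<and> a \<in> T \<and> (\<forall>x\<in>T. joined a x)" for a
  proof -
    obtain W where "open W" "a \<in> W" "\<forall>y\<in>W. joined a y"
      by (rule joined_chart_ball)
    then show ?thesis
      by (intro exI[of _ W]) simp
  qed
qed simp_all

lemma dist_le_curve_length:
  assumes "piecewise_C1_curve A p" "p 0 = x" "p 1 = y"
  shows "\<rho> x y \<le> curve_length A g p"
  unfolding riem_dist_def
proof (rule cInf_lower)
  show "bdd_below {curve_length A g p |p. piecewise_C1_curve A p \<and> p 0 = x \<and> p 1 = y}"
    by (rule bdd_belowI[of _ 0]) (auto intro: curve_length_nonneg)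
qed (use assms in blast)

lemma dist_greatest:
  assumes "\<And>p. piecewise_C1_curve A p \<Longrightarrow> p 0 = x \<Longrightarrow> p 1 = y \<Longrightarrow> B \<le> curve_length A g p"
  shows "B \<le> \<rho> x y"
  unfolding riem_dist_def
proof (rule cInf_greatest)
  show "{curve_length A g p |p. piecewise_C1_curve A p \<and> p 0 = x \<and> p 1 = y} \<noteq> {}"
    using joined[of x y] unfolding joined_def by blast
qed (use assms in blast)

lemma dist_approx:
  assumes "\<rho> x y < B"
  obtains p where "piecewise_C1_curve A p" "p 0 = x" "p 1 = y" "curve_length A g p < B"
proof -
  have "\<exists>p. piecewise_C1_curve A p \<and> p 0 = x \<and> p 1 = y \<and> curve_length A g p < B"
    using dist_greatest[of x y B] assms by (meson not_le)
  then show ?thesis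
    using that by blast
qed

lemma dist_nonneg: "0 \<le> \<rho> x y"
  by (rule dist_greatest) (rule curve_length_nonneg)

lemma dist_sym: "\<rho> x y = \<rho> y x"
proof -
  have "\<rho> y x \<le> \<rho> x y" for x y
  proof (rule dist_greatest)
    fix p assume p: "piecewise_C1_curve A p" "p 0 = x" "p 1 = y"
    have "\<rho> y x \<le> curve_length A g (reversepath p)"
      by (rule dist_le_curve_length[OF piecewise_C1_reversepath[OF p(1)]]) (use p in \<open>simp_all add: reversepath_def\<close>)
    then show "\<rho> y x \<le> curve_length A g p"
      by (simp add: curve_length_reversepath[OF p(1)])
  qed
  then show ?thesis
    by (simp add: order_antisym)
qed

lemma dist_triangle: "\<rho> x z \<le> \<rho> x y + \<rho> y z"
proof (rule field_le_epsilon)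
  fix e :: real assume "0 < e"
  then have e: "\<rho> x y < \<rho> x y + e / 2" "\<rho> y z < \<rho> y z + e / 2"
    by simp_all
  obtain p where p: "piecewise_C1_curve A p" "p 0 = x" "p 1 = y" "curve_length A g p < \<rho> x y + e / 2"
    by (rule dist_approx[OF e(1)])
  obtain q where q: "piecewise_C1_curve A q" "q 0 = y" "q 1 = z" "curve_length A g q < \<rho> y z + e / 2"
    by (rule dist_approx[OF e(2)])
  have pq: "p 1 = q 0"
    using p q by simp
  have "\<rho> x z \<le> curve_length A g (p +++ q)"
    by (rule dist_le_curve_length[OF piecewise_C1_joinpaths[OF p(1) q(1) pq]])
      (use p(2) q(3) in \<open>simp_all add: joinpaths_def\<close>)
  then show "\<rho> x z \<le> \<rho> x y + \<rho> y z + e"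
    unfolding curve_length_joinpaths[OF p(1) q(1)] using p(4) q(4) by linarith
qed

lemma dist_le_chart_segment:
  assumes c: "(U, \<phi>) \<in> A" and xy: "x \<in> U" "y \<in> U" and sub: "closed_segment (\<phi> x) (\<phi> y) \<subseteq> \<phi> ` U"
    and bound: "\<And>z. z \<in> closed_segment (\<phi> x) (\<phi> y) \<Longrightarrow> sqrt (coord_form U \<phi> z (\<phi> y - \<phi> x)) \<le> B"
  shows "\<rho> x y \<le> B"
proof (rule segment_curve[OF c xy sub bound])
  fix p assume "piecewise_C1_curve A p" "p 0 = x" "p 1 = y" "curve_length A g p \<le> B"
  then show ?thesis
    using dist_le_curve_length[of p x y] by simp
qed

lemma dist_self: "\<rho> x x = 0"
proof -
  obtain U \<phi> where c: "(U, \<phi>) \<in> A" "x \<in> U"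
    by (rule chart_at)
  have "\<rho> x x \<le> 0"
    by (rule dist_le_chart_segment[OF c c(2)]) (use c in \<open>auto simp: coord_form_zero\<close>)
  then show ?thesis
    using dist_nonneg[of x x] by simp
qed

section \<open>Comparison of the distance with coordinate norms\<close>

text \<open>Coordinate displacement is the integral of the coordinate velocity, whose norm times
  \<open>a\<close> is at most the speed. The upper time \<open>\<tau>\<close> leaves room for curves
  of which only an initial piece lies in the chart.\<close>

lemma chart_curve_length:
  assumes p: "piecewise_C1_curve A p" and c: "(U, \<phi>) \<in> A" and \<tau>: "0 \<le> \<tau>" "\<tau> \<le> 1"
    and sub: "p ` {0..\<tau>} \<subseteq> U" and a: "0 < a"
    and bound: "\<And>t e. t \<in> {0..\<tau>} \<Longrightarrow> a * norm e \<le> sqrt (coord_form U \<phi> (\<phi> (p t)) e)"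
  shows "a * norm (\<phi> (p \<tau>) - \<phi> (p 0)) \<le> curve_length A g p"
proof -
  obtain N where N: "finite N" "0 \<in> N" "1 \<in> N" "\<forall>t\<in>{0..1} - N. isCont p t \<and> has_velocity A p t (velocity A p t)"
    by (rule piecewise_C1_velocity[OF p])
  define h where "h t = (if t \<in> N then 0 else velocity A p t (U, \<phi>))" for t
  define s where "s t = (if t \<in> N then 0 else speed p t)" for t
  have cp: "continuous_on {0..1} p"
    using p by (simp add: piecewise_C1_curve_def)
  have "continuous_on {0..\<tau>} (\<lambda>t. \<phi> (p t))"
    by (rule continuous_on_compose2[OF continuous_on_chart[OF c] continuous_on_subset[OF cp] sub]) (use \<tau> in auto)
  then have "(h has_integral \<phi> (p \<tau>) - \<phi> (p 0)) {0..\<tau>}"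
  proof (intro fundamental_theorem_of_calculus_interior_strong[OF N(1) \<tau>(1)])
    fix t assume t: "t \<in> {0<..<\<tau>} - N"
    then have "t \<in> {0..1} - N"
      using \<tau> by auto
    then have v: "isCont p t" "has_velocity A p t (velocity A p t)"
      using N(4) by auto
    have "p t \<in> U"
      using sub t by auto
    from has_velocity_chart[OF v(2,1) c this] show "((\<lambda>t. \<phi> (p t)) has_vector_derivative h t) (at t)"
      using t by (simp add: h_def o_def)
  qed
  then have hi: "((\<lambda>t. a *\<^sub>R h t) has_integral a *\<^sub>R (\<phi> (p \<tau>) - \<phi> (p 0))) {0..\<tau>}"
    by (rule has_integral_cmul)
  have si: "(s has_integral curve_length A g p) {0..1}"
    by (rule has_integral_spike_finite[OF N(1) _ speed_has_integral[OF p]]) (simp add: s_def)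
  have s0: "0 \<le> s t" if "t \<in> {0..1}" for t
    using N(4) that speed_nonneg[of p t] by (simp add: s_def)
  have s\<tau>: "s integrable_on {0..\<tau>}"
    using integrable_subinterval_real[OF has_integral_integrable[OF si]] \<tau> by auto
  have "norm (a *\<^sub>R (\<phi> (p \<tau>) - \<phi> (p 0))) \<le> integral {0..\<tau>} s"
    unfolding integral_unique[OF hi, symmetric]
  proof (rule integral_norm_bound_integral[OF has_integral_integrable[OF hi] s\<tau>])
    fix t assume t: "t \<in> {0..\<tau>}"
    show "norm (a *\<^sub>R h t) \<le> s t"
    proof (cases "t \<in> N")
      case True
      then show ?thesis
        by (simp add: h_def s_def)
    next
      case False
      then have "has_velocity A p t (velocity A p t)"
        using N(4) t \<tau> by simp
      moreover have "p t \<in> U"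
        using sub t by auto
      ultimately have "speed p t = sqrt (coord_form U \<phi> (\<phi> (p t)) (velocity A p t (U, \<phi>)))"
        by (intro tnorm_chart[OF c]) (simp_all add: has_velocity_def)
      then show ?thesis
        using bound[OF t, of "velocity A p t (U, \<phi>)"] False a by (simp add: h_def s_def)
    qed
  qed
  also have "\<dots> \<le> integral {0..1} s"
    by (rule integral_subset_le) (use s0 s\<tau> \<tau> has_integral_integrable[OF si] in auto)
  also have "\<dots> = curve_length A g p"
    using si by (rule integral_unique)
  finally show ?thesis
    using a by simp
qed

text \<open>A curve that leaves a coordinate ball is cut at its first exit time.\<close>

lemma curve_length_exit:
  assumes p: "piecewise_C1_curve A p" and c: "(U, \<phi>) \<in> A" and x: "p 0 \<in> U" and r: "0 < r" "cball (\<phi> (p 0)) r \<subseteq> \<phi> ` U"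
    and a: "0 < a" and bound: "\<And>z e. z \<in> cball (\<phi> (p 0)) r \<Longrightarrow> a * norm e \<le> sqrt (coord_form U \<phi> z e)"
  shows "(p 1 \<in> U \<and> \<phi> (p 1) \<in> ball (\<phi> (p 0)) r \<and> a * norm (\<phi> (p 1) - \<phi> (p 0)) \<le> curve_length A g p) \<or>
    a * r \<le> curve_length A g p"
proof -
  let ?B = "{y \<in> U. \<phi> y \<in> ball (\<phi> (p 0)) r}"
  have cp: "continuous_on {0..1} p"
    using p by (simp add: piecewise_C1_curve_def)
  define K where "K = {0..1} \<inter> p -` (- ?B)"
  have oB: "open ?B"
    by (rule open_chart_preimage[OF c]) simp
  have K: "closed K"
    unfolding K_def by (rule continuous_closed_preimage[OF cp]) (use oB in auto)
  have le: "a * norm (\<phi> (p \<tau>) - \<phi> (p 0)) \<le> curve_length A g p"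
    if \<tau>: "0 \<le> \<tau>" "\<tau> \<le> 1" and im: "\<forall>t\<in>{0..\<tau>}. p t \<in> U \<and> \<phi> (p t) \<in> cball (\<phi> (p 0)) r" for \<tau>
    by (rule chart_curve_length[OF p c \<tau> _ a]) (use im bound in auto)
  show ?thesis
  proof (cases "K = {}")
    case True
    have in_B: "p t \<in> ?B" if "t \<in> {0..1}" for t
      using True that unfolding K_def by blast
    have "\<forall>t\<in>{0..1}. p t \<in> U \<and> \<phi> (p t) \<in> cball (\<phi> (p 0)) r"
      using in_B ball_subset_cball by blast
    from le[OF _ _ this] in_B[of 1] show ?thesis
      by simp
  next
    case False
    define \<tau> where "\<tau> = Inf K"
    have "K \<subseteq> {0..1}"
      by (auto simp: K_def)
    then have bdd: "bdd_below K"
      by (rule bdd_below_mono[rotated]) simp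
    have \<tau>K: "\<tau> \<in> K"
      unfolding \<tau>_def by (rule closed_contains_Inf[OF False bdd K])
    have \<tau>01: "0 \<le> \<tau>" "\<tau> \<le> 1"
      using \<tau>K \<open>K \<subseteq> {0..1}\<close> by auto
    have "p 0 \<in> ?B"
      using x r by simp
    then have "\<tau> \<noteq> 0"
      using \<tau>K unfolding K_def by blast
    then have \<tau>pos: "0 < \<tau>"
      using \<tau>01 by simp
    have before: "p t \<in> ?B" if "t \<in> {0..<\<tau>}" for t
    proof (rule ccontr)
      assume "p t \<notin> ?B"
      then have "t \<in> K"
        using that \<tau>01 by (simp add: K_def)
      then have "\<tau> \<le> t"
        unfolding \<tau>_def by (rule cInf_lower[OF _ bdd])
      then show False
        using that by simp
    qed
    \<comment> \<open>A priori the curve could leave the chart domain at time \<open>\<tau>\<close>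
      itself. The preimage of the closed coordinate ball is compact, hence closed in the Hausdorff
      space, so the limit point \<open>p \<tau>\<close> still lies over that ball.\<close>
    let ?C = "inv_into U \<phi> ` cball (\<phi> (p 0)) r"
    have "compact ?C"
      by (intro compact_continuous_image continuous_on_subset[OF continuous_on_chart_inverse[OF c] r(2)] compact_cball)
    then have closedC: "closed ?C"
      by (rule compact_imp_closed)
    have "?B \<subseteq> ?C"
    proof
      fix y assume y: "y \<in> ?B"
      then have "y = inv_into U \<phi> (\<phi> y)"
        using chart_inverse[OF c] by simp
      moreover have "\<phi> y \<in> cball (\<phi> (p 0)) r"
        using y by simp
      ultimately show "y \<in> ?C"
        by (rule image_eqI)
    qed
    then have "p ` {0..<\<tau>} \<subseteq> ?C"
      using before by blast
    moreover have cl: "closure {0..<\<tau>} = {0..\<tau>}"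
      using \<tau>pos by simp
    moreover have "continuous_on (closure {0..<\<tau>}) p"
      unfolding cl by (rule continuous_on_subset[OF cp]) (use \<tau>01 in auto)
    ultimately have pC: "p ` {0..\<tau>} \<subseteq> ?C"
      using image_closure_subset[of "{0..<\<tau>}" p ?C] closedC by simp
    have im: "p t \<in> U \<and> \<phi> (p t) \<in> cball (\<phi> (p 0)) r" if t: "t \<in> {0..\<tau>}" for t
    proof -
      obtain z where z: "z \<in> cball (\<phi> (p 0)) r" "p t = inv_into U \<phi> z"
        using pC t by blast
      then have "z \<in> \<phi> ` U"
        using r(2) by blast
      then show ?thesis
        using z by (simp add: inv_into_into f_inv_into_f)
    qed
    have "p \<tau> \<notin> ?B"
      using \<tau>K unfolding K_def by blast
    \<comment> \<open>In the closed ball but outside the open one: the coordinate displacement at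
      the exit time is exactly \<open>r\<close>.\<close>
    then have "norm (\<phi> (p \<tau>) - \<phi> (p 0)) = r"
      using im[of \<tau>] \<tau>01 by (simp add: dist_norm norm_minus_commute)
    then show ?thesis
      using le[OF \<tau>01] im by simp
  qed
qed

text \<open>A curve of length below \<open>a * r\<close> cannot reach the boundary of the coordinate
  ball, so its end point stays inside. Curves that do exit are longer than \<open>a\<close> times
  the displacement anyway, which makes the lower bound hold for the infimum over all curves.\<close>

lemma dist_less_imp_chart:
  assumes c: "(U, \<phi>) \<in> A" and x: "x \<in> U" and r: "0 < r" "cball (\<phi> x) r \<subseteq> \<phi> ` U"
    and a: "0 < a" and bound: "\<And>z e. z \<in> cball (\<phi> x) r \<Longrightarrow> a * norm e \<le> sqrt (coord_form U \<phi> z e)"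
    and less: "\<rho> x y < a * r"
  shows "y \<in> U" "\<phi> y \<in> ball (\<phi> x) r" "a * norm (\<phi> y - \<phi> x) \<le> \<rho> x y"
proof -
  have *: "(y \<in> U \<and> \<phi> y \<in> ball (\<phi> x) r \<and> a * norm (\<phi> y - \<phi> x) \<le> curve_length A g p) \<or> a * r \<le> curve_length A g p"
    if p: "piecewise_C1_curve A p" "p 0 = x" "p 1 = y" for p
    using curve_length_exit[OF p(1) c, of r a] p x r a bound by simp
  obtain p where p: "piecewise_C1_curve A p" "p 0 = x" "p 1 = y" "curve_length A g p < a * r"
    by (rule dist_approx[OF less])
  show y: "y \<in> U" "\<phi> y \<in> ball (\<phi> x) r"
    using *[OF p(1-3)] p(4) by auto
  show "a * norm (\<phi> y - \<phi> x) \<le> \<rho> x y"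
  proof (rule dist_greatest)
    fix p assume p: "piecewise_C1_curve A p" "p 0 = x" "p 1 = y"
    have "a * norm (\<phi> y - \<phi> x) \<le> a * r"
      using y(2) a by (simp add: dist_norm norm_minus_commute)
    then show "a * norm (\<phi> y - \<phi> x) \<le> curve_length A g p"
      using *[OF p] by linarith
  qed
qed

text \<open>The upper Lipschitz bound comes from coordinate segments, the lower one from the exit
  argument centred at \<open>y\<close> instead of \<open>x\<close>.\<close>

lemma dist_chart_equivalent:
  assumes c: "(U, \<phi>) \<in> A" and x: "x \<in> U"
  obtains r a b where "0 < r" "0 < a" "0 < b" "cball (\<phi> x) r \<subseteq> \<phi> ` U"
    "\<forall>y\<in>U. \<forall>z\<in>U. \<phi> y \<in> cball (\<phi> x) r \<longrightarrow> \<phi> z \<in> cball (\<phi> x) r \<longrightarrow>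
      a * norm (\<phi> z - \<phi> y) \<le> \<rho> y z \<and> \<rho> y z \<le> b * norm (\<phi> z - \<phi> y)"
    "\<forall>z\<in>cball (\<phi> x) r. \<forall>e. a * norm e \<le> sqrt (coord_form U \<phi> z e)"
    "\<forall>y. \<rho> x y < a * r \<longrightarrow> y \<in> U \<and> \<phi> y \<in> ball (\<phi> x) r"
proof -
  obtain R where R: "0 < R" "cball (\<phi> x) R \<subseteq> \<phi> ` U"
    using open_chart_image[OF c] x open_contains_cball by blast
  obtain a b where ab: "0 < a" "0 < b"
    and la: "\<forall>z\<in>cball (\<phi> x) R. \<forall>e. a * norm e \<le> sqrt (coord_form U \<phi> z e)"
    and ub: "\<forall>z\<in>cball (\<phi> x) R. \<forall>e. sqrt (coord_form U \<phi> z e) \<le> b * norm e"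
    by (rule coord_form_bounds[OF c compact_cball R(2)])
  \<comment> \<open>Points of the \<open>r\<close>-ball are at most \<open>2 * r\<close> apart, and
    the ball of radius \<open>3 * r\<close> about any of them fits into the ball of radius
    \<open>R = 4 * r\<close> on which the form is controlled.\<close>
  define r where "r = R / 4"
  have rR: "cball (\<phi> x) r \<subseteq> cball (\<phi> x) R"
    using R by (intro subset_cball) (simp add: r_def)
  show ?thesis
  proof (rule that[of r a b])
    show "0 < r" "0 < a" "0 < b" "cball (\<phi> x) r \<subseteq> \<phi> ` U"
      using R ab rR by (auto simp: r_def)
    show "\<forall>z\<in>cball (\<phi> x) r. \<forall>e. a * norm e \<le> sqrt (coord_form U \<phi> z e)"
      using rR la by blast
    show "\<forall>y. \<rho> x y < a * r \<longrightarrow> y \<in> U \<and> \<phi> y \<in> ball (\<phi> x) r"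
    proof (intro allI impI)
      fix y assume less: "\<rho> x y < a * r"
      have "0 < r" "cball (\<phi> x) r \<subseteq> \<phi> ` U" "\<And>z e. z \<in> cball (\<phi> x) r \<Longrightarrow> a * norm e \<le> sqrt (coord_form U \<phi> z e)"
        using R rR la by (auto simp: r_def simp del: mem_cball)
      from dist_less_imp_chart[OF c x this(1,2) ab(1) this(3) less] show "y \<in> U \<and> \<phi> y \<in> ball (\<phi> x) r"
        by blast
    qed
    show "\<forall>y\<in>U. \<forall>z\<in>U. \<phi> y \<in> cball (\<phi> x) r \<longrightarrow> \<phi> z \<in> cball (\<phi> x) r \<longrightarrow>
      a * norm (\<phi> z - \<phi> y) \<le> \<rho> y z \<and> \<rho> y z \<le> b * norm (\<phi> z - \<phi> y)"
    proof (intro ballI impI)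
      fix y z assume yz: "y \<in> U" "z \<in> U" "\<phi> y \<in> cball (\<phi> x) r" "\<phi> z \<in> cball (\<phi> x) r"
      have sub: "cball (\<phi> y) (3 * r) \<subseteq> cball (\<phi> x) R"
        using yz(3) by (simp add: r_def cball_subset_cball_iff dist_commute)
      have lower: "a * norm (\<phi> z - \<phi> y) \<le> \<rho> y z"
      proof (rule ccontr)
        assume "\<not> ?thesis"
        then have less: "\<rho> y z < a * norm (\<phi> z - \<phi> y)"
          by simp
        have "dist (\<phi> z) (\<phi> y) \<le> dist (\<phi> x) (\<phi> z) + dist (\<phi> x) (\<phi> y)"
          by (rule dist_triangle3)
        then have "norm (\<phi> z - \<phi> y) \<le> 3 * r"
          using yz(3,4) R by (simp add: dist_norm r_def)
        then have "a * norm (\<phi> z - \<phi> y) \<le> a * (3 * r)"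
          using ab(1) by (intro mult_left_mono) auto
        then have less3: "\<rho> y z < a * (3 * r)"
          using less by simp
        have "0 < 3 * r" "cball (\<phi> y) (3 * r) \<subseteq> \<phi> ` U"
            "\<And>z e. z \<in> cball (\<phi> y) (3 * r) \<Longrightarrow> a * norm e \<le> sqrt (coord_form U \<phi> z e)"
          using R sub la by (auto simp: r_def simp del: mem_cball)
        from dist_less_imp_chart(3)[OF c yz(1) this(1,2) ab(1) this(3) less3] show False
          using less by simp
      qed
      have seg: "closed_segment (\<phi> y) (\<phi> z) \<subseteq> cball (\<phi> x) R"
        using yz(3,4) rR by (intro closed_segment_subset) auto
      have "\<rho> y z \<le> b * norm (\<phi> z - \<phi> y)"
        by (rule dist_le_chart_segment[OF c yz(1,2)]) (use seg R(2) ub in blast)+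
      with lower show "a * norm (\<phi> z - \<phi> y) \<le> \<rho> y z \<and> \<rho> y z \<le> b * norm (\<phi> z - \<phi> y)"
        by blast
    qed
  qed
qed

text \<open>With the metric frozen at \<open>x\<close>, the bound depends on \<open>y\<close> only
  through a homogeneous function of its coordinate displacement. It can therefore be applied to
  difference quotients of a curve.\<close>

lemma dist_le_twice_form:
  assumes c: "(U, \<phi>) \<in> A" and x: "x \<in> U"
  obtains r where "0 < r" "\<forall>y\<in>U. \<phi> y \<in> ball (\<phi> x) r \<longrightarrow>
    \<rho> x y \<le> 2 * sqrt (coord_form U \<phi> (\<phi> x) (\<phi> y - \<phi> x))"
proof -
  have "\<phi> x \<in> \<phi> ` U"
    using x by simp
  then obtain r where r: "0 < r" "cball (\<phi> x) r \<subseteq> \<phi> ` U"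
    "\<forall>z\<in>cball (\<phi> x) r. \<forall>e. sqrt (coord_form U \<phi> z e) \<le> 2 * sqrt (coord_form U \<phi> (\<phi> x) e)"
    by (rule coord_form_near[OF c])
  have "\<rho> x y \<le> 2 * sqrt (coord_form U \<phi> (\<phi> x) (\<phi> y - \<phi> x))" if y: "y \<in> U" "\<phi> y \<in> ball (\<phi> x) r" for y
  proof -
    have seg: "closed_segment (\<phi> x) (\<phi> y) \<subseteq> cball (\<phi> x) r"
      using y r by (intro closed_segment_subset) auto
    show ?thesis
      by (rule dist_le_chart_segment[OF c x y(1)]) (use seg r(2,3) in blast)+
  qed
  with r(1) show ?thesis
    by (intro that) auto
qed

section \<open>The distance induces the manifold topology\<close>

lemma dist_ball_subset_open:
  assumes "open W" "x \<in> W"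
  obtains e where "0 < e" "\<forall>y. \<rho> x y < e \<longrightarrow> y \<in> W"
proof -
  obtain U \<phi> where c: "(U, \<phi>) \<in> A" "x \<in> U" "U \<subseteq> W"
    by (rule chart_within[OF assms])
  obtain r a b where "0 < r" "0 < a" "0 < b" "cball (\<phi> x) r \<subseteq> \<phi> ` U"
    "\<forall>y\<in>U. \<forall>z\<in>U. \<phi> y \<in> cball (\<phi> x) r \<longrightarrow> \<phi> z \<in> cball (\<phi> x) r \<longrightarrow>
      a * norm (\<phi> z - \<phi> y) \<le> \<rho> y z \<and> \<rho> y z \<le> b * norm (\<phi> z - \<phi> y)"
    "\<forall>z\<in>cball (\<phi> x) r. \<forall>e. a * norm e \<le> sqrt (coord_form U \<phi> z e)"
    "\<forall>y. \<rho> x y < a * r \<longrightarrow> y \<in> U \<and> \<phi> y \<in> ball (\<phi> x) r"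
    by (rule dist_chart_equivalent[OF c(1,2)])
  then show ?thesis
    using c(3) by (intro that[of "a * r"]) auto
qed

lemma open_subset_dist_ball:
  assumes "0 < e"
  obtains W where "open W" "x \<in> W" "\<forall>y\<in>W. \<rho> x y < e"
proof -
  obtain U \<phi> where c: "(U, \<phi>) \<in> A" "x \<in> U"
    by (rule chart_at)
  obtain r a b where r: "0 < r" "0 < a" "0 < b" "cball (\<phi> x) r \<subseteq> \<phi> ` U"
    and eq: "\<forall>y\<in>U. \<forall>z\<in>U. \<phi> y \<in> cball (\<phi> x) r \<longrightarrow> \<phi> z \<in> cball (\<phi> x) r \<longrightarrow>
      a * norm (\<phi> z - \<phi> y) \<le> \<rho> y z \<and> \<rho> y z \<le> b * norm (\<phi> z - \<phi> y)"
    "\<forall>z\<in>cball (\<phi> x) r. \<forall>e. a * norm e \<le> sqrt (coord_form U \<phi> z e)"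
    "\<forall>y. \<rho> x y < a * r \<longrightarrow> y \<in> U \<and> \<phi> y \<in> ball (\<phi> x) r"
    by (rule dist_chart_equivalent[OF c])
  let ?W = "{y \<in> U. \<phi> y \<in> ball (\<phi> x) (min r (e / b))}"
  have "\<rho> x y < e" if y: "y \<in> ?W" for y
  proof -
    have "\<rho> x y \<le> b * norm (\<phi> y - \<phi> x)"
      using eq(1) c y r by simp
    also have "\<dots> < e"
      using y r by (simp add: dist_norm norm_minus_commute field_simps)
    finally show ?thesis .
  qed
  moreover have "open ?W"
    by (rule open_chart_preimage[OF c(1)]) simp
  moreover have "x \<in> ?W"
    using c r assms by simp
  ultimately show ?thesis
    by (intro that[of ?W]) auto
qed

text \<open>The Hausdorff property enters through the openness of the complement of a point: some
  distance ball about \<open>x\<close> misses \<open>y\<close>.\<close>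

lemma dist_eq_0_iff: "\<rho> x y = 0 \<longleftrightarrow> x = y"
proof
  assume 0: "\<rho> x y = 0"
  show "x = y"
  proof (rule ccontr)
    assume "x \<noteq> y"
    then have "open (- {y})" "x \<in> - {y}"
      by auto
    then obtain e where "0 < e" "\<forall>z. \<rho> x z < e \<longrightarrow> z \<in> - {y}"
      by (rule dist_ball_subset_open)
    then show False
      using 0 by (auto dest: spec[of _ y])
  qed
qed (simp add: dist_self)

sublocale M: Metric_space UNIV \<rho>
  by (rule Metric_space.intro) (auto simp: dist_nonneg dist_sym dist_eq_0_iff dist_triangle)

lemma dist_triangle_abs: "\<bar>\<rho> x y - \<rho> x z\<bar> \<le> \<rho> y z"
  using dist_triangle[of x y z] dist_triangle[of x z y] dist_sym[of z y] by linarith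

text \<open>The bridge between the topology of the type, in which charts and continuity are stated,
  and the distance, in which absolute continuity and completeness are stated.\<close>

lemma tendsto_iff_dist: "(f \<longlongrightarrow> l) F \<longleftrightarrow> ((\<lambda>t. \<rho> l (f t)) \<longlongrightarrow> 0) F"
proof
  assume f: "(f \<longlongrightarrow> l) F"
  show "((\<lambda>t. \<rho> l (f t)) \<longlongrightarrow> 0) F"
  proof (rule tendstoI)
    fix e :: real assume "0 < e"
    then obtain W where W: "open W" "l \<in> W" "\<forall>y\<in>W. \<rho> l y < e"
      by (rule open_subset_dist_ball[where x = l])
    have "\<forall>\<^sub>F t in F. f t \<in> W"
      by (rule topological_tendstoD[OF f W(1,2)])
    then show "\<forall>\<^sub>F t in F. dist (\<rho> l (f t)) 0 < e"
      by (rule eventually_mono) (use W(3) dist_nonneg in simp)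
  qed
next
  assume f: "((\<lambda>t. \<rho> l (f t)) \<longlongrightarrow> 0) F"
  show "(f \<longlongrightarrow> l) F"
  proof (rule topological_tendstoI)
    fix W assume "open W" "l \<in> W"
    then obtain e where e: "0 < e" "\<forall>y. \<rho> l y < e \<longrightarrow> y \<in> W"
      by (rule dist_ball_subset_open)
    have "\<forall>\<^sub>F t in F. \<rho> l (f t) < e"
      by (rule order_tendstoD(2)[OF f e(1)])
    then show "\<forall>\<^sub>F t in F. f t \<in> W"
      by (rule eventually_mono) (use e(2) in blast)
  qed
qed

end

subsection \<open>Comparison functions\<close>

lemma dom0_downward: "s \<in> dom0 r \<Longrightarrow> 0 \<le> s' \<Longrightarrow> s' \<le> s \<Longrightarrow> s' \<in> dom0 r"
  unfolding dom0_def using order.strict_trans1[of "ereal s'" "ereal s" r] by simp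

lemma Icc_subset_dom0: "b \<in> dom0 r \<Longrightarrow> {0..b} \<subseteq> dom0 r"
  using dom0_downward by auto

lemma zero_in_dom0: "0 < r \<Longrightarrow> 0 \<in> dom0 r"
  by (simp add: dom0_def zero_ereal_def)

lemma dom0_nonneg: "s \<in> dom0 r \<Longrightarrow> 0 \<le> s"
  by (simp add: dom0_def)

lemma dom0_greater:
  assumes "s \<in> dom0 r"
  obtains s' where "s' \<in> dom0 r" "s < s'"
proof -
  obtain q where q: "ereal s < ereal q" "ereal q < r"
    using assms ereal_dense3[of "ereal s" r] by (auto simp: dom0_def)
  then show ?thesis
    using assms by (intro that[of q]) (auto simp: dom0_def)
qed

lemma K_function_less_iff:
  "K_function r \<alpha> \<Longrightarrow> s \<in> dom0 r \<Longrightarrow> t \<in> dom0 r \<Longrightarrow> \<alpha> s < \<alpha> t \<longleftrightarrow> s < t"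
  unfolding K_function_def using strict_mono_on_less by blast

lemma K_function_le_iff:
  "K_function r \<alpha> \<Longrightarrow> s \<in> dom0 r \<Longrightarrow> t \<in> dom0 r \<Longrightarrow> \<alpha> s \<le> \<alpha> t \<longleftrightarrow> s \<le> t"
  using K_function_less_iff[of r \<alpha> t s] by (simp add: linorder_not_less[symmetric])

lemma K_function_eq_iff:
  "K_function r \<alpha> \<Longrightarrow> s \<in> dom0 r \<Longrightarrow> t \<in> dom0 r \<Longrightarrow> \<alpha> s = \<alpha> t \<longleftrightarrow> s = t"
  using K_function_le_iff[of r \<alpha> s t] K_function_le_iff[of r \<alpha> t s] by (auto simp: order_eq_iff)

lemma K_function_zero: "K_function r \<alpha> \<Longrightarrow> \<alpha> 0 = 0"
  and K_function_domain: "K_function r \<alpha> \<Longrightarrow> 0 < r"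
  and K_function_continuous: "K_function r \<alpha> \<Longrightarrow> continuous_on (dom0 r) \<alpha>"
  by (simp_all add: K_function_def)

lemma K_function_nonneg: "K_function r \<alpha> \<Longrightarrow> s \<in> dom0 r \<Longrightarrow> 0 \<le> \<alpha> s"
  using K_function_le_iff[of r \<alpha> 0 s] zero_in_dom0[OF K_function_domain] by (simp add: K_function_zero dom0_nonneg)

lemma K_function_pos: "K_function r \<alpha> \<Longrightarrow> s \<in> dom0 r \<Longrightarrow> 0 < s \<Longrightarrow> 0 < \<alpha> s"
  using K_function_less_iff[of r \<alpha> 0 s] zero_in_dom0[OF K_function_domain] by (simp add: K_function_zero)

lemma K_function_subdomain:
  assumes K: "K_function r \<alpha>" and sub: "dom0 r' \<subseteq> dom0 r" and r': "0 < r'"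
  shows "K_function r' \<alpha>"
proof -
  have "continuous_on (dom0 r') \<alpha>"
    by (rule continuous_on_subset[OF K_function_continuous[OF K] sub])
  moreover have "strict_mono_on (dom0 r') \<alpha>"
    by (rule strict_mono_onI) (use K_function_less_iff[OF K] sub in blast)
  ultimately show ?thesis
    using r' K_function_zero[OF K] by (simp add: K_function_def)
qed

lemma K_function_surj:
  assumes K: "K_function r \<alpha>" and b: "b \<in> dom0 r" and y: "0 \<le> y" "y \<le> \<alpha> b"
  obtains s where "0 \<le> s" "s \<le> b" "s \<in> dom0 r" "\<alpha> s = y"
proof -
  have "continuous_on {0..b} \<alpha>"
    by (rule continuous_on_subset[OF K_function_continuous[OF K] Icc_subset_dom0[OF b]])
  then have "\<exists>s\<ge>0. s \<le> b \<and> \<alpha> s = y"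
    using y K_function_zero[OF K] dom0_nonneg[OF b] by (intro IVT') simp_all
  then show ?thesis
    using that dom0_downward[OF b] by blast
qed

section \<open>Inverses and compositions of comparison functions\<close>

text \<open>Outside the range of \<open>\<alpha>\<close> the value is unspecified, so inverting at
  \<open>y\<close> calls for a witness \<open>b\<close> in the domain with
  \<open>y \<le> \<alpha> b\<close>.\<close>

definition K_inv :: "ereal \<Rightarrow> (real \<Rightarrow> real) \<Rightarrow> real \<Rightarrow> real" where
  "K_inv r \<alpha> = inv_into (dom0 r) \<alpha>"

lemma K_inv_f: "K_function r \<alpha> \<Longrightarrow> s \<in> dom0 r \<Longrightarrow> K_inv r \<alpha> (\<alpha> s) = s"
  unfolding K_inv_def using K_function_eq_iff by (intro inv_into_f_f inj_onI) blast+

lemma f_K_inv: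
  assumes "K_function r \<alpha>" "b \<in> dom0 r" "0 \<le> y" "y \<le> \<alpha> b"
  shows "K_inv r \<alpha> y \<in> dom0 r" "\<alpha> (K_inv r \<alpha> y) = y" "K_inv r \<alpha> y \<le> b"
proof -
  obtain s where "0 \<le> s" "s \<le> b" "s \<in> dom0 r" "\<alpha> s = y"
    using assms by (rule K_function_surj)
  then show "K_inv r \<alpha> y \<in> dom0 r" "\<alpha> (K_inv r \<alpha> y) = y" "K_inv r \<alpha> y \<le> b"
    using K_inv_f[OF assms(1)] by auto
qed

lemma K_inv_continuous:
  assumes K: "K_function r \<alpha>" and b: "b \<in> dom0 r"
  shows "continuous_on {0..\<alpha> b} (K_inv r \<alpha>)"
proof -
  have "continuous_on (\<alpha> ` {0..b}) (K_inv r \<alpha>)"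
    by (rule continuous_on_inv[OF continuous_on_subset[OF K_function_continuous[OF K] Icc_subset_dom0[OF b]]])
      (use K_inv_f[OF K] Icc_subset_dom0[OF b] in auto)
  moreover have "{0..\<alpha> b} \<subseteq> \<alpha> ` {0..b}"
  proof
    fix y assume y: "y \<in> {0..\<alpha> b}"
    then have y': "0 \<le> y" "y \<le> \<alpha> b" by auto
    obtain s where "0 \<le> s" "s \<le> b" "s \<in> dom0 r" "\<alpha> s = y"
      by (rule K_function_surj[OF K b y'])
    then show "y \<in> \<alpha> ` {0..b}"
      by auto
  qed
  ultimately show ?thesis
    by (rule continuous_on_subset)
qed

lemma K_function_inv_comp:
  assumes K: "K_function r \<alpha>" and L: "K_function r' \<kappa>"
    and sub: "\<And>s. s \<in> dom0 r' \<Longrightarrow> \<exists>b\<in>dom0 r. \<kappa> s < \<alpha> b"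
  shows "K_function r' (\<lambda>s. K_inv r \<alpha> (\<kappa> s))"
proof -
  have inv: "K_inv r \<alpha> (\<kappa> s) \<in> dom0 r" "\<alpha> (K_inv r \<alpha> (\<kappa> s)) = \<kappa> s" if s: "s \<in> dom0 r'" for s
  proof -
    obtain b where "b \<in> dom0 r" "\<kappa> s < \<alpha> b"
      using sub[OF s] by blast
    then show "K_inv r \<alpha> (\<kappa> s) \<in> dom0 r" "\<alpha> (K_inv r \<alpha> (\<kappa> s)) = \<kappa> s"
      using f_K_inv[OF K, of b "\<kappa> s"] K_function_nonneg[OF L s] by auto
  qed
  have "continuous_on (dom0 r') (\<lambda>s. K_inv r \<alpha> (\<kappa> s))"
    unfolding continuous_on_eq_continuous_within
  proof
    \<comment> \<open>Continuity is a local matter: a slightly larger \<open>s1\<close> in the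
      open-ended domain makes \<open>{0..s1}\<close> a relative neighbourhood of \<open>s\<close> on
      which \<open>\<kappa>\<close> stays below one value \<open>\<alpha> b\<close>, where the
      inverse is known to be continuous.\<close>
    fix s assume s: "s \<in> dom0 r'"
    obtain s1 where s1: "s1 \<in> dom0 r'" "s < s1"
      by (rule dom0_greater[OF s])
    obtain b where b: "b \<in> dom0 r" "\<kappa> s1 < \<alpha> b"
      using sub[OF s1(1)] by blast
    have in1: "t \<in> dom0 r'" if "t \<in> {0..s1}" for t
      using that dom0_downward[OF s1(1)] by simp
    have "continuous_on {0..s1} (\<lambda>s. K_inv r \<alpha> (\<kappa> s))"
    proof (rule continuous_on_compose2[OF K_inv_continuous[OF K b(1)]])
      show "continuous_on {0..s1} \<kappa>"
        by (rule continuous_on_subset[OF K_function_continuous[OF L] Icc_subset_dom0[OF s1(1)]])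
      show "\<kappa> ` {0..s1} \<subseteq> {0..\<alpha> b}"
      proof
        fix y assume "y \<in> \<kappa> ` {0..s1}"
        then obtain t where t: "t \<in> {0..s1}" "y = \<kappa> t" by blast
        then have "\<kappa> t \<le> \<kappa> s1" "0 \<le> \<kappa> t"
          using K_function_le_iff[OF L in1 s1(1)] K_function_nonneg[OF L in1] by auto
        then show "y \<in> {0..\<alpha> b}"
          using t b(2) by simp
      qed
    qed
    then have "continuous (at s within {0..s1}) (\<lambda>s. K_inv r \<alpha> (\<kappa> s))"
      using s s1(2) by (auto simp: continuous_on_eq_continuous_within dom0_nonneg)
    moreover have "at s within {0..s1} = at s within dom0 r'"
    proof (rule at_within_nhd[of s "{..<s1}"])
      show "{0..s1} \<inter> {..<s1} - {s} = dom0 r' \<inter> {..<s1} - {s}"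
        using in1 dom0_nonneg by auto
    qed (use s1(2) in auto)
    ultimately show "continuous (at s within dom0 r') (\<lambda>s. K_inv r \<alpha> (\<kappa> s))"
      by simp
  qed
  moreover have "strict_mono_on (dom0 r') (\<lambda>s. K_inv r \<alpha> (\<kappa> s))"
  proof (rule strict_mono_onI)
    fix s t assume st: "s \<in> dom0 r'" "t \<in> dom0 r'" "s < t"
    then have "\<kappa> s < \<kappa> t"
      using K_function_less_iff[OF L] by blast
    then show "K_inv r \<alpha> (\<kappa> s) < K_inv r \<alpha> (\<kappa> t)"
      using K_function_less_iff[OF K inv(1)[OF st(1)] inv(1)[OF st(2)]] inv(2)[OF st(1)] inv(2)[OF st(2)] by simp
  qed
  moreover have "K_inv r \<alpha> (\<kappa> 0) = 0"
    using K_inv_f[OF K zero_in_dom0[OF K_function_domain[OF K]]] K_function_zero[OF K] K_function_zero[OF L] by simp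
  ultimately show ?thesis
    using K_function_domain[OF L] by (simp add: K_function_def)
qed

lemma K_function_comp:
  assumes K: "K_function r \<alpha>" and L: "K_function r' \<kappa>" and sub: "\<And>s. s \<in> dom0 r' \<Longrightarrow> \<kappa> s \<in> dom0 r"
  shows "K_function r' (\<lambda>s. \<alpha> (\<kappa> s))"
proof -
  have "continuous_on (dom0 r') (\<lambda>s. \<alpha> (\<kappa> s))"
    by (rule continuous_on_compose2[OF K_function_continuous[OF K] K_function_continuous[OF L]]) (use sub in auto)
  moreover have "strict_mono_on (dom0 r') (\<lambda>s. \<alpha> (\<kappa> s))"
    by (rule strict_mono_onI) (use K_function_less_iff[OF K] K_function_less_iff[OF L] sub in auto)
  ultimately show ?thesis
    using K_function_domain[OF L] K_function_zero[OF K] K_function_zero[OF L] by (simp add: K_function_def)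
qed

text \<open>This turns the inequality \<open>W t + t * \<alpha>\<^sub>3 (\<alpha>\<^sub>2\<^sup>-\<^sup>1 (W t)) \<le> \<alpha>\<^sub>2 s\<close> into an upper bound on \<open>\<alpha>\<^sub>2\<^sup>-\<^sup>1 (W t)\<close>.\<close>

definition decay :: "ereal \<Rightarrow> (real \<Rightarrow> real) \<Rightarrow> (real \<Rightarrow> real) \<Rightarrow> real \<Rightarrow> real \<Rightarrow> real" where
  "decay r \<alpha> \<kappa> s t = (THE v. v \<in> dom0 r \<and> \<alpha> v + t * \<kappa> v = \<alpha> s)"

context
  fixes r :: ereal and \<alpha> \<kappa> :: "real \<Rightarrow> real"
  assumes K: "K_function r \<alpha>" and L: "K_function r \<kappa>"
begin

lemma decay_sum_less:
  assumes "0 \<le> t" "v \<in> dom0 r" "w \<in> dom0 r" "v < w"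
  shows "\<alpha> v + t * \<kappa> v < \<alpha> w + t * \<kappa> w"
proof -
  have "\<alpha> v < \<alpha> w" "\<kappa> v \<le> \<kappa> w"
    using assms K_function_less_iff[OF K] K_function_le_iff[OF L] by auto
  then show ?thesis
    using mult_left_mono[of "\<kappa> v" "\<kappa> w" t] assms(1) by linarith
qed

lemma decay_ex1:
  assumes s: "s \<in> dom0 r" and t: "0 \<le> t"
  shows "\<exists>!v. v \<in> dom0 r \<and> \<alpha> v + t * \<kappa> v = \<alpha> s"
proof (rule ex_ex1I)
  have "continuous_on {0..s} (\<lambda>v. \<alpha> v + t * \<kappa> v)"
    by (intro continuous_intros continuous_on_subset[OF K_function_continuous[OF K]]
        continuous_on_subset[OF K_function_continuous[OF L]] Icc_subset_dom0[OF s])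
  moreover have "0 \<le> \<alpha> s" "0 \<le> t * \<kappa> s"
    using K_function_nonneg[OF K s] K_function_nonneg[OF L s] t by auto
  ultimately have "\<exists>v\<ge>0. v \<le> s \<and> \<alpha> v + t * \<kappa> v = \<alpha> s"
    using K_function_zero[OF K] K_function_zero[OF L] dom0_nonneg[OF s] by (intro IVT') simp_all
  then show "\<exists>v. v \<in> dom0 r \<and> \<alpha> v + t * \<kappa> v = \<alpha> s"
    using dom0_downward[OF s] by blast
  fix v w assume "v \<in> dom0 r \<and> \<alpha> v + t * \<kappa> v = \<alpha> s" "w \<in> dom0 r \<and> \<alpha> w + t * \<kappa> w = \<alpha> s"
  then show "v = w"
    using decay_sum_less[OF t, of v w] decay_sum_less[OF t, of w v] by (cases v w rule: linorder_cases) auto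
qed

lemma decay:
  assumes "s \<in> dom0 r" "0 \<le> t"
  shows decay_in_dom0: "decay r \<alpha> \<kappa> s t \<in> dom0 r"
    and decay_eq: "\<alpha> (decay r \<alpha> \<kappa> s t) + t * \<kappa> (decay r \<alpha> \<kappa> s t) = \<alpha> s"
  using theI'[OF decay_ex1[OF assms]] unfolding decay_def by auto

text \<open>The sum \<alpha> w + t * \<kappa> w is strictly increasing in w, so comparing
  \<open>decay\<close> with w means comparing this sum with \<alpha> s. Monotonicity, continuity and
  the limit in time are all read off from here.\<close>

lemma decay_less_iff:
  assumes s: "s \<in> dom0 r" "0 \<le> t" and w: "w \<in> dom0 r"
  shows "decay r \<alpha> \<kappa> s t < w \<longleftrightarrow> \<alpha> s < \<alpha> w + t * \<kappa> w"
    and "w < decay r \<alpha> \<kappa> s t \<longleftrightarrow> \<alpha> w + t * \<kappa> w < \<alpha> s"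
  using decay_sum_less[OF s(2) w decay_in_dom0[OF s]] decay_sum_less[OF s(2) decay_in_dom0[OF s] w] decay_eq[OF s]
  by (cases w "decay r \<alpha> \<kappa> s t" rule: linorder_cases; simp)+

lemma decay_le_self:
  assumes s: "s \<in> dom0 r" "0 \<le> t"
  shows "decay r \<alpha> \<kappa> s t \<le> s"
proof -
  have "0 \<le> t * \<kappa> s"
    using s(2) K_function_nonneg[OF L s(1)] by simp
  then show ?thesis
    using decay_less_iff(2)[OF s s(1)] by linarith
qed

text \<open>Each strict inequality between \<open>decay\<close> and a fixed number is equivalent to
  the sign of a continuous function of the two arguments, hence persists nearby.\<close>

lemma continuous_on_decay: "continuous_on (dom0 r \<times> {0..}) (\<lambda>p. decay r \<alpha> \<kappa> (fst p) (snd p))"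
  unfolding continuous_on_def
proof
  let ?S = "dom0 r \<times> {0..} :: (real \<times> real) set"
  fix p assume p: "p \<in> ?S"
  have inS: "\<forall>\<^sub>F q in at p within ?S. q \<in> ?S"
    by (simp add: eventually_at_filter)
  let ?k = "\<lambda>w q. \<alpha> w + snd q * \<kappa> w - \<alpha> (fst q)"
  have k: "((?k w) \<longlongrightarrow> ?k w p) (at p within ?S)" for w
  proof -
    have "continuous_on ?S (?k w)"
      by (intro continuous_intros continuous_on_compose2[OF K_function_continuous[OF K]]) auto
    from bspec[OF this[unfolded continuous_on_def] p] show ?thesis .
  qed
  show "((\<lambda>p. decay r \<alpha> \<kappa> (fst p) (snd p)) \<longlongrightarrow> decay r \<alpha> \<kappa> (fst p) (snd p)) (at p within ?S)"
  proof (rule order_tendstoI)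
    fix a assume a: "a < decay r \<alpha> \<kappa> (fst p) (snd p)"
    show "\<forall>\<^sub>F q in at p within ?S. a < decay r \<alpha> \<kappa> (fst q) (snd q)"
    proof (cases "0 \<le> a")
      case True
      then have a': "a \<in> dom0 r"
        using dom0_downward[OF decay_in_dom0[of "fst p" "snd p"], of a] p a by auto
      have "?k a p < 0"
        using decay_less_iff(2)[of "fst p" "snd p" a] a a' p by auto
      from order_tendstoD(2)[OF k this] inS show ?thesis
        by eventually_elim (use decay_less_iff(2) a' in auto)
    next
      case False
      show ?thesis
        using inS by eventually_elim (use decay_in_dom0 dom0_nonneg False in force)
    qed
  next
    fix a assume a: "decay r \<alpha> \<kappa> (fst p) (snd p) < a"
    have dp: "decay r \<alpha> \<kappa> (fst p) (snd p) \<in> dom0 r"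
      using p by (intro decay_in_dom0) auto
    obtain b where b: "b \<in> dom0 r" "decay r \<alpha> \<kappa> (fst p) (snd p) < b"
      by (rule dom0_greater[OF dp])
    \<comment> \<open>The bound \<open>a\<close> may lie outside the domain of the comparison
      functions; the minimum with \<open>b\<close> is inside and still exceeds
      \<open>decay\<close>.\<close>
    define w where "w = min a b"
    have w: "w \<in> dom0 r" "decay r \<alpha> \<kappa> (fst p) (snd p) < w" "w \<le> a"
      using dom0_downward[OF b(1), of w] a b dom0_nonneg[OF dp] by (auto simp: w_def)
    have "0 < ?k w p"
      using decay_less_iff(1)[of "fst p" "snd p" w] w p by auto
    from order_tendstoD(1)[OF k this] inS show "\<forall>\<^sub>F q in at p within ?S. decay r \<alpha> \<kappa> (fst q) (snd q) < a"
    proof eventually_elim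
      fix q assume q: "0 < ?k w q" "q \<in> ?S"
      then have "decay r \<alpha> \<kappa> (fst q) (snd q) < w"
        using decay_less_iff(1)[of "fst q" "snd q" w] w(1) by auto
      then show "decay r \<alpha> \<kappa> (fst q) (snd q) < a"
        using w(3) by simp
    qed
  qed
qed

lemma KL_function_decay_comp:
  assumes h: "K_function r h"
  shows "KL_function r (\<lambda>s t. h (decay r \<alpha> \<kappa> s t))"
proof -
  have cont: "continuous_on (dom0 r \<times> {0..}) (\<lambda>p. h (decay r \<alpha> \<kappa> (fst p) (snd p)))"
    by (rule continuous_on_compose2[OF K_function_continuous[OF h] continuous_on_decay]) (use decay_in_dom0 in auto)
  have "K_function r (\<lambda>s. h (decay r \<alpha> \<kappa> s t))" if t: "0 \<le> t" for t
    unfolding K_function_def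
  proof (intro conjI)
    show "0 < r"
      by (rule K_function_domain[OF K])
    show "continuous_on (dom0 r) (\<lambda>s. h (decay r \<alpha> \<kappa> s t))"
    proof -
      have "continuous_on (dom0 r) (\<lambda>s. (s, t))"
        by (intro continuous_intros)
      then have "continuous_on (dom0 r) (\<lambda>s. h (decay r \<alpha> \<kappa> (fst (s, t)) (snd (s, t))))"
        by (rule continuous_on_compose2[OF cont]) (use t in auto)
      then show ?thesis by simp
    qed
    show "strict_mono_on (dom0 r) (\<lambda>s. h (decay r \<alpha> \<kappa> s t))"
    proof (rule strict_mono_onI)
      fix s s' assume s: "s \<in> dom0 r" "s' \<in> dom0 r" "s < s'"
      have "decay r \<alpha> \<kappa> s t < decay r \<alpha> \<kappa> s' t"
        using decay_less_iff(1)[OF s(1) t decay_in_dom0[OF s(2) t]] decay_eq[OF s(2) t] K_function_less_iff[OF K s(1,2)] s(3)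
        by simp
      then show "h (decay r \<alpha> \<kappa> s t) < h (decay r \<alpha> \<kappa> s' t)"
        using K_function_less_iff[OF h decay_in_dom0[OF s(1) t] decay_in_dom0[OF s(2) t]] by simp
    qed
    have z: "0 \<in> dom0 r"
      by (rule zero_in_dom0[OF K_function_domain[OF K]])
    have "decay r \<alpha> \<kappa> 0 t = 0"
      using decay_le_self[OF z t] dom0_nonneg[OF decay_in_dom0[OF z t]] by simp
    then show "h (decay r \<alpha> \<kappa> 0 t) = 0"
      by (simp add: K_function_zero[OF h])
  qed
  moreover have "antimono_on {0..} (\<lambda>t. h (decay r \<alpha> \<kappa> s t))" if s: "s \<in> dom0 r" for s
  proof (rule monotone_onI)
    fix t t' :: real assume t: "t \<in> {0..}" "t' \<in> {0..}" "t \<le> t'"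
    then have t0: "0 \<le> t" "0 \<le> t'" by auto
    have "t * \<kappa> (decay r \<alpha> \<kappa> s t) \<le> t' * \<kappa> (decay r \<alpha> \<kappa> s t)"
      using t(3) K_function_nonneg[OF L decay_in_dom0[OF s t0(1)]] by (rule mult_right_mono)
    then have "\<not> \<alpha> (decay r \<alpha> \<kappa> s t) + t' * \<kappa> (decay r \<alpha> \<kappa> s t) < \<alpha> s"
      using decay_eq[OF s t0(1)] by simp
    then have "decay r \<alpha> \<kappa> s t' \<le> decay r \<alpha> \<kappa> s t"
      using decay_less_iff(2)[OF s t0(2) decay_in_dom0[OF s t0(1)]] by simp
    then show "h (decay r \<alpha> \<kappa> s t') \<le> h (decay r \<alpha> \<kappa> s t)"
      using K_function_le_iff[OF h decay_in_dom0[OF s t0(2)] decay_in_dom0[OF s t0(1)]] by simp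
  qed
  moreover have "((\<lambda>t. h (decay r \<alpha> \<kappa> s t)) \<longlongrightarrow> 0) at_top" if s: "s \<in> dom0 r" for s
  proof -
    have z: "0 \<in> dom0 r"
      by (rule zero_in_dom0[OF K_function_domain[OF K]])
    have lim: "((\<lambda>t. decay r \<alpha> \<kappa> s t) \<longlongrightarrow> 0) at_top"
    proof (rule order_tendstoI)
      fix a :: real assume "a < 0"
      show "\<forall>\<^sub>F t in at_top. a < decay r \<alpha> \<kappa> s t"
        using eventually_ge_at_top[of "0::real"]
        by eventually_elim (use \<open>a < 0\<close> decay_in_dom0[OF s] dom0_nonneg in force)
    next
      fix a :: real assume a: "0 < a"
      obtain b where b: "b \<in> dom0 r" "0 < b"
        by (rule dom0_greater[OF z])
      define w where "w = min a b"
      have w: "w \<in> dom0 r" "0 < w" "w \<le> a"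
        using dom0_downward[OF b(1), of w] a b by (auto simp: w_def)
      have pos: "0 < \<kappa> w"
        by (rule K_function_pos[OF L w(1,2)])
      \<comment> \<open>Beyond time \<alpha> s / \<kappa> w the term t * \<kappa> w alone exceeds
        \<alpha> s, which forces \<open>decay\<close> below w.\<close>
      show "\<forall>\<^sub>F t in at_top. decay r \<alpha> \<kappa> s t < a"
        using eventually_ge_at_top[of "0::real"] eventually_gt_at_top[of "\<alpha> s / \<kappa> w"]
      proof eventually_elim
        fix t assume t: "0 \<le> t" "\<alpha> s / \<kappa> w < t"
        then have "\<alpha> s < t * \<kappa> w"
          using pos by (simp add: field_simps)
        then have "\<alpha> s < \<alpha> w + t * \<kappa> w"
          using K_function_nonneg[OF K w(1)] by linarith
        then show "decay r \<alpha> \<kappa> s t < a"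
          using decay_less_iff(1)[OF s t(1) w(1)] w(3) by simp
      qed
    qed
    have "((\<lambda>t. h (decay r \<alpha> \<kappa> s t)) \<longlongrightarrow> h 0) at_top"
    proof (rule continuous_on_tendsto_compose[OF K_function_continuous[OF h] lim z])
      show "\<forall>\<^sub>F t in at_top. decay r \<alpha> \<kappa> s t \<in> dom0 r"
        using eventually_ge_at_top[of "0::real"] by eventually_elim (rule decay_in_dom0[OF s])
    qed
    then show ?thesis
      by (simp add: K_function_zero[OF h])
  qed
  ultimately show ?thesis
    unfolding KL_function_def using cont by (simp add: split_beta)
qed

end

section \<open>The radii of the theorem and the construction of \<beta> and \<gamma>\<close>

locale ISS_comparison =
  fixes r0 \<delta> :: ereal and \<alpha>1 \<alpha>2 \<alpha>3 \<alpha>4 :: "real \<Rightarrow> real"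
  assumes K1: "K_function r0 \<alpha>1" and K2: "K_function r0 \<alpha>2" and K3: "K_function r0 \<alpha>3"
    and K4: "K_function \<delta> \<alpha>4" and im4: "\<alpha>4 ` dom0 \<delta> \<subseteq> dom0 r0"
    and le12: "\<And>r. r \<in> dom0 r0 \<Longrightarrow> \<alpha>1 r \<le> \<alpha>2 r"
begin

text \<open>Within this radius V is at most \<alpha>1 r, a level at which the radius cannot exceed
  r. Its limit as r tends to r0 is r_V.\<close>

definition "safe_radius r = K_inv r0 \<alpha>2 (\<alpha>1 r)"

lemma safe_radius: "r \<in> dom0 r0 \<Longrightarrow> safe_radius r \<in> dom0 r0" "r \<in> dom0 r0 \<Longrightarrow> \<alpha>2 (safe_radius r) = \<alpha>1 r"
  using f_K_inv[OF K2] K_function_nonneg[OF K1] le12 unfolding safe_radius_def by blast+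

lemma less_safe_radius_iff: "r \<in> dom0 r0 \<Longrightarrow> s \<in> dom0 r0 \<Longrightarrow> s < safe_radius r \<longleftrightarrow> \<alpha>2 s < \<alpha>1 r"
  using K_function_less_iff[OF K2 _ safe_radius(1)] by (simp add: safe_radius(2))

lemma safe_radius_mono: "r \<in> dom0 r0 \<Longrightarrow> s \<in> dom0 r0 \<Longrightarrow> r \<le> s \<Longrightarrow> safe_radius r \<le> safe_radius s"
  using K_function_le_iff[OF K2 safe_radius(1) safe_radius(1)] K_function_le_iff[OF K1] by (simp add: safe_radius(2))

text \<open>The map \<open>safe_radius\<close> is nondecreasing, so its left limit at r0, finite or
  not, is its supremum. In this form s < r_V unfolds into a witness r.\<close>

lemma r_V_eq: "r_V r0 \<alpha>1 \<alpha>2 = (SUP r\<in>dom0 r0. ereal (safe_radius r))"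
proof -
  have r0: "0 < r0"
    by (rule K_function_domain[OF K1])
  have ev: "\<forall>\<^sub>F y in at_left r0. real_of_ereal y \<in> dom0 r0 \<and> s < real_of_ereal y" if s: "s \<in> dom0 r0" for s
    unfolding eventually_at_left[OF r0]
  proof (intro exI[of _ "ereal s"] conjI allI impI)
    show "ereal s < r0"
      using s by (simp add: dom0_def)
    fix y assume y: "ereal s < y" "y < r0"
    then have "ereal (real_of_ereal y) = y"
      by (intro ereal_real') auto
    then show "real_of_ereal y \<in> dom0 r0" "s < real_of_ereal y"
      using y s unfolding dom0_def by (metis (mono_tags, lifting) less_ereal.simps(1) less_imp_le mem_Collect_eq order.trans)+
  qed
  have z: "0 \<in> dom0 r0"
    by (rule zero_in_dom0[OF r0])
  \<comment> \<open>\<open>Lim\<close> is determined only along a nontrivial filter; density of the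
    extended reals provides points to the left of \<open>r0\<close>, also when \<open>r0\<close> is
    infinite.\<close>
  have nb: "at_left r0 \<noteq> bot"
  proof
    assume "at_left r0 = bot"
    then have "\<forall>\<^sub>F y in at_left r0. False"
      by simp
    then obtain b where b: "b < r0" "\<And>y. b < y \<Longrightarrow> y < r0 \<Longrightarrow> False"
      unfolding eventually_at_left[OF r0] by blast
    show False
      using dense[OF b(1)] b(2) by blast
  qed
  have "((\<lambda>r. ereal (safe_radius (real_of_ereal r))) \<longlongrightarrow> (SUP r\<in>dom0 r0. ereal (safe_radius r))) (at_left r0)"
  proof (rule order_tendstoI)
    fix a assume "a < (SUP r\<in>dom0 r0. ereal (safe_radius r))"
    then obtain s where s: "s \<in> dom0 r0" "a < ereal (safe_radius s)"
      by (auto simp: less_SUP_iff)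
    show "\<forall>\<^sub>F y in at_left r0. a < ereal (safe_radius (real_of_ereal y))"
      using ev[OF s(1)]
    proof eventually_elim
      fix y assume y: "real_of_ereal y \<in> dom0 r0 \<and> s < real_of_ereal y"
      then have "safe_radius s \<le> safe_radius (real_of_ereal y)"
        using s(1) by (intro safe_radius_mono) auto
      then show "a < ereal (safe_radius (real_of_ereal y))"
        using s(2) by (meson ereal_less_eq(3) less_le_trans)
    qed
  next
    fix a assume a: "(SUP r\<in>dom0 r0. ereal (safe_radius r)) < a"
    show "\<forall>\<^sub>F y in at_left r0. ereal (safe_radius (real_of_ereal y)) < a"
      using ev[OF z]
    proof eventually_elim
      fix y assume "real_of_ereal y \<in> dom0 r0 \<and> 0 < real_of_ereal y"
      then have "ereal (safe_radius (real_of_ereal y)) \<le> (SUP r\<in>dom0 r0. ereal (safe_radius r))"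
        by (intro SUP_upper) simp
      then show "ereal (safe_radius (real_of_ereal y)) < a"
        using a by (rule le_less_trans)
    qed
  qed
  then show ?thesis
    unfolding r_V_def safe_radius_def K_inv_def by (rule tendsto_Lim[OF nb])
qed

abbreviation "rV \<equiv> r_V r0 \<alpha>1 \<alpha>2"
abbreviation "rVhat \<equiv> r_V_hat \<delta> \<alpha>4 rV"

text \<open>The working form of the definition of r_V: a strict gap between \<alpha>2 s and
  \<alpha>1 r at some r < r0. It makes the inverse of \<alpha>1 available at \<alpha>2 s and later
  confines trajectories.\<close>

lemma dom0_rV:
  assumes "s \<in> dom0 rV"
  shows "s \<in> dom0 r0" "\<exists>r\<in>dom0 r0. \<alpha>2 s < \<alpha>1 r"
proof -
  have "ereal s < (SUP r\<in>dom0 r0. ereal (safe_radius r))" "0 \<le> s"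
    using assms by (simp_all add: dom0_def r_V_eq)
  then obtain r where r: "r \<in> dom0 r0" "s < safe_radius r"
    by (auto simp: less_SUP_iff)
  then show s: "s \<in> dom0 r0"
    using dom0_downward[OF safe_radius(1)[OF r(1)]] \<open>0 \<le> s\<close> by simp
  show "\<exists>r\<in>dom0 r0. \<alpha>2 s < \<alpha>1 r"
    using less_safe_radius_iff[OF r(1) s] r by blast
qed

lemma rV_pos: "0 < rV"
proof -
  have z: "0 \<in> dom0 r0"
    by (rule zero_in_dom0[OF K_function_domain[OF K1]])
  obtain r where r: "r \<in> dom0 r0" "0 < r"
    by (rule dom0_greater[OF z])
  have "0 < safe_radius r"
    using less_safe_radius_iff[OF r(1) z] K_function_pos[OF K1 r] K_function_zero[OF K2] by simp
  then have "0 < ereal (safe_radius r)"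
    by simp
  also have "\<dots> \<le> rV"
    unfolding r_V_eq using r(1) by (rule SUP_upper)
  finally show ?thesis .
qed

text \<open>Since \<alpha>4 is continuous and vanishes at 0 while r_V is positive, some positive s
  belongs to the set whose supremum is taken.\<close>

lemma rVhat_pos: "0 < rVhat"
proof -
  have z: "0 \<in> dom0 \<delta>"
    by (rule zero_in_dom0[OF K_function_domain[OF K4]])
  have lim: "(\<alpha>4 \<longlongrightarrow> 0) (at 0 within dom0 \<delta>)"
    using K_function_continuous[OF K4] z K_function_zero[OF K4] unfolding continuous_on_def by force
  obtain q where q: "0 < ereal q" "ereal q < rV"
    using ereal_dense3[OF rV_pos] by blast
  have "\<forall>\<^sub>F s in at 0 within dom0 \<delta>. \<alpha>4 s < q"
    by (rule order_tendstoD(2)[OF lim]) (use q in simp)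
  then obtain d where d: "0 < d" "\<And>s. s \<in> dom0 \<delta> \<Longrightarrow> s \<noteq> 0 \<Longrightarrow> dist s 0 < d \<Longrightarrow> \<alpha>4 s < q"
    unfolding eventually_at by blast
  obtain b where b: "b \<in> dom0 \<delta>" "0 < b"
    by (rule dom0_greater[OF z])
  define s where "s = min b (d / 2)"
  have s: "s \<in> dom0 \<delta>" "0 < s" "s < d"
    using dom0_downward[OF b(1), of s] b d(1) by (auto simp: s_def min_def)
  have "ereal (\<alpha>4 s) < ereal q"
    using d(2)[of s] s by (simp add: dist_real_def)
  then have "ereal (\<alpha>4 s) < rV"
    using q(2) by (rule less_trans)
  then have "ereal s \<le> rVhat"
    unfolding r_V_hat_def using s(1) by (intro Sup_upper) blast
  moreover have "0 < ereal s"
    using s(2) by simp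
  ultimately show ?thesis
    by (rule less_le_trans[rotated])
qed

lemma dom0_rVhat:
  assumes "s \<in> dom0 rVhat"
  shows "s \<in> dom0 \<delta>" "\<alpha>4 s \<in> dom0 rV"
proof -
  have "ereal s < rVhat" "0 \<le> s"
    using assms by (simp_all add: dom0_def)
  then obtain s' where s': "s' \<in> dom0 \<delta>" "ereal (\<alpha>4 s') < rV" "s < s'"
    unfolding r_V_hat_def less_Sup_iff by auto
  then show s: "s \<in> dom0 \<delta>"
    using dom0_downward[OF s'(1)] \<open>0 \<le> s\<close> by simp
  have "\<alpha>4 s \<le> \<alpha>4 s'"
    using K_function_le_iff[OF K4 s s'(1)] s'(3) by simp
  then have "ereal (\<alpha>4 s) < rV"
    using s'(2) by (meson ereal_less_eq(3) le_less_trans)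
  then show "\<alpha>4 s \<in> dom0 rV"
    using K_function_nonneg[OF K4 s] by (simp add: dom0_def)
qed

text \<open>When V is at most \<alpha>2 s, the radius is at most \<open>overshoot s\<close>. The gap
  behind r_V makes this value lie in the domain of \<alpha>1.\<close>

definition "overshoot s = K_inv r0 \<alpha>1 (\<alpha>2 s)"

lemma K_rV: "K_function rV \<alpha>2" "K_function rV \<alpha>3"
  by (rule K_function_subdomain[OF _ _ rV_pos], rule K2 K3, use dom0_rV(1) in blast)+

lemma K_overshoot: "K_function rV overshoot"
  unfolding overshoot_def[abs_def] using K1 K_rV(1) dom0_rV(2) by (rule K_function_inv_comp)

lemma overshoot:
  assumes "s \<in> dom0 rV"
  shows "overshoot s \<in> dom0 r0" "\<alpha>1 (overshoot s) = \<alpha>2 s"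
proof -
  obtain b where "b \<in> dom0 r0" "\<alpha>2 s < \<alpha>1 b"
    using dom0_rV(2)[OF assms] by blast
  then show "overshoot s \<in> dom0 r0" "\<alpha>1 (overshoot s) = \<alpha>2 s"
    using f_K_inv[OF K1, of b "\<alpha>2 s"] K_function_nonneg[OF K_rV(1) assms] by (auto simp: overshoot_def)
qed

text \<open>Here \<open>decay\<close> bounds the inverse of \<alpha>2 at the current value of V, and
  \<open>overshoot\<close> converts that back into a bound on the radius.\<close>

definition "\<beta> s t = overshoot (decay rV \<alpha>2 \<alpha>3 s t)"
definition "\<gamma> s = overshoot (\<alpha>4 s)"

lemma KL_\<beta>: "KL_function rV \<beta>"
  unfolding \<beta>_def[abs_def] using K_rV K_overshoot by (rule KL_function_decay_comp)

lemma K_\<gamma>: "K_function rVhat \<gamma>"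
proof -
  have "K_function rVhat \<alpha>4"
    by (rule K_function_subdomain[OF K4 _ rVhat_pos]) (use dom0_rVhat(1) in blast)
  from K_function_comp[OF K_overshoot this dom0_rVhat(2)] show ?thesis
    unfolding \<gamma>_def[abs_def] by simp
qed

lemma le_\<gamma>:
  assumes "x \<in> dom0 r0" "s \<in> dom0 rVhat" "\<alpha>1 x \<le> \<alpha>2 (\<alpha>4 s)"
  shows "x \<le> \<gamma> s"
  using K_function_le_iff[OF K1 assms(1) overshoot(1)[OF dom0_rVhat(2)[OF assms(2)]]] overshoot(2)[OF dom0_rVhat(2)[OF assms(2)]] assms(3)
  by (simp add: \<gamma>_def)

text \<open>In the application \<open>x\<close> is the radius at time \<open>t\<close>,
  \<open>s\<close> the initial radius, and \<open>w\<close> the point with \<alpha>2 w equal to the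
  value of V at time \<open>t\<close>; the second inequality then says that w is at most
  \<open>decay\<close>.\<close>

lemma le_\<beta>:
  assumes s: "s \<in> dom0 rV" and t: "0 \<le> t" and x: "x \<in> dom0 r0" and w: "w \<in> dom0 r0"
    and le: "\<alpha>1 x \<le> \<alpha>2 w" "\<alpha>2 w + t * \<alpha>3 w \<le> \<alpha>2 s"
  shows "x \<le> \<beta> s t"
proof -
  have "0 \<le> t * \<alpha>3 w"
    using t K_function_nonneg[OF K3 w] by simp
  then have "\<alpha>2 w \<le> \<alpha>2 s"
    using le(2) by linarith
  then have "w \<le> s"
    using K_function_le_iff[OF K2 w dom0_rV(1)[OF s]] by simp
  \<comment> \<open>The function \<open>decay\<close> is formed over the smaller domain up to
    \<open>rV\<close>, so \<open>w\<close> must be moved there; it inherits membership from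
    \<open>s\<close>.\<close>
  then have w': "w \<in> dom0 rV"
    using dom0_downward[OF s] dom0_nonneg[OF w] by blast
  note d = decay_in_dom0[OF K_rV s t]
  have "w \<le> decay rV \<alpha>2 \<alpha>3 s t"
    using decay_less_iff(1)[OF K_rV s t w'] le(2) by simp
  then have "\<alpha>2 w \<le> \<alpha>2 (decay rV \<alpha>2 \<alpha>3 s t)"
    using K_function_le_iff[OF K_rV(1) w' d] by simp
  then have "\<alpha>1 x \<le> \<alpha>1 (overshoot (decay rV \<alpha>2 \<alpha>3 s t))"
    using le(1) overshoot(2)[OF d] by simp
  then show ?thesis
    using K_function_le_iff[OF K1 x overshoot(1)[OF d]] by (simp add: \<beta>_def)
qed

end

subsection \<open>Absolutely continuous curves\<close>

lemma AE_lebesgueE: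
  assumes "AE t in lebesgue. P t"
  obtains N where "negligible N" "\<forall>t. t \<notin> N \<longrightarrow> P t"
proof -
  obtain N where "N \<in> null_sets lebesgue" "{t \<in> space lebesgue. \<not> P t} \<subseteq> N"
    using assms unfolding eventually_ae_filter by blast
  then show ?thesis
    by (intro that[of N]) (auto simp: negligible_iff_null_sets)
qed

lemma AE_lebesgue_on_iff:
  "S \<in> sets lebesgue \<Longrightarrow> (AE t in lebesgue_on S. P t) \<longleftrightarrow> (AE t in lebesgue. t \<in> S \<longrightarrow> P t)"
  by (rule AE_restrict_space_iff) simp

lemma has_vector_derivative_imp_quotient:
  assumes "(f has_vector_derivative v) (at t)"
  shows "((\<lambda>s. (1 / (s - t)) *\<^sub>R (f s - f t)) \<longlongrightarrow> v) (at t)"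
proof -
  have "((\<lambda>s. (1 / norm (s - t)) *\<^sub>R (f s - f t - (s - t) *\<^sub>R v)) \<longlongrightarrow> 0) (at t)"
    using assms unfolding has_vector_derivative_def has_derivative_within diff_diff_eq by blast
  then have "((\<lambda>s. norm ((1 / norm (s - t)) *\<^sub>R (f s - f t - (s - t) *\<^sub>R v))) \<longlongrightarrow> 0) (at t)"
    by (rule tendsto_norm_zero)
  moreover have "norm ((1 / norm (s - t)) *\<^sub>R (f s - f t - (s - t) *\<^sub>R v)) =
      norm ((1 / (s - t)) *\<^sub>R (f s - f t - (s - t) *\<^sub>R v))" for s
    by simp
  ultimately have "((\<lambda>s. norm ((1 / (s - t)) *\<^sub>R (f s - f t - (s - t) *\<^sub>R v))) \<longlongrightarrow> 0) (at t)"
    by (simp only:)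
  then have "((\<lambda>s. (1 / (s - t)) *\<^sub>R (f s - f t - (s - t) *\<^sub>R v)) \<longlongrightarrow> 0) (at t)"
    by (rule tendsto_norm_zero_cancel)
  then have "((\<lambda>s. (1 / (s - t)) *\<^sub>R (f s - f t - (s - t) *\<^sub>R v) + v) \<longlongrightarrow> 0 + v) (at t)"
    by (intro tendsto_intros)
  moreover have "\<forall>\<^sub>F s in at t. (1 / (s - t)) *\<^sub>R (f s - f t - (s - t) *\<^sub>R v) + v = (1 / (s - t)) *\<^sub>R (f s - f t)"
    unfolding eventually_at_filter
  proof (intro always_eventually allI impI)
    fix s assume "s \<noteq> t"
    then show "(1 / (s - t)) *\<^sub>R (f s - f t - (s - t) *\<^sub>R v) + v = (1 / (s - t)) *\<^sub>R (f s - f t)"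
      by (simp add: scaleR_diff_right[of _ "f s - f t"])
  qed
  ultimately show ?thesis
    unfolding add_0 by (rule Lim_transform_eventually)
qed

text \<open>Splitting at \<open>t\<close> turns a derivative into an estimate for intervals
  straddling \<open>t\<close>, the form that gauge arguments consume.\<close>

lemma derivative_imp_increment_le:
  fixes w :: "real \<Rightarrow> real"
  assumes w: "(w has_real_derivative D) (at t)" and DJ: "D \<le> J" and e: "0 < e"
  shows "\<exists>d>0. \<forall>u v. u \<le> t \<and> t \<le> v \<and> t - d < u \<and> v < t + d \<longrightarrow> w v - w u \<le> (J + e) * (v - u)"
proof -
  obtain d where d: "0 < d" "\<And>y. norm (y - t) < d \<Longrightarrow> norm (w y - w t - D * (y - t)) \<le> e * norm (y - t)"
    using w e unfolding has_field_derivative_def has_derivative_at_alt by blast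
  have "w v - w u \<le> (J + e) * (v - u)" if uv: "u \<le> t" "t \<le> v" "t - d < u" "v < t + d" for u v
  proof -
    have 1: "norm (w v - w t - D * (v - t)) \<le> e * norm (v - t)" "norm (w u - w t - D * (u - t)) \<le> e * norm (u - t)"
      by (rule d(2), use uv in \<open>simp add: abs_if\<close>)+
    have "w v - w t - D * (v - t) \<le> e * (v - t)" "- (w u - w t - D * (u - t)) \<le> e * (t - u)"
      using 1 uv by (auto simp: abs_le_iff)
    then have "w v - w u \<le> (D + e) * (v - u)"
      by (simp add: algebra_simps)
    also have "\<dots> \<le> (J + e) * (v - u)"
      using DJ uv by (intro mult_right_mono) auto
    finally show ?thesis .
  qed
  with d(1) show ?thesis
    by blast
qed

context riemannian
begin

text \<open>Passage from the Lebesgue set integrals of the definition to gauge integrals, in which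
  the increment theorem is stated.\<close>

lemma abs_continuous_integral:
  assumes "abs_continuous A g a b x"
  obtains k where "k absolutely_integrable_on {a..b}"
    "\<forall>s t. a \<le> s \<and> s \<le> t \<and> t \<le> b \<longrightarrow> \<rho> (x s) (x t) \<le> integral {s..t} k"
proof -
  obtain k where k: "set_integrable lebesgue {a..b} k"
    "\<forall>s t. a \<le> s \<and> s \<le> t \<and> t \<le> b \<longrightarrow> \<rho> (x s) (x t) \<le> set_lebesgue_integral lebesgue {s..t} k"
    using assms unfolding abs_continuous_def by blast
  have "\<rho> (x s) (x t) \<le> integral {s..t} k" if "a \<le> s" "s \<le> t" "t \<le> b" for s t
  proof -
    have "set_integrable lebesgue {s..t} k"
      by (rule absolutely_integrable_on_subinterval[OF k(1)]) (use that in auto)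
    have "\<rho> (x s) (x t) \<le> set_lebesgue_integral lebesgue {s..t} k"
      using k(2) that by blast
    also have "\<dots> = integral {s..t} k"
      by (rule set_lebesgue_integral_eq_integral(2)) fact
    finally show ?thesis .
  qed
  with k(1) show ?thesis
    by (intro that[of k]) auto
qed

lemma abs_continuousI:
  assumes k: "k absolutely_integrable_on {a..b}"
    and le: "\<And>s t. a \<le> s \<Longrightarrow> s \<le> t \<Longrightarrow> t \<le> b \<Longrightarrow> \<rho> (x s) (x t) \<le> integral {s..t} k"
  shows "abs_continuous A g a b x"
  unfolding abs_continuous_def
proof (intro exI[of _ k] conjI allI impI k)
  fix s t assume st: "a \<le> s \<and> s \<le> t \<and> t \<le> b"
  have "set_integrable lebesgue {s..t} k"
    by (rule absolutely_integrable_on_subinterval[OF k]) (use st in auto)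
  from set_lebesgue_integral_eq_integral(2)[OF this] show "\<rho> (x s) (x t) \<le> set_lebesgue_integral lebesgue {s..t} k"
    using le[of s t] st by simp
qed

lemma integral_bound_imp_dist_le:
  fixes k :: "real \<Rightarrow> real"
  assumes k: "k integrable_on {a..b}"
    and le: "\<And>s t. a \<le> s \<Longrightarrow> s \<le> t \<Longrightarrow> t \<le> b \<Longrightarrow> \<rho> (x s) (x t) \<le> integral {s..t} k"
    and st: "s \<in> {a..b}" "t \<in> {a..b}"
  shows "\<rho> (x s) (x t) \<le> \<bar>integral {a..t} k - integral {a..s} k\<bar>"
proof -
  have *: "\<rho> (x s) (x t) \<le> integral {a..t} k - integral {a..s} k" if "a \<le> s" "s \<le> t" "t \<le> b" for s t
  proof -
    have "k integrable_on {a..t}"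
      using integrable_subinterval_real[OF k] that by auto
    then have "integral {a..s} k + integral {s..t} k = integral {a..t} k"
      by (rule Henstock_Kurzweil_Integration.integral_combine[OF that(1,2)])
    then show ?thesis
      using le[OF that] by simp
  qed
  show ?thesis
    using *[of s t] *[of t s] st dist_sym[of "x s" "x t"] by (cases "s \<le> t") auto
qed

lemma integral_bound_imp_continuous_on:
  fixes k :: "real \<Rightarrow> real"
  assumes k: "k integrable_on {a..b}"
    and le: "\<And>s t. a \<le> s \<Longrightarrow> s \<le> t \<Longrightarrow> t \<le> b \<Longrightarrow> \<rho> (x s) (x t) \<le> integral {s..t} k"
  shows "continuous_on {a..b} x"
  unfolding continuous_on_def
proof
  fix t assume t: "t \<in> {a..b}"
  have "((\<lambda>s. integral {a..s} k) \<longlongrightarrow> integral {a..t} k) (at t within {a..b})"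
    using indefinite_integral_continuous_1[OF k] t unfolding continuous_on_def by blast
  then have "((\<lambda>s. \<bar>integral {a..s} k - integral {a..t} k\<bar>) \<longlongrightarrow> 0) (at t within {a..b})"
    by (intro tendsto_rabs_zero LIM_zero)
  then have "((\<lambda>s. \<rho> (x t) (x s)) \<longlongrightarrow> 0) (at t within {a..b})"
  proof (rule Lim_null_comparison[rotated])
    show "\<forall>\<^sub>F s in at t within {a..b}. norm (\<rho> (x t) (x s)) \<le> \<bar>integral {a..s} k - integral {a..t} k\<bar>"
      unfolding eventually_at_filter
    proof (intro always_eventually allI impI)
      fix s assume "s \<in> {a..b}"
      then show "norm (\<rho> (x t) (x s)) \<le> \<bar>integral {a..s} k - integral {a..t} k\<bar>"
        using integral_bound_imp_dist_le[OF k le t, of s] dist_nonneg[of "x t" "x s"] by simp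
    qed
  qed
  then show "(x \<longlongrightarrow> x t) (at t within {a..b})"
    by (simp add: tendsto_iff_dist)
qed

lemma abs_continuous_imp_continuous_on:
  assumes "abs_continuous A g a b x"
  shows "continuous_on {a..b} x"
proof -
  obtain k where k: "k absolutely_integrable_on {a..b}"
    "\<forall>s t. a \<le> s \<and> s \<le> t \<and> t \<le> b \<longrightarrow> \<rho> (x s) (x t) \<le> integral {s..t} k"
    by (rule abs_continuous_integral[OF assms])
  show ?thesis
    by (rule integral_bound_imp_continuous_on[OF set_lebesgue_integral_eq_integral(1)[OF k(1)]]) (use k(2) in blast)
qed

lemma velocity_imp_dist_le:
  assumes v: "has_velocity A x t v" and ct: "isCont x t" and e: "0 < e"
  shows "\<exists>d>0. \<forall>s. \<bar>s - t\<bar> < d \<longrightarrow> \<rho> (x t) (x s) \<le> (2 * tnorm g (x t) v + e) * \<bar>s - t\<bar>"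
proof -
  obtain U \<phi> where c: "(U, \<phi>) \<in> A" "x t \<in> U"
    by (rule chart_at)
  obtain r where r: "0 < r" "\<forall>y\<in>U. \<phi> y \<in> ball (\<phi> (x t)) r \<longrightarrow>
      \<rho> (x t) y \<le> 2 * sqrt (coord_form U \<phi> (\<phi> (x t)) (\<phi> y - \<phi> (x t)))"
    by (rule dist_le_twice_form[OF c])
  define n where "n w = sqrt (coord_form U \<phi> (\<phi> (x t)) w)" for w
  have zU: "\<phi> (x t) \<in> \<phi> ` U"
    using c(2) by simp
  have vt: "v \<in> tangent_space A (x t)"
    using v by (simp add: has_velocity_def)
  have ncont: "continuous_on UNIV n"
    unfolding n_def
    by (intro continuous_intros continuous_on_compose2[OF continuous_on_coord_form[OF c(1)], of UNIV "\<lambda>w. (\<phi> (x t), w)", simplified])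
      (use c(2) in auto)
  have "((\<phi> \<circ> x) has_vector_derivative v (U, \<phi>)) (at t)"
    by (rule has_velocity_chart[OF v ct c])
  then have "((\<lambda>s. (1 / (s - t)) *\<^sub>R (\<phi> (x s) - \<phi> (x t))) \<longlongrightarrow> v (U, \<phi>)) (at t)"
    using has_vector_derivative_imp_quotient[of "\<phi> \<circ> x"] by simp
  then have "((\<lambda>s. n ((1 / (s - t)) *\<^sub>R (\<phi> (x s) - \<phi> (x t)))) \<longlongrightarrow> n (v (U, \<phi>))) (at t)"
    by (rule continuous_on_tendsto_compose[OF ncont]) auto
  moreover have "n (v (U, \<phi>)) = tnorm g (x t) v"
    unfolding n_def by (rule tnorm_chart[OF c(1) vt c(2), symmetric])
  ultimately have "\<forall>\<^sub>F s in at t. n ((1 / (s - t)) *\<^sub>R (\<phi> (x s) - \<phi> (x t))) < tnorm g (x t) v + e / 2"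
    by (intro order_tendstoD(2)) (use e in auto)
  moreover have "\<forall>\<^sub>F s in at t. x s \<in> {y \<in> U. \<phi> y \<in> ball (\<phi> (x t)) r}"
  proof (rule topological_tendstoD)
    show "(x \<longlongrightarrow> x t) (at t)"
      using ct by (simp add: isCont_def)
    show "open {y \<in> U. \<phi> y \<in> ball (\<phi> (x t)) r}"
      by (rule open_chart_preimage[OF c(1)]) simp
    show "x t \<in> {y \<in> U. \<phi> y \<in> ball (\<phi> (x t)) r}"
      using c r by simp
  qed
  ultimately have "\<forall>\<^sub>F s in at t. \<rho> (x t) (x s) \<le> (2 * tnorm g (x t) v + e) * \<bar>s - t\<bar>"
  proof eventually_elim
    fix s assume 1: "n ((1 / (s - t)) *\<^sub>R (\<phi> (x s) - \<phi> (x t))) < tnorm g (x t) v + e / 2"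
      and 2: "x s \<in> {y \<in> U. \<phi> y \<in> ball (\<phi> (x t)) r}"
    show "\<rho> (x t) (x s) \<le> (2 * tnorm g (x t) v + e) * \<bar>s - t\<bar>"
    proof (cases "s = t")
      case True
      then show ?thesis
        by (simp add: dist_self)
    next
      case False
      then have "n (\<phi> (x s) - \<phi> (x t)) = \<bar>s - t\<bar> * n ((1 / (s - t)) *\<^sub>R (\<phi> (x s) - \<phi> (x t)))"
        using sqrt_coord_form_scale[OF c(1) zU, of "s - t" "(1 / (s - t)) *\<^sub>R (\<phi> (x s) - \<phi> (x t))"] by (simp add: n_def)
      also have "\<dots> \<le> \<bar>s - t\<bar> * (tnorm g (x t) v + e / 2)"
        using 1 by (intro mult_left_mono) auto
      finally have "2 * n (\<phi> (x s) - \<phi> (x t)) \<le> (2 * tnorm g (x t) v + e) * \<bar>s - t\<bar>"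
        by (simp add: algebra_simps)
      moreover have "\<rho> (x t) (x s) \<le> 2 * n (\<phi> (x s) - \<phi> (x t))"
        using r(2) 2 by (simp add: n_def)
      ultimately show ?thesis
        by simp
    qed
  qed
  then obtain d where d: "0 < d" "\<forall>s. s \<noteq> t \<and> dist s t < d \<longrightarrow> \<rho> (x t) (x s) \<le> (2 * tnorm g (x t) v + e) * \<bar>s - t\<bar>"
    unfolding eventually_at by blast
  have "\<rho> (x t) (x s) \<le> (2 * tnorm g (x t) v + e) * \<bar>s - t\<bar>" if "\<bar>s - t\<bar> < d" for s
    using d(2) that by (cases "s = t") (auto simp: dist_self dist_real_def)
  with d(1) show ?thesis
    by blast
qed

text \<open>The factor 2 avoids a limit of metrics and is immaterial for the extension of solutions.\<close>

lemma dist_le_integral_speed: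
  assumes ab: "a \<le> b" and ac: "abs_continuous A g a b x" and J: "J integrable_on {a..b}" and N: "negligible N"
    and vel: "\<And>t. t \<in> {a<..<b} - N \<Longrightarrow> has_velocity A x t (v t) \<and> tnorm g (x t) (v t) \<le> J t"
  shows "\<rho> (x a) (x b) \<le> integral {a..b} (\<lambda>t. 2 * J t)"
proof -
  obtain k where k: "k absolutely_integrable_on {a..b}"
    "\<forall>s t. a \<le> s \<and> s \<le> t \<and> t \<le> b \<longrightarrow> \<rho> (x s) (x t) \<le> integral {s..t} k"
    by (rule abs_continuous_integral[OF ac])
  have cont: "continuous_on {a..b} x"
    by (rule abs_continuous_imp_continuous_on[OF ac])
  \<comment> \<open>The increment theorem is applied to the distance from the starting point, whose
    increments are dominated by those of the curve.\<close>
  have "\<rho> (x a) (x b) - \<rho> (x a) (x a) \<le> integral {a..b} (\<lambda>t. 2 * J t)"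
  proof (rule absolutely_continuous_increment_le[where k = k and N = "N \<union> {a, b}", OF ab set_lebesgue_integral_eq_integral(1)[OF k(1)]])
    show "(\<lambda>t. 2 * J t) integrable_on {a..b}"
      using J by (rule integrable_on_mult_right)
    show "negligible (N \<union> {a, b})"
      using N by simp
    show "\<bar>\<rho> (x a) (x t) - \<rho> (x a) (x s)\<bar> \<le> integral {s..t} k" if "a \<le> s" "s \<le> t" "t \<le> b" for s t
    proof -
      have "\<rho> (x s) (x t) \<le> integral {s..t} k"
        using k(2) that by blast
      then show ?thesis
        using dist_triangle_abs[of "x a" "x t" "x s"] dist_sym[of "x t" "x s"] by simp
    qed
    fix t e :: real assume t: "t \<in> {a..b} - (N \<union> {a, b})" and e: "0 < e"
    have t': "t \<in> {a<..<b} - N"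
      using t by auto
    have ct: "isCont x t"
      by (rule continuous_on_interior[OF cont]) (use t' in simp)
    obtain d where d: "0 < d" "\<forall>s. \<bar>s - t\<bar> < d \<longrightarrow> \<rho> (x t) (x s) \<le> (2 * tnorm g (x t) (v t) + e) * \<bar>s - t\<bar>"
      using velocity_imp_dist_le[OF _ ct e] vel[OF t'] by blast
    have near: "\<rho> (x t) (x s) \<le> (2 * J t + e) * \<bar>s - t\<bar>" if "\<bar>s - t\<bar> < d" for s
    proof -
      have "\<rho> (x t) (x s) \<le> (2 * tnorm g (x t) (v t) + e) * \<bar>s - t\<bar>"
        using d(2) that by blast
      also have "\<dots> \<le> (2 * J t + e) * \<bar>s - t\<bar>"
        using vel[OF t'] by (intro mult_right_mono) auto
      finally show ?thesis .
    qed
    have "\<rho> (x a) (x w) - \<rho> (x a) (x u) \<le> (2 * J t + e) * (w - u)"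
      if "u \<le> t" "t \<le> w" "t - d < u" "w < t + d" for u w
    proof -
      have "\<rho> (x a) (x w) \<le> \<rho> (x a) (x u) + \<rho> (x u) (x w)" "\<rho> (x u) (x w) \<le> \<rho> (x u) (x t) + \<rho> (x t) (x w)"
        by (rule dist_triangle)+
      moreover have "\<rho> (x t) (x u) \<le> (2 * J t + e) * (t - u)" "\<rho> (x t) (x w) \<le> (2 * J t + e) * (w - t)"
      proof -
        have "\<bar>u - t\<bar> = t - u" "\<bar>w - t\<bar> = w - t"
          using that by simp_all
        then show "\<rho> (x t) (x u) \<le> (2 * J t + e) * (t - u)" "\<rho> (x t) (x w) \<le> (2 * J t + e) * (w - t)"
          using near[of u] near[of w] that by simp_all
      qed
      moreover have "(2 * J t + e) * (t - u) + (2 * J t + e) * (w - t) = (2 * J t + e) * (w - u)"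
        by (simp add: algebra_simps)
      ultimately show ?thesis
        using dist_sym[of "x u" "x t"] by linarith
    qed
    with d(1) show "\<exists>d>0. \<forall>u v. u \<le> t \<and> t \<le> v \<and> t - d < u \<and> v < t + d \<and> a \<le> u \<and> v \<le> b \<longrightarrow>
        \<rho> (x a) (x v) - \<rho> (x a) (x u) \<le> (2 * J t + e) * (v - u)"
      by blast
  qed
  then show ?thesis
    by (simp add: dist_self)
qed

section \<open>The Lyapunov function along a curve\<close>

text \<open>\<open>differential\<close> evaluates in a chart picked by choice; the chain rule and
  the transformation law of tangent vectors cancel each other, so any chart about the point gives
  the same value.\<close>

lemma differential_chart:
  assumes c: "(U, \<phi>) \<in> A" "x \<in> U" and F: "((F \<circ> inv_into U \<phi>) has_derivative L) (at (\<phi> x))"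
    and v: "v \<in> tangent_space A x"
  shows "differential A F x v = L (v (U, \<phi>))"
proof -
  have at: "(U, \<phi>) \<in> charts_at A x"
    using c by (simp add: charts_at_def)
  define d where "d = (SOME c. c \<in> charts_at A x)"
  have d: "d \<in> charts_at A x"
    unfolding d_def by (rule someI[of "\<lambda>c. c \<in> charts_at A x", OF at])
  obtain W \<psi> where W: "d = (W, \<psi>)"
    by (cases d)
  have "(W, \<psi>) \<in> A" "x \<in> W"
    using d W by (auto simp: charts_at_def)
  from chart_change_derivative[OF this(1) c(1) this(2) c(2) F]
  have "frechet_derivative (F \<circ> inv_into W \<psi>) (at (\<psi> x)) = L \<circ> trans_deriv (W, \<psi>) (U, \<phi>) x"
    by (rule frechet_derivative_at[symmetric])
  moreover have "v (U, \<phi>) = trans_deriv (W, \<psi>) (U, \<phi>) x (v (W, \<psi>))"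
    using tangent_spaceD[OF v d at] W by simp
  moreover have "differential A F x v = frechet_derivative (F \<circ> inv_into W \<psi>) (at (\<psi> x)) (v (W, \<psi>))"
    unfolding differential_def Let_def d_def[symmetric] W by simp
  ultimately show ?thesis
    by simp
qed

lemma C1_time_space_chart:
  assumes V: "C1_time_space A B V" and B: "open B" and x: "x \<in> B"
  obtains U \<phi> V' where "(U, \<phi>) \<in> A" "x \<in> U" "U \<subseteq> B" "continuous_on ({0..} \<times> \<phi> ` U) V'"
    "\<forall>p\<in>{0..} \<times> \<phi> ` U. ((\<lambda>(t, z). V t (inv_into U \<phi> z)) has_derivative blinfun_apply (V' p)) (at p within {0..} \<times> \<phi> ` U)"
proof -
  obtain U \<phi> where c: "(U, \<phi>) \<in> A" "x \<in> U" "U \<subseteq> B"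
    by (rule chart_within[OF B x])
  then have "C1_on ({0..} \<times> \<phi> ` U) (\<lambda>(t, z). V t (inv_into U \<phi> z))"
    using V unfolding C1_time_space_def by blast
  then show ?thesis
    using that[OF c] unfolding C1_on_def by blast
qed

text \<open>For positive \<open>t\<close> the derivative of V relative to the half line becomes an
  ordinary one. Its linear map \<open>L\<close> is split as
  \<open>L (1, v) = L (1, 0) + L (0, v)\<close>, the time derivative plus the spatial
  differential.\<close>

lemma chain_rule_time_space:
  assumes V: "C1_time_space A B V" and B: "open B" and t: "0 < t" and xB: "x t \<in> B" and ct: "isCont x t"
    and v: "has_velocity A x t v"
  shows "((\<lambda>s. V s (x s)) has_real_derivative time_derivative V t (x t) + differential A (V t) (x t) v) (at t)"
proof -
  obtain U \<phi> V' where c: "(U, \<phi>) \<in> A" "x t \<in> U" "U \<subseteq> B" "continuous_on ({0..} \<times> \<phi> ` U) V'"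
    "\<forall>p\<in>{0..} \<times> \<phi> ` U. ((\<lambda>(t, z). V t (inv_into U \<phi> z)) has_derivative blinfun_apply (V' p)) (at p within {0..} \<times> \<phi> ` U)"
    by (rule C1_time_space_chart[OF V B xB])
  define F where "F = (\<lambda>(t, z). V t (inv_into U \<phi> z))"
  define L where "L = blinfun_apply (V' (t, \<phi> (x t)))"
  have lin: "linear L"
    unfolding L_def by (rule bounded_linear.linear) (rule blinfun.bounded_linear_right)
  have oU: "open (\<phi> ` U)"
    by (rule open_chart_image[OF c(1)])
  have p: "(t, \<phi> (x t)) \<in> {0<..} \<times> \<phi> ` U" "open ({0::real<..} \<times> \<phi> ` U)"
    using t c(2) by (simp, intro open_Times open_greaterThan oU)
  have "(F has_derivative L) (at (t, \<phi> (x t)) within {0..} \<times> \<phi> ` U)"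
    using c(5) p(1) unfolding F_def L_def by force
  then have "(F has_derivative L) (at (t, \<phi> (x t)) within {0<..} \<times> \<phi> ` U)"
    by (rule has_derivative_subset) auto
  then have F: "(F has_derivative L) (at (t, \<phi> (x t)))"
    using at_within_open[OF p] by simp
  have "((\<phi> \<circ> x) has_vector_derivative v (U, \<phi>)) (at t)"
    by (rule has_velocity_chart[OF v ct c(1,2)])
  then have "((\<lambda>s. (s, \<phi> (x s))) has_derivative (\<lambda>h. (h, h *\<^sub>R v (U, \<phi>)))) (at t)"
    unfolding has_vector_derivative_def o_def by (intro has_derivative_Pair has_derivative_ident)
  from diff_chain_at[OF this F]
  have "(F \<circ> (\<lambda>s. (s, \<phi> (x s))) has_derivative (L \<circ> (\<lambda>h. (h, h *\<^sub>R v (U, \<phi>))))) (at t)" .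
  also have "L \<circ> (\<lambda>h. (h, h *\<^sub>R v (U, \<phi>))) = (*) (L (1, v (U, \<phi>)))"
  proof
    fix h :: real
    have "(h, h *\<^sub>R v (U, \<phi>)) = h *\<^sub>R (1, v (U, \<phi>))"
      by simp
    then show "(L \<circ> (\<lambda>h. (h, h *\<^sub>R v (U, \<phi>)))) h = L (1, v (U, \<phi>)) * h"
      using linear_cmul[OF lin, of h "(1, v (U, \<phi>))"] by simp
  qed
  finally have "(F \<circ> (\<lambda>s. (s, \<phi> (x s))) has_real_derivative L (1, v (U, \<phi>))) (at t)"
    by (simp only: has_field_derivative_def)
  moreover have "\<forall>\<^sub>F s in at t. (F \<circ> (\<lambda>s. (s, \<phi> (x s)))) s = V s (x s)"
  proof -
    have "\<forall>\<^sub>F s in at t. x s \<in> U"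
      using ct open_chart_domain[OF c(1)] c(2) unfolding isCont_def by (rule topological_tendstoD)
    then show ?thesis
      by (rule eventually_mono) (simp add: F_def chart_inverse[OF c(1)])
  qed
  ultimately have W: "((\<lambda>s. V s (x s)) has_real_derivative L (1, v (U, \<phi>))) (at t)"
    unfolding has_field_derivative_def
    by (rule has_derivative_transform_eventually) (use chart_inverse[OF c(1)] c(2) in \<open>auto simp: F_def\<close>)
  have "((\<lambda>s. (s, \<phi> (x t))) has_derivative (\<lambda>h. (h, 0))) (at t)"
    by (intro has_derivative_Pair has_derivative_ident has_derivative_const)
  from diff_chain_at[OF this F] have "((\<lambda>s. V s (x t)) has_derivative (\<lambda>h. L (h, 0))) (at t)"
    using chart_inverse[OF c(1,2)] by (simp add: F_def o_def)
  moreover have "(\<lambda>h. L (h, 0)) = (\<lambda>h. h *\<^sub>R L (1, 0))"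
  proof
    show "L (h, 0) = h *\<^sub>R L (1, 0)" for h :: real
      using linear_cmul[OF lin, of h "(1, 0)"] by simp
  qed
  ultimately have "((\<lambda>s. V s (x t)) has_vector_derivative L (1, 0)) (at t)"
    by (simp only: has_vector_derivative_def)
  moreover have "at t within {0..} = at t"
    by (rule at_within_interior) (use t in simp)
  ultimately have td: "time_derivative V t (x t) = L (1, 0)"
    unfolding time_derivative_def by (simp add: vector_derivative_at)
  have "((\<lambda>z. (t, z)) has_derivative (\<lambda>e. (0, e))) (at (\<phi> (x t)))"
    by (intro has_derivative_Pair has_derivative_ident has_derivative_const)
  from diff_chain_at[OF this F] have "((V t \<circ> inv_into U \<phi>) has_derivative (\<lambda>e. L (0, e))) (at (\<phi> (x t)))"
    by (simp add: F_def o_def)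
  from differential_chart[OF c(1,2) this] v have dd: "differential A (V t) (x t) v = L (0, v (U, \<phi>))"
    by (simp add: has_velocity_def)
  have "L (1, v (U, \<phi>)) = L ((1, 0) + (0, v (U, \<phi>)))"
    by simp
  also have "\<dots> = L (1, 0) + L (0, v (U, \<phi>))"
    by (rule linear_add[OF lin])
  finally show ?thesis
    using W td dd by simp
qed

text \<open>On a compact convex coordinate box the derivative of V is bounded, so V is Lipschitz
  there; the lower half of the chart comparison replaces coordinate norms by the distance. This
  supplies the integrable majorant for the increments of V along a solution.\<close>

lemma time_space_local_lipschitz:
  assumes V: "C1_time_space A B V" and B: "open B" and t: "0 \<le> t" and xB: "x t \<in> B"
    and cont: "(x \<longlongrightarrow> x t) (at t within I)"
  shows "\<exists>d>0. \<exists>C\<ge>0. \<forall>s\<in>I. \<forall>s'\<in>I. 0 \<le> s \<and> 0 \<le> s' \<and> \<bar>s - t\<bar> < d \<and> \<bar>s' - t\<bar> < d \<longrightarrow>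
    \<bar>V s (x s) - V s' (x s')\<bar> \<le> C * (\<bar>s - s'\<bar> + \<rho> (x s) (x s'))"
proof -
  obtain U \<phi> V' where c: "(U, \<phi>) \<in> A" "x t \<in> U" "U \<subseteq> B" and V': "continuous_on ({0..} \<times> \<phi> ` U) V'"
    and der: "\<forall>p\<in>{0..} \<times> \<phi> ` U. ((\<lambda>(t, z). V t (inv_into U \<phi> z)) has_derivative blinfun_apply (V' p)) (at p within {0..} \<times> \<phi> ` U)"
    by (rule C1_time_space_chart[OF V B xB])
  obtain r a b where r: "0 < r" "0 < a" "0 < b" "cball (\<phi> (x t)) r \<subseteq> \<phi> ` U"
    "\<forall>y\<in>U. \<forall>z\<in>U. \<phi> y \<in> cball (\<phi> (x t)) r \<longrightarrow> \<phi> z \<in> cball (\<phi> (x t)) r \<longrightarrow>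
      a * norm (\<phi> z - \<phi> y) \<le> \<rho> y z \<and> \<rho> y z \<le> b * norm (\<phi> z - \<phi> y)"
    "\<forall>z\<in>cball (\<phi> (x t)) r. \<forall>e. a * norm e \<le> sqrt (coord_form U \<phi> z e)"
    "\<forall>y. \<rho> (x t) y < a * r \<longrightarrow> y \<in> U \<and> \<phi> y \<in> ball (\<phi> (x t)) r"
    by (rule dist_chart_equivalent[OF c(1,2)])
  \<comment> \<open>The time interval is cut off at 0 because V is differentiable only on the closed
    half line; the factor remains convex, as the mean value inequality demands.\<close>
  define S where "S = {max 0 (t - 1)..t + 1} \<times> cball (\<phi> (x t)) r"
  have S: "compact S" "convex S" "S \<subseteq> {0..} \<times> \<phi> ` U"
    using r(4) by (auto simp: S_def intro!: compact_Times convex_Times)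
  have "bounded (V' ` S)"
    by (intro compact_imp_bounded compact_continuous_image continuous_on_subset[OF V' S(3)] S(1))
  then obtain C where C: "0 < C" "\<forall>p\<in>S. norm (V' p) \<le> C"
    unfolding bounded_pos by auto
  define F where "F = (\<lambda>(t, z). V t (inv_into U \<phi> z))"
  have lip: "norm (F p - F q) \<le> C * norm (p - q)" if "p \<in> S" "q \<in> S" for p q
  proof (rule differentiable_bound[OF S(2) _ _ that])
    show "(F has_derivative blinfun_apply (V' p)) (at p within S)" if "p \<in> S" for p
      unfolding F_def by (rule has_derivative_subset[OF bspec[OF der] S(3)]) (use that S(3) in blast)
    show "onorm (blinfun_apply (V' p)) \<le> C" if "p \<in> S" for p
      using C(2) that by (simp add: norm_blinfun.rep_eq)
  qed
  have "\<forall>\<^sub>F s in at t within I. x s \<in> {y \<in> U. \<phi> y \<in> ball (\<phi> (x t)) r}"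
    by (rule topological_tendstoD[OF cont]) (use c r open_chart_preimage[OF c(1), of "ball (\<phi> (x t)) r"] in auto)
  then obtain d where d: "0 < d" "\<forall>s\<in>I. s \<noteq> t \<and> dist s t < d \<longrightarrow> x s \<in> {y \<in> U. \<phi> y \<in> ball (\<phi> (x t)) r}"
    unfolding eventually_at by blast
  have in_U: "x s \<in> U \<and> \<phi> (x s) \<in> cball (\<phi> (x t)) r" if "s \<in> I" "\<bar>s - t\<bar> < d" for s
    using d(2) that c(2) r(1) by (cases "s = t") (auto simp: dist_real_def)
  define C' where "C' = C * (1 + 1 / a)"
  have C': "C \<le> C'" "C / a \<le> C'" "0 \<le> C'"
    using C(1) r(2) by (auto simp: C'_def field_simps)
  have "\<forall>s\<in>I. \<forall>s'\<in>I. 0 \<le> s \<and> 0 \<le> s' \<and> \<bar>s - t\<bar> < min d 1 \<and> \<bar>s' - t\<bar> < min d 1 \<longrightarrow>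
    \<bar>V s (x s) - V s' (x s')\<bar> \<le> C' * (\<bar>s - s'\<bar> + \<rho> (x s) (x s'))"
  proof (intro ballI impI)
    fix s s' assume s: "s \<in> I" "s' \<in> I" "0 \<le> s \<and> 0 \<le> s' \<and> \<bar>s - t\<bar> < min d 1 \<and> \<bar>s' - t\<bar> < min d 1"
    have xs: "x s \<in> U" "\<phi> (x s) \<in> cball (\<phi> (x t)) r" "x s' \<in> U" "\<phi> (x s') \<in> cball (\<phi> (x t)) r"
      using in_U s by auto
    have "s \<in> {max 0 (t - 1)..t + 1}" "s' \<in> {max 0 (t - 1)..t + 1}"
      using s by (auto simp: abs_if split: if_splits)
    then have "(s, \<phi> (x s)) \<in> S" "(s', \<phi> (x s')) \<in> S"
      using xs unfolding S_def by blast+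
    from lip[OF this] have "\<bar>V s (x s) - V s' (x s')\<bar> \<le> C * norm ((s, \<phi> (x s)) - (s', \<phi> (x s')))"
      using chart_inverse[OF c(1)] xs by (simp add: F_def)
    also have "\<dots> \<le> C * (\<bar>s - s'\<bar> + norm (\<phi> (x s) - \<phi> (x s')))"
      using norm_Pair_le[of "s - s'" "\<phi> (x s) - \<phi> (x s')"] C(1) by (intro mult_left_mono) simp_all
    also have "\<dots> \<le> C * (\<bar>s - s'\<bar> + \<rho> (x s) (x s') / a)"
    proof -
      have "a * norm (\<phi> (x s) - \<phi> (x s')) \<le> \<rho> (x s) (x s')"
        using r(5) xs by (metis norm_minus_commute)
      then have "norm (\<phi> (x s) - \<phi> (x s')) \<le> \<rho> (x s) (x s') / a"
        using r(2) by (simp add: field_simps)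
      then show ?thesis
        using C(1) by (intro mult_left_mono add_left_mono) auto
    qed
    also have "\<dots> = C * \<bar>s - s'\<bar> + C / a * \<rho> (x s) (x s')"
      by (simp add: algebra_simps)
    also have "\<dots> \<le> C' * \<bar>s - s'\<bar> + C' * \<rho> (x s) (x s')"
      using C' dist_nonneg by (intro add_mono mult_right_mono) auto
    finally show "\<bar>V s (x s) - V s' (x s')\<bar> \<le> C' * (\<bar>s - s'\<bar> + \<rho> (x s) (x s'))"
      by (simp add: distrib_left)
  qed
  moreover have "0 < min d 1"
    using d(1) by simp
  ultimately show ?thesis
    using C'(3) by blast
qed

text \<open>The Lipschitz constant is only local, so the inequality is proved on short intervals and
  propagated by bisection: it is additive over adjacent intervals because the rate \<open>c\<close>
  is constant.\<close>

theorem lyapunov_decrease: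
  assumes V: "C1_time_space A B V" and B: "open B" and ab: "0 \<le> a" "a \<le> b" and ac: "abs_continuous A g a b x"
    and xB: "\<And>t. t \<in> {a..b} \<Longrightarrow> x t \<in> B" and N: "negligible N"
    and dec: "\<And>t. t \<in> {a<..<b} - N \<Longrightarrow> \<exists>v. has_velocity A x t v \<and>
      time_derivative V t (x t) + differential A (V t) (x t) v \<le> - c"
  shows "V b (x b) - V a (x a) \<le> - c * (b - a)"
proof -
  obtain k where k: "k absolutely_integrable_on {a..b}"
    "\<forall>s t. a \<le> s \<and> s \<le> t \<and> t \<le> b \<longrightarrow> \<rho> (x s) (x t) \<le> integral {s..t} k"
    by (rule abs_continuous_integral[OF ac])
  have ki: "k integrable_on {a..b}"
    by (rule set_lebesgue_integral_eq_integral(1)[OF k(1)])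
  have cont: "continuous_on {a..b} x"
    by (rule abs_continuous_imp_continuous_on[OF ac])
  define W where "W t = V t (x t)" for t
  \<comment> \<open>Bisection quantifies over all short intervals around a point, including ones
    that stick out of \<open>{a..b}\<close>; the premise makes these hold vacuously.\<close>
  define P where "P u v \<longleftrightarrow> (a \<le> u \<and> u \<le> v \<and> v \<le> b \<longrightarrow> W v - W u \<le> - c * (v - u))" for u v
  have "P a b"
  proof (induction rule: Bolzano[OF ab(2)])
    case (1 u v w)
    then show ?case
      by (auto simp: P_def algebra_simps)
  next
    case (2 t)
    then have t: "t \<in> {a..b}" by simp
    have "(x \<longlongrightarrow> x t) (at t within {a..b})"
      using cont t by (simp add: continuous_on_def)
    from time_space_local_lipschitz[where t = t and x = x, OF V B _ xB[OF t] this] t ab(1)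
    obtain d C where d: "0 < d" "0 \<le> C" and lip: "\<forall>s\<in>{a..b}. \<forall>s'\<in>{a..b}. 0 \<le> s \<and> 0 \<le> s' \<and> \<bar>s - t\<bar> < d \<and> \<bar>s' - t\<bar> < d \<longrightarrow>
      \<bar>V s (x s) - V s' (x s')\<bar> \<le> C * (\<bar>s - s'\<bar> + \<rho> (x s) (x s'))"
      by auto
    show ?case
    proof (intro exI[of _ d] conjI allI impI d(1))
      fix u v assume uv: "u \<le> t \<and> t \<le> v \<and> v - u < d"
      show "P u v"
        unfolding P_def
      proof
        assume uv': "a \<le> u \<and> u \<le> v \<and> v \<le> b"
        have kuv: "k integrable_on {s..s'}" if "u \<le> s" "s' \<le> v" for s s'
          using integrable_subinterval_real[OF ki] that uv' by auto
        have "W v - W u \<le> integral {u..v} (\<lambda>_. - c)"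
        \<comment> \<open>The majorant combines the Lipschitz constant in time with that in the
          distance, the latter weighted by the majorant \<open>k\<close> of the curve.\<close>
        proof (rule absolutely_continuous_increment_le[where k = "\<lambda>s. C * (1 + k s)" and N = "N \<union> {u, v}"])
          show "u \<le> v" using uv' by simp
          show "(\<lambda>s. C * (1 + k s)) integrable_on {u..v}"
            by (intro integrable_on_mult_right integrable_add kuv) auto
          show "(\<lambda>_. - c) integrable_on {u..v}"
            by (rule integrable_const_ivl)
          show "negligible (N \<union> {u, v})"
            using N by simp
        next
          fix s s' assume s: "u \<le> s" "s \<le> s'" "s' \<le> v"
          have "\<bar>s - t\<bar> < d" "\<bar>s' - t\<bar> < d" "s \<in> {a..b}" "s' \<in> {a..b}" "0 \<le> s" "0 \<le> s'"
            using s uv uv' ab(1) by (auto simp: abs_if)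
          then have "\<bar>W s' - W s\<bar> \<le> C * (\<bar>s' - s\<bar> + \<rho> (x s') (x s))"
            unfolding W_def using lip by blast
          also have "\<dots> \<le> C * ((s' - s) + integral {s..s'} k)"
            using k(2) s uv' dist_sym[of "x s'" "x s"] d(2) by (intro mult_left_mono add_mono) auto
          also have "\<dots> = integral {s..s'} (\<lambda>r. C * (1 + k r))"
          proof -
            have "integral {s..s'} (\<lambda>r. 1 + k r) = integral {s..s'} (\<lambda>r. 1) + integral {s..s'} k"
              using s by (intro integral_add kuv) auto
            then show ?thesis
              using s by simp
          qed
          finally show "\<bar>W s' - W s\<bar> \<le> integral {s..s'} (\<lambda>r. C * (1 + k r))" .
        next
          fix s e :: real assume s: "s \<in> {u..v} - (N \<union> {u, v})" and e: "0 < e"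
          then have s': "s \<in> {a<..<b} - N"
            using uv' by auto
          obtain w where w: "has_velocity A x s w" "time_derivative V s (x s) + differential A (V s) (x s) w \<le> - c"
            using dec[OF s'] by blast
          have "isCont x s"
            by (rule continuous_on_interior[OF cont]) (use s' in simp)
          then have "(W has_real_derivative time_derivative V s (x s) + differential A (V s) (x s) w) (at s)"
            unfolding W_def using s' ab(1) w(1) xB[of s] by (intro chain_rule_time_space[OF V B]) auto
          from derivative_imp_increment_le[OF this w(2) e]
          show "\<exists>d>0. \<forall>u' v'. u' \<le> s \<and> s \<le> v' \<and> s - d < u' \<and> v' < s + d \<and> u \<le> u' \<and> v' \<le> v \<longrightarrow>
              W v' - W u' \<le> (- c + e) * (v' - u')"
            by blast
        qed
        then show "W v - W u \<le> - c * (v - u)"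
          using uv' by (simp add: mult.commute)
      qed
    qed
  qed
  then show ?thesis
    using ab(2) by (simp add: P_def W_def)
qed

end

subsection \<open>Existence and extension of solutions\<close>

context riemannian
begin

lemma dist_continuous: "(f \<longlongrightarrow> l) F \<Longrightarrow> ((\<lambda>t. \<rho> y (f t)) \<longlongrightarrow> \<rho> y l) F"
proof -
  assume "(f \<longlongrightarrow> l) F"
  then have "((\<lambda>t. \<rho> l (f t)) \<longlongrightarrow> 0) F"
    by (simp add: tendsto_iff_dist)
  then have "((\<lambda>t. \<rho> y (f t) - \<rho> y l) \<longlongrightarrow> 0) F"
  proof (rule Lim_null_comparison[rotated])
    show "\<forall>\<^sub>F t in F. norm (\<rho> y (f t) - \<rho> y l) \<le> \<rho> l (f t)"
      using dist_triangle_abs[of y "f _" l] dist_sym[of "f _" l] by (intro always_eventually allI) simp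
  qed
  then show ?thesis
    by (rule LIM_zero_cancel)
qed

lemma assumption_A_bound:
  assumes "assumption_A A g D f xs" and R: "0 < R" "0 < r"
  obtains I where "\<forall>b\<ge>0. set_integrable lebesgue {0..b} I"
    "AE t in lebesgue_on {0..}. \<forall>x\<in>D. \<forall>u. \<rho> x xs \<le> R \<and> norm u \<le> r \<longrightarrow> tnorm g x (f t x u) \<le> I t"
proof -
  have "\<forall>R>0. \<forall>r>0. \<exists>I. (\<forall>b\<ge>0. set_integrable lebesgue {0..b} I) \<and>
        (AE t in lebesgue_on {0..}. \<forall>x\<in>D. \<forall>u. \<rho> x xs \<le> R \<and> norm u \<le> r \<longrightarrow> tnorm g x (f t x u) \<le> I t)"
    using assms(1) unfolding assumption_A_def by (elim conjE)
  from this[rule_format, OF R] show ?thesis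
    by (elim exE conjE) (rule that)
qed

lemma assumption_A_measurable:
  assumes "assumption_A A g D f xs" "x \<in> D" "c \<in> charts_at A x"
  shows "(\<lambda>t. f t x w c) \<in> borel_measurable (lebesgue_on {0..})"
proof -
  have "\<forall>x\<in>D. \<forall>u. \<forall>c\<in>charts_at A x. (\<lambda>t. f t x u c) \<in> borel_measurable (lebesgue_on {0..})"
    using assms(1) unfolding assumption_A_def by (elim conjE)
  from this[rule_format, OF assms(2,3)] show ?thesis .
qed

lemma assumption_A_lipschitz:
  assumes "assumption_A A g D f xs" "0 \<le> t" "(U, \<phi>) \<in> A" "U \<subseteq> D"
  shows "local_lipschitz {t} (\<phi> ` U) (\<lambda>s z. f s (inv_into U \<phi> z) w (U, \<phi>))"
proof -
  have "\<forall>t\<ge>0. \<forall>u. \<forall>(U, \<phi>)\<in>A. U \<subseteq> D \<longrightarrow>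
        local_lipschitz {t} (\<phi> ` U) (\<lambda>s z. f s (inv_into U \<phi> z) u (U, \<phi>))"
    using assms(1) unfolding assumption_A_def by (elim conjE)
  then have "\<forall>(U, \<phi>)\<in>A. U \<subseteq> D \<longrightarrow> local_lipschitz {t} (\<phi> ` U) (\<lambda>s z. f s (inv_into U \<phi> z) w (U, \<phi>))"
    using assms(2) by blast
  from bspec[OF this assms(3)] show ?thesis
    using assms(4) by simp
qed

lemma assumption_A_continuous:
  assumes "assumption_A A g D f xs" "0 \<le> t" "x \<in> D" "c \<in> charts_at A x"
  shows "continuous_on UNIV (\<lambda>w. f t x w c)"
proof -
  have "\<forall>t\<ge>0. \<forall>x\<in>D. \<forall>c\<in>charts_at A x. continuous_on UNIV (\<lambda>u. f t x u c)"
    using assms(1) unfolding assumption_A_def by (elim conjE)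
  from this[rule_format, OF assms(2-4)] show ?thesis .
qed

lemma caratheodory_chart_field_measurable:
  fixes f :: "real \<Rightarrow> 'a \<Rightarrow> 'u::euclidean_space \<Rightarrow> ('a, 'e) tangent"
  assumes meas: "\<And>w. (\<lambda>t. f t x w c) \<in> borel_measurable (lebesgue_on {0..})"
    and cont: "\<And>t. 0 \<le> t \<Longrightarrow> continuous_on UNIV (\<lambda>w. f t x w c)"
    and u: "u \<in> borel_measurable (lebesgue_on {0..})"
    and N: "negligible N" and T: "0 \<le> a"
  shows "(\<lambda>t. if t \<in> N then 0 else f t x (u t) c) \<in> borel_measurable (lebesgue_on {a..b})"
proof -
  have "(\<lambda>t. f t x (u t) c) \<in> borel_measurable (lebesgue_on {0..})"
    by (rule borel_measurable_caratheodory[where F = "\<lambda>t w. f t x w c", OF meas _ u]) (use cont in simp)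
  then have f: "(\<lambda>t. f t x (u t) c) \<in> borel_measurable (lebesgue_on {a..b})"
    by (rule measurable_restrict_mono) (use T in auto)
  show ?thesis
  proof (rule measurable_If_set[OF _ f])
    have "N \<in> sets lebesgue"
      using N by (rule negligible_imp_sets)
    then show "N \<inter> space (lebesgue_on {a..b}) \<in> sets (lebesgue_on {a..b})"
      by (auto simp: sets_restrict_space)
  qed simp
qed

text \<open>The field is read in a chart, extended to the whole coordinate space, solved there by
  Caratheodory's theorem, and the solution is pulled back for as long as it remains in the
  coordinate ball.\<close>

lemma local_solution:
  fixes f :: "real \<Rightarrow> 'a \<Rightarrow> 'u::euclidean_space \<Rightarrow> ('a, 'e) tangent"
  assumes D: "open D" and tan: "\<And>t x w. 0 \<le> t \<Longrightarrow> x \<in> D \<Longrightarrow> f t x w \<in> tangent_space A x"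
    and AA: "assumption_A A g D f xs" and u: "L_infinity u" and p: "p \<in> D" and T: "0 \<le> T"
  obtains h y where "0 < h" "y T = p" "y ` {T..T + h} \<subseteq> D" "abs_continuous A g T (T + h) y"
    "AE t in lebesgue. T < t \<and> t < T + h \<longrightarrow> has_velocity A y t (f t (y t) (u t))"
proof -
  obtain U \<phi> where c: "(U, \<phi>) \<in> A" "p \<in> U" "U \<subseteq> D"
    by (rule chart_within[OF D p])
  obtain r a b where r: "0 < r" "0 < a" "0 < b" "cball (\<phi> p) r \<subseteq> \<phi> ` U"
    "\<forall>y\<in>U. \<forall>z\<in>U. \<phi> y \<in> cball (\<phi> p) r \<longrightarrow> \<phi> z \<in> cball (\<phi> p) r \<longrightarrow>
      a * norm (\<phi> z - \<phi> y) \<le> \<rho> y z \<and> \<rho> y z \<le> b * norm (\<phi> z - \<phi> y)"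
    "\<forall>z\<in>cball (\<phi> p) r. \<forall>e. a * norm e \<le> sqrt (coord_form U \<phi> z e)"
    "\<forall>y. \<rho> p y < a * r \<longrightarrow> y \<in> U \<and> \<phi> y \<in> ball (\<phi> p) r"
    by (rule dist_chart_equivalent[OF c(1,2)])
  let ?K = "cball (\<phi> p) r"
  let ?inv = "inv_into U \<phi>"
  have inv: "?inv z \<in> U" "\<phi> (?inv z) = z" if "z \<in> ?K" for z
    using that r(4) by (auto simp: inv_into_into f_inv_into_f subset_eq)
  \<comment> \<open>The term \<open>b * r\<close> bounds the distance from \<open>p\<close> over the
    coordinate ball, and the summand 1 keeps \<open>R\<close> positive, as the growth bound
    requires.\<close>
  define R where "R = \<rho> p xs + b * r + 1"
  have R: "0 < R"
    using dist_nonneg[of p xs] r by (simp add: R_def add_nonneg_pos)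
  have dR: "\<rho> (?inv z) xs \<le> R" if z: "z \<in> ?K" for z
  proof -
    have pK: "\<phi> p \<in> ?K"
      using r(1) by simp
    have "\<rho> (?inv z) p \<le> b * norm (\<phi> p - \<phi> (?inv z))"
      using r(5) inv[OF z] c(2) pK z by (auto simp del: mem_cball)
    also have "\<dots> \<le> b * r"
      using z r(3) by (intro mult_left_mono) (simp_all add: inv(2)[OF z] dist_norm)
    finally show ?thesis
      using dist_triangle[of "?inv z" xs p] by (simp add: R_def)
  qed
  obtain C0 where C0: "AE t in lebesgue_on {0..}. norm (u t) \<le> C0" and um: "u \<in> borel_measurable (lebesgue_on {0..})"
    using u unfolding L_infinity_def by blast
  define C where "C = \<bar>C0\<bar> + 1"
  have C: "0 < C"
    by (simp add: C_def add_nonneg_pos)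
  obtain I where I: "\<forall>b\<ge>0. set_integrable lebesgue {0..b} I"
    and Ib: "AE t in lebesgue_on {0..}. \<forall>x\<in>D. \<forall>u. \<rho> x xs \<le> R \<and> norm u \<le> C \<longrightarrow> tnorm g x (f t x u) \<le> I t"
    by (rule assumption_A_bound[OF AA R C])
  have "AE t in lebesgue_on {0..}. norm (u t) \<le> C0 \<and> (\<forall>x\<in>D. \<forall>u. \<rho> x xs \<le> R \<and> norm u \<le> C \<longrightarrow> tnorm g x (f t x u) \<le> I t)"
    using C0 Ib by eventually_elim blast
  then have "AE t in lebesgue. t \<in> {0..} \<longrightarrow> norm (u t) \<le> C0 \<and> (\<forall>x\<in>D. \<forall>u. \<rho> x xs \<le> R \<and> norm u \<le> C \<longrightarrow> tnorm g x (f t x u) \<le> I t)"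
    by (subst (asm) AE_lebesgue_on_iff) auto
  then obtain N where N': "negligible N"
    and N0: "\<forall>t. t \<notin> N \<longrightarrow> t \<in> {0..} \<longrightarrow> norm (u t) \<le> C0 \<and> (\<forall>x\<in>D. \<forall>u. \<rho> x xs \<le> R \<and> norm u \<le> C \<longrightarrow> tnorm g x (f t x u) \<le> I t)"
    by (rule AE_lebesgueE)
  have bnd: "tnorm g x (f t x (u t)) \<le> I t" if "0 \<le> t" "t \<notin> N" "x \<in> D" "\<rho> x xs \<le> R" for t x
  proof -
    have "t \<in> {0..} \<longrightarrow> norm (u t) \<le> C0 \<and> (\<forall>x\<in>D. \<forall>u. \<rho> x xs \<le> R \<and> norm u \<le> C \<longrightarrow> tnorm g x (f t x u) \<le> I t)"
      using N0 that(2) by blast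
    then have "norm (u t) \<le> C0" "\<forall>x\<in>D. \<forall>u. \<rho> x xs \<le> R \<and> norm u \<le> C \<longrightarrow> tnorm g x (f t x u) \<le> I t"
      using that(1) by simp_all
    moreover from this(1) have "norm (u t) \<le> C"
      by (simp add: C_def)
    ultimately show ?thesis
      using that by blast
  qed
  \<comment> \<open>Projection onto the closed coordinate ball extends the field continuously to all
    of space without changing it on the ball.\<close>
  define cp where "cp = closest_point ?K"
  have K: "convex ?K" "closed ?K" "?K \<noteq> {}"
    using r(1) by auto
  have cpK: "cp z \<in> ?K" for z
    unfolding cp_def by (rule closest_point_in_set[OF K(2,3)])
  have cpcont: "continuous_on UNIV cp"
    unfolding cp_def by (rule continuous_on_closest_point[OF K])
  \<comment> \<open>Setting the field to zero on the null set turns the almost everywhere bound into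
    one valid at every time; dividing by \<open>a\<close> in \<open>m\<close> passes from the
    Riemannian norm to the coordinate norm.\<close>
  define F where "F t z = (if t \<in> N then 0 else f t (?inv (cp z)) (u t) (U, \<phi>))" for t z
  define m where "m t = \<bar>I t\<bar> / a" for t
  have at: "(U, \<phi>) \<in> charts_at A (?inv (cp z))" for z
    using c(1) inv(1)[OF cpK] by (simp add: charts_at_def)
  have invD: "?inv (cp z) \<in> D" for z
    using inv(1)[OF cpK] c(3) by blast
  note A1 = assumption_A_measurable[OF AA] and A2 = assumption_A_lipschitz[OF AA _ c(1,3)]
    and A3 = assumption_A_continuous[OF AA]
  have Fmeas: "(\<lambda>t. F t z) \<in> borel_measurable (lebesgue_on {T..T + 1})" for z
    unfolding F_def
  proof (rule caratheodory_chart_field_measurable[where f = f and x = "?inv (cp z)" and c = "(U, \<phi>)", OF _ _ um N' T])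
    show "(\<lambda>t. f t (?inv (cp z)) w (U, \<phi>)) \<in> borel_measurable (lebesgue_on {0..})" for w
      by (rule A1[OF invD at])
    show "continuous_on UNIV (\<lambda>w. f t (?inv (cp z)) w (U, \<phi>))" if "0 \<le> t" for t
      by (rule A3[OF that invD at])
  qed
  have Fcont: "continuous_on UNIV (F t)" if t: "t \<in> {T..T + 1}" for t
  proof (cases "t \<in> N")
    case True
    then show ?thesis
      by (simp add: F_def[abs_def])
  next
    case False
    have "continuous_on (\<phi> ` U) (\<lambda>z. f t (?inv z) (u t) (U, \<phi>))"
      by (rule local_lipschitz_continuous_on[OF A2]) (use t T in auto)
    then have "continuous_on UNIV (\<lambda>z. f t (?inv (cp z)) (u t) (U, \<phi>))"
      by (rule continuous_on_compose2[OF _ cpcont]) (use cpK r(4) in blast)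
    then show ?thesis
      using False by (simp add: F_def[abs_def])
  qed
  have Iint: "I absolutely_integrable_on {T..T + 1}"
    by (rule absolutely_integrable_on_subinterval[OF I[rule_format, of "T + 1"]]) (use T in auto)
  have mabs: "m absolutely_integrable_on {T..T + 1}"
    unfolding m_def by (intro set_integrable_divide set_integrable_abs Iint)
  have mint: "m integrable_on {T..T + 1}"
    by (rule set_lebesgue_integral_eq_integral(1)[OF mabs])
  have Fb: "norm (F t z) \<le> m t" if t: "t \<in> {T..T + 1}" for t z
  proof (cases "t \<in> N")
    case True
    then show ?thesis
      using r(2) by (simp add: F_def m_def)
  next
    case False
    have t0: "0 \<le> t"
      using t T by auto
    have "a * norm (F t z) \<le> sqrt (coord_form U \<phi> (cp z) (f t (?inv (cp z)) (u t) (U, \<phi>)))"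
      using r(6) cpK False by (simp add: F_def del: mem_cball)
    also have "\<dots> = tnorm g (?inv (cp z)) (f t (?inv (cp z)) (u t))"
      using tnorm_chart[OF c(1) tan[OF t0 invD] inv(1)[OF cpK], of z "u t"] by (simp add: inv(2)[OF cpK])
    also have "\<dots> \<le> I t"
      by (rule bnd[OF t0 False invD dR[OF cpK]])
    finally have "norm (F t z) * a \<le> \<bar>I t\<bar>"
      by (simp add: mult.commute)
    then show ?thesis
      using r(2) by (simp add: m_def field_simps)
  qed
  have T1: "T \<le> T + 1" by simp
  obtain z where z: "continuous_on {T..T + 1} z" "(\<lambda>s. F s (z s)) absolutely_integrable_on {T..T + 1}"
    and zeq: "\<forall>t\<in>{T..T + 1}. z t = \<phi> p + integral {T..t} (\<lambda>s. F s (z s))"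
  proof (rule caratheodory_existence[OF T1 Fmeas Fcont mint Fb])
    fix y assume "continuous_on {T..T + 1} y" "(\<lambda>s. F s (y s)) absolutely_integrable_on {T..T + 1}"
      "\<And>t. t \<in> {T..T + 1} \<Longrightarrow> y t = \<phi> p + integral {T..t} (\<lambda>s. F s (y s))"
    then show thesis
      by (intro that[of y] ballI)
  qed
  have Fint: "(\<lambda>s. F s (z s)) integrable_on {T..T + 1}"
    by (rule set_lebesgue_integral_eq_integral(1)[OF z(2)])
  have zT: "z T = \<phi> p"
    using zeq by simp
  have "(z \<longlongrightarrow> \<phi> p) (at T within {T..T + 1})"
    using z(1) zT unfolding continuous_on_def by force
  then have "\<forall>\<^sub>F t in at T within {T..T + 1}. z t \<in> ball (\<phi> p) r"
    by (rule topological_tendstoD) (use r(1) in auto)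
  then obtain d where d: "0 < d" "\<forall>t\<in>{T..T + 1}. t \<noteq> T \<and> dist t T < d \<longrightarrow> z t \<in> ball (\<phi> p) r"
    unfolding eventually_at by blast
  \<comment> \<open>Half of \<open>d\<close> keeps the closed interval up to \<open>T + h\<close>
    strictly within the range where \<open>z\<close> stays in the ball.\<close>
  define h where "h = min 1 (d / 2)"
  have h: "0 < h" "h \<le> 1"
    using d(1) by (auto simp: h_def)
  have zK: "z t \<in> ?K" if t: "t \<in> {T..T + h}" for t
  proof (cases "t = T")
    case True
    then show ?thesis
      using zT r(1) by simp
  next
    case False
    have "z t \<in> ball (\<phi> p) r"
      using t False d h by (intro d(2)[rule_format]) (auto simp: dist_real_def h_def)
    then show ?thesis
      using ball_subset_cball by blast
  qed
  have cpz: "cp (z t) = z t" if "t \<in> {T..T + h}" for t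
    unfolding cp_def by (rule closest_point_self[OF zK[OF that]])
  define y where "y t = ?inv (z t)" for t
  have \<phi>y: "\<phi> (y t) = z t" "y t \<in> U" if "t \<in> {T..T + h}" for t
    using inv[OF zK[OF that]] by (simp_all add: y_def)
  have sub: "q integrable_on {s..t}" if "q integrable_on {T..T + 1}" "T \<le> s" "t \<le> T + 1"
    for q :: "real \<Rightarrow> 'x::euclidean_space" and s t
    using integrable_subinterval_real[OF that(1)] that by auto
  have zdiff: "norm (z t - z s) \<le> integral {s..t} m" if st: "T \<le> s" "s \<le> t" "t \<le> T + 1" for s t
  proof -
    have "z t - z s = integral {s..t} (\<lambda>s. F s (z s))"
      using Henstock_Kurzweil_Integration.integral_combine[OF st(1,2) sub[OF Fint order_refl st(3)]] zeq st by (simp add: algebra_simps)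
    also have "norm \<dots> \<le> integral {s..t} m"
      by (rule integral_norm_bound_integral) (use st Fb sub[OF Fint st(1,3)] sub[OF mint st(1,3)] in auto)
    finally show ?thesis .
  qed
  have "abs_continuous A g T (T + h) y"
  proof (rule abs_continuousI)
    show "(\<lambda>t. b * m t) absolutely_integrable_on {T..T + h}"
      by (intro set_integrable_mult_right absolutely_integrable_on_subinterval[OF mabs]) (use h in auto)
    fix s t assume st: "T \<le> s" "s \<le> t" "t \<le> T + h"
    have s': "s \<in> {T..T + h}" and t': "t \<in> {T..T + h}"
      using st by auto
    have "\<rho> (y s) (y t) \<le> b * norm (\<phi> (y t) - \<phi> (y s))"
      using r(5)[rule_format, of "y s" "y t"] \<phi>y[OF s'] \<phi>y[OF t'] zK[OF s'] zK[OF t'] by (simp del: mem_cball)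
    also have "\<dots> \<le> b * integral {s..t} m"
      using zdiff[of s t] st h r(3) by (intro mult_left_mono) (auto simp: \<phi>y[OF s'] \<phi>y[OF t'])
    finally show "\<rho> (y s) (y t) \<le> integral {s..t} (\<lambda>t. b * m t)"
      by simp
  qed
  moreover have "y ` {T..T + h} \<subseteq> D"
    using \<phi>y(2) c(3) by blast
  moreover have "y T = p"
    using chart_inverse[OF c(1,2)] by (simp add: y_def zT)
  moreover have "AE t in lebesgue. T < t \<and> t < T + h \<longrightarrow> has_velocity A y t (f t (y t) (u t))"
  proof -
    \<comment> \<open>Lebesgue differentiation recovers the differential equation from the integral
      equation off this null set.\<close>
    let ?E = "{t \<in> {T<..<T + 1}. \<not> ((\<lambda>t. integral {T..t} (\<lambda>s. F s (z s))) has_vector_derivative F t (z t)) (at t)}"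
    have "?E \<in> null_sets lebesgue"
      using integral_has_vector_derivative_AE[OF Fint] by (simp add: negligible_iff_null_sets)
    then have "AE t in lebesgue. t \<notin> ?E"
      by (rule AE_not_in)
    moreover have "AE t in lebesgue. t \<notin> N"
      using N' unfolding negligible_iff_null_sets by (rule AE_not_in)
    ultimately show ?thesis
    proof eventually_elim
      fix t assume tE: "t \<notin> ?E" and tN: "t \<notin> N"
      show "T < t \<and> t < T + h \<longrightarrow> has_velocity A y t (f t (y t) (u t))"
      proof
        assume t: "T < t \<and> t < T + h"
        then have t': "t \<in> {T..T + h}" and t'': "t \<in> {T<..<T + h}"
          by auto
        have "((\<lambda>t. integral {T..t} (\<lambda>s. F s (z s))) has_vector_derivative F t (z t)) (at t)"
          using tE t h by auto
        then have "((\<lambda>t. \<phi> p + integral {T..t} (\<lambda>s. F s (z s))) has_vector_derivative 0 + F t (z t)) (at t)"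
          by (intro has_vector_derivative_add has_vector_derivative_const)
        then have "((\<phi> \<circ> y) has_vector_derivative 0 + F t (z t)) (at t)"
          by (rule has_vector_derivative_transform_within_open[where S = "{T<..<T + h}"])
            (use t'' h zeq \<phi>y(1) in auto)
        then have "((\<phi> \<circ> y) has_vector_derivative f t (y t) (u t) (U, \<phi>)) (at t)"
          using tN by (simp add: F_def cpz[OF t'] y_def)
        from has_velocityI[where p = y and t = t, OF c(1) \<phi>y(2)[OF t'] this]
        have "has_velocity A y t (coord_vector A (U, \<phi>) (y t) (f t (y t) (u t) (U, \<phi>)))" .
        moreover have "coord_vector A (U, \<phi>) (y t) (f t (y t) (u t) (U, \<phi>)) = f t (y t) (u t)"
        proof (rule coord_vector_eqI)
          show "(U, \<phi>) \<in> charts_at A (y t)"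
            using c(1) \<phi>y(2)[OF t'] by (simp add: charts_at_def)
          show "f t (y t) (u t) \<in> tangent_space A (y t)"
            using tan[of t "y t"] t T \<phi>y(2)[OF t'] c(3) by auto
        qed simp
        ultimately show "has_velocity A y t (f t (y t) (u t))"
          by simp
      qed
    qed
  qed
  ultimately show ?thesis
    using h(1) by (intro that[of h y])
qed

text \<open>Increments are bounded by those of a function continuous up to \<open>T\<close>, so the
  curve is Cauchy there. The bound by the integral up to \<open>T\<close> survives in the limit,
  which is what keeps the later gluing absolutely continuous.\<close>

lemma complete_limit:
  fixes J :: "real \<Rightarrow> real"
  assumes complete: "M.mcomplete" and T: "t0 < T" and J: "J integrable_on {t0..T}"
    and le: "\<And>s t. t0 \<le> s \<Longrightarrow> s \<le> t \<Longrightarrow> t < T \<Longrightarrow> \<rho> (x s) (x t) \<le> integral {s..t} J"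
  obtains p where "\<forall>s. t0 \<le> s \<and> s < T \<longrightarrow> \<rho> (x s) p \<le> integral {s..T} J"
proof -
  define G where "G t = integral {t0..t} J" for t
  have Gcont: "continuous_on {t0..T} G"
    unfolding G_def by (rule indefinite_integral_continuous_1[OF J])
  have comb: "integral {s..t} J = G t - G s" if "t0 \<le> s" "s \<le> t" "t \<le> T" for s t
  proof -
    have "J integrable_on {t0..t}"
      using integrable_subinterval_real[OF J] that by auto
    from Henstock_Kurzweil_Integration.integral_combine[OF that(1,2) this] show ?thesis
      by (simp add: G_def)
  qed
  have le': "\<rho> (x s) (x t) \<le> \<bar>G t - G s\<bar>" if "t0 \<le> s" "s < T" "t0 \<le> t" "t < T" for s t
    using le[of s t] le[of t s] comb[of s t] comb[of t s] that dist_sym[of "x s" "x t"] by (cases "s \<le> t") auto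
  \<comment> \<open>A sequence in the half-open interval that starts at \<open>t0\<close> and
    converges to \<open>T\<close>.\<close>
  define \<tau> where "\<tau> n = T - (T - t0) / real (Suc n)" for n
  have \<tau>: "t0 \<le> \<tau> n" "\<tau> n < T" for n
  proof -
    have "(T - t0) / real (Suc n) \<le> (T - t0) / 1"
      using T by (intro divide_left_mono) auto
    then show "t0 \<le> \<tau> n" "\<tau> n < T"
      using T by (simp_all add: \<tau>_def)
  qed
  have "(\<lambda>n. (T - t0) / real (Suc n)) \<longlonglongrightarrow> 0"
    by (rule LIMSEQ_Suc[OF lim_const_over_n])
  then have "\<tau> \<longlonglongrightarrow> T - 0"
    unfolding \<tau>_def by (intro tendsto_intros)
  then have \<tau>lim: "\<tau> \<longlonglongrightarrow> T"
    by simp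
  have Glim: "(\<lambda>n. G (\<tau> n)) \<longlonglongrightarrow> G T"
    by (rule continuous_on_tendsto_compose[OF Gcont \<tau>lim]) (use T \<tau> in \<open>auto intro!: always_eventually less_imp_le\<close>)
  have "M.MCauchy (\<lambda>n. x (\<tau> n))"
    unfolding M.MCauchy_def
  proof (intro conjI allI impI)
    fix e :: real assume e: "0 < e"
    obtain n0 where n0: "\<And>n n'. n0 \<le> n \<Longrightarrow> n0 \<le> n' \<Longrightarrow> dist (G (\<tau> n)) (G (\<tau> n')) < e"
      using metric_CauchyD[OF LIMSEQ_imp_Cauchy[OF Glim] e] by blast
    have "\<rho> (x (\<tau> n)) (x (\<tau> n')) < e" if "n0 \<le> n" "n0 \<le> n'" for n n'
      using le'[OF \<tau> \<tau>, of n n'] n0[OF that] by (simp add: dist_real_def abs_minus_commute)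
    then show "\<exists>N. \<forall>n n'. N \<le> n \<longrightarrow> N \<le> n' \<longrightarrow> \<rho> (x (\<tau> n)) (x (\<tau> n')) < e"
      by blast
  qed simp
  then obtain p where "limitin M.mtopology (\<lambda>n. x (\<tau> n)) p sequentially"
    using complete unfolding M.mcomplete_def by blast
  then have lim: "\<forall>e>0. \<exists>n0. \<forall>n\<ge>n0. \<rho> (x (\<tau> n)) p < e"
    unfolding M.limit_metric_sequentially by auto
  then have lim0: "(\<lambda>n. \<rho> (x (\<tau> n)) p) \<longlonglongrightarrow> 0"
    unfolding LIMSEQ_iff using dist_nonneg by simp
  have "\<rho> (x s) p \<le> integral {s..T} J" if s: "t0 \<le> s" "s < T" for s
  proof (rule LIMSEQ_le_const)
    have "(\<lambda>n. (G (\<tau> n) - G s) + \<rho> (x (\<tau> n)) p) \<longlonglongrightarrow> (G T - G s) + 0"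
      by (intro tendsto_intros Glim lim0)
    then show "(\<lambda>n. (G (\<tau> n) - G s) + \<rho> (x (\<tau> n)) p) \<longlonglongrightarrow> integral {s..T} J"
      using comb[of s T] s by simp
    have "\<forall>\<^sub>F n in sequentially. s < \<tau> n"
      by (rule order_tendstoD(1)[OF \<tau>lim s(2)])
    then obtain n0 where n0: "\<forall>n\<ge>n0. s < \<tau> n"
      unfolding eventually_sequentially by blast
    show "\<exists>N. \<forall>n\<ge>N. \<rho> (x s) p \<le> (G (\<tau> n) - G s) + \<rho> (x (\<tau> n)) p"
    proof (intro exI[of _ n0] allI impI)
      fix n assume "n0 \<le> n"
      then have sle: "s \<le> \<tau> n"
        using n0 by auto
      then have "\<rho> (x s) (x (\<tau> n)) \<le> G (\<tau> n) - G s"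
        using le[OF s(1) sle \<tau>(2)] comb[OF s(1) sle] \<tau>(2)[of n] by simp
      then show "\<rho> (x s) p \<le> (G (\<tau> n) - G s) + \<rho> (x (\<tau> n)) p"
        using dist_triangle[of "x s" p "x (\<tau> n)"] by linarith
    qed
  qed
  then show ?thesis
    by (intro that[of p]) blast
qed

text \<open>The growth bound on the ball makes the curve converge at \<open>T\<close>. The closed
  condition on the radius passes to the limit and places it in \<open>D\<close>, from where a local
  solution starts.\<close>

theorem bounded_solution_extends:
  fixes f :: "real \<Rightarrow> 'a \<Rightarrow> 'u::euclidean_space \<Rightarrow> ('a, 'e) tangent"
  assumes D: "open D" and tan: "\<And>t x w. 0 \<le> t \<Longrightarrow> x \<in> D \<Longrightarrow> f t x w \<in> tangent_space A x"
    and AA: "assumption_A A g D f xs" and u: "L_infinity u" and complete: "M.mcomplete"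
    and sol: "is_solution A g D f u t0 (ereal T) x" and t0: "0 \<le> t0"
    and bounded: "\<And>t. t0 \<le> t \<Longrightarrow> t < T \<Longrightarrow> \<rho> (x t) xs \<le> R"
    and ball: "\<And>p. \<rho> p xs \<le> R \<Longrightarrow> p \<in> D"
  obtains T' x' where "ereal T < T'" "is_solution A g D f u t0 T' x'" "\<forall>t. t0 \<le> t \<and> ereal t < ereal T \<longrightarrow> x' t = x t"
proof -
  have t0T: "t0 < T" and xD: "\<And>t. t0 \<le> t \<Longrightarrow> t < T \<Longrightarrow> x t \<in> D"
    and xac: "\<And>a b. t0 \<le> a \<Longrightarrow> a \<le> b \<Longrightarrow> b < T \<Longrightarrow> abs_continuous A g a b x"
    and xvel: "AE t in lebesgue. t0 < t \<and> ereal t < ereal T \<longrightarrow> has_velocity A x t (f t (x t) (u t))"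
    using sol unfolding is_solution_def by auto
  \<comment> \<open>The growth bound of Assumption (A) is available only for positive radii, while
    \<open>R\<close> is arbitrary here.\<close>
  define R' where "R' = \<bar>R\<bar> + 1"
  have R': "0 < R'" "R \<le> R'"
    by (auto simp: R'_def)
  obtain C0 where C0: "AE t in lebesgue_on {0..}. norm (u t) \<le> C0"
    using u unfolding L_infinity_def by blast
  define C where "C = \<bar>C0\<bar> + 1"
  have C: "0 < C" "C0 \<le> C"
    by (auto simp: C_def)
  obtain I where I: "\<forall>b\<ge>0. set_integrable lebesgue {0..b} I"
    and Ib: "AE t in lebesgue_on {0..}. \<forall>x\<in>D. \<forall>u. \<rho> x xs \<le> R' \<and> norm u \<le> C \<longrightarrow> tnorm g x (f t x u) \<le> I t"
    by (rule assumption_A_bound[OF AA R'(1) C(1)])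
  have C0': "AE t in lebesgue. t \<in> {0..} \<longrightarrow> norm (u t) \<le> C0"
    using C0 by (subst (asm) AE_lebesgue_on_iff) auto
  have Ib': "AE t in lebesgue. t \<in> {0..} \<longrightarrow> (\<forall>x\<in>D. \<forall>u. \<rho> x xs \<le> R' \<and> norm u \<le> C \<longrightarrow> tnorm g x (f t x u) \<le> I t)"
    using Ib by (subst (asm) AE_lebesgue_on_iff) auto
  have "AE t in lebesgue. t0 < t \<and> t < T \<longrightarrow> has_velocity A x t (f t (x t) (u t)) \<and> tnorm g (x t) (f t (x t) (u t)) \<le> \<bar>I t\<bar>"
    using C0' Ib' xvel
  proof eventually_elim
    fix t assume 1: "t \<in> {0..} \<longrightarrow> norm (u t) \<le> C0"
      and 2: "t \<in> {0..} \<longrightarrow> (\<forall>x\<in>D. \<forall>u. \<rho> x xs \<le> R' \<and> norm u \<le> C \<longrightarrow> tnorm g x (f t x u) \<le> I t)"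
      and 3: "t0 < t \<and> ereal t < ereal T \<longrightarrow> has_velocity A x t (f t (x t) (u t))"
    show "t0 < t \<and> t < T \<longrightarrow> has_velocity A x t (f t (x t) (u t)) \<and> tnorm g (x t) (f t (x t) (u t)) \<le> \<bar>I t\<bar>"
    proof
      assume t: "t0 < t \<and> t < T"
      have "t \<in> {0..}" "x t \<in> D" "\<rho> (x t) xs \<le> R'"
        using t t0 xD[of t] bounded[of t] R' by auto
      moreover have "norm (u t) \<le> C"
        using 1 \<open>t \<in> {0..}\<close> C by simp
      ultimately have "tnorm g (x t) (f t (x t) (u t)) \<le> I t"
        using 2 by blast
      then show "has_velocity A x t (f t (x t) (u t)) \<and> tnorm g (x t) (f t (x t) (u t)) \<le> \<bar>I t\<bar>"
        using 3 t by simp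
    qed
  qed
  then obtain N where N: "negligible N"
    and N0: "\<forall>t. t \<notin> N \<longrightarrow> t0 < t \<and> t < T \<longrightarrow> has_velocity A x t (f t (x t) (u t)) \<and> tnorm g (x t) (f t (x t) (u t)) \<le> \<bar>I t\<bar>"
    by (rule AE_lebesgueE)
  \<comment> \<open>The factor 2 is the one lost in comparing distance and speed.\<close>
  define J where "J t = 2 * \<bar>I t\<bar>" for t
  have Iabs: "(\<lambda>t. \<bar>I t\<bar>) absolutely_integrable_on {a..b}" if "0 \<le> a" "0 \<le> b" for a b
    by (intro set_integrable_abs absolutely_integrable_on_subinterval[OF I[rule_format, OF that(2)]]) (use that in auto)
  have Jabs: "J absolutely_integrable_on {a..b}" if "0 \<le> a" "0 \<le> b" for a b
    unfolding J_def by (intro set_integrable_mult_right Iabs that)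
  have Jint: "J integrable_on {a..b}" if "0 \<le> a" "0 \<le> b" for a b
    by (rule set_lebesgue_integral_eq_integral(1)[OF Jabs[OF that]])
  have xJ: "\<rho> (x s) (x t) \<le> integral {s..t} J" if st: "t0 \<le> s" "s \<le> t" "t < T" for s t
    unfolding J_def
  proof (rule dist_le_integral_speed[OF st(2) xac[OF st] _ N])
    show "(\<lambda>t. \<bar>I t\<bar>) integrable_on {s..t}"
      by (rule set_lebesgue_integral_eq_integral(1)[OF Iabs]) (use st t0 in auto)
    fix r assume r: "r \<in> {s<..<t} - N"
    then have "t0 < r \<and> r < T \<longrightarrow> has_velocity A x r (f r (x r) (u r)) \<and> tnorm g (x r) (f r (x r) (u r)) \<le> \<bar>I r\<bar>"
      using N0 by blast
    then show "has_velocity A x r (f r (x r) (u r)) \<and> tnorm g (x r) (f r (x r) (u r)) \<le> \<bar>I r\<bar>"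
      using r st by simp
  qed
  have T0: "0 \<le> T"
    using t0 t0T by simp
  obtain p where p: "\<forall>s. t0 \<le> s \<and> s < T \<longrightarrow> \<rho> (x s) p \<le> integral {s..T} J"
    by (rule complete_limit[OF complete t0T Jint[OF t0 T0] xJ])
  have pR: "\<rho> p xs \<le> R"
  proof (rule field_le_epsilon)
    fix e :: real assume e: "0 < e"
    have "continuous_on {t0..T} (\<lambda>t. integral {t0..t} J)"
      by (rule indefinite_integral_continuous_1[OF Jint[OF t0 T0]])
    then have "((\<lambda>t. integral {t0..t} J) \<longlongrightarrow> integral {t0..T} J) (at T within {t0..T})"
      using t0T by (simp add: continuous_on_def)
    then have "\<forall>\<^sub>F t in at T within {t0..T}. integral {t0..T} J - e < integral {t0..t} J"
      by (rule order_tendstoD(1)) (use e in simp)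
    then obtain d where d: "0 < d" "\<forall>t\<in>{t0..T}. t \<noteq> T \<and> dist t T < d \<longrightarrow> integral {t0..T} J - e < integral {t0..t} J"
      unfolding eventually_at by blast
    define s where "s = max t0 (T - d / 2)"
    have s: "t0 \<le> s" "s < T" "dist s T < d"
      using d(1) t0T by (auto simp: s_def dist_real_def abs_if)
    have "integral {t0..s} J + integral {s..T} J = integral {t0..T} J"
      by (rule Henstock_Kurzweil_Integration.integral_combine[OF s(1) less_imp_le[OF s(2)] Jint[OF t0 T0]])
    moreover have "integral {t0..T} J - e < integral {t0..s} J"
      using d(2) s by auto
    ultimately have "\<rho> (x s) p \<le> e"
      using p s by force
    then show "\<rho> p xs \<le> R + e"
      using dist_triangle[of p xs "x s"] dist_sym[of p "x s"] bounded[OF s(1,2)] by linarith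
  qed
  have pD: "p \<in> D"
    by (rule ball[OF pR])
  obtain h y where h: "0 < h" and y: "y T = p" "y ` {T..T + h} \<subseteq> D" "abs_continuous A g T (T + h) y"
    and yvel: "AE t in lebesgue. T < t \<and> t < T + h \<longrightarrow> has_velocity A y t (f t (y t) (u t))"
    by (rule local_solution[OF D tan AA u pD T0])
  obtain k where k: "k absolutely_integrable_on {T..T + h}"
    "\<forall>s t. T \<le> s \<and> s \<le> t \<and> t \<le> T + h \<longrightarrow> \<rho> (y s) (y t) \<le> integral {s..t} k"
    by (rule abs_continuous_integral[OF y(3)])
  define x' where "x' t = (if t < T then x t else y t)" for t
  have x'T: "\<rho> (x s) (y T) \<le> integral {s..T} J" if "t0 \<le> s" "s < T" for s
    using p that y(1) by simp
  have ac: "abs_continuous A g a b x'" if ab: "t0 \<le> a" "a \<le> b" "b < T + h" for a b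
  proof (cases "b < T")
    case True
    have "abs_continuous A g a b x"
      by (rule xac[OF ab(1,2) True])
    then show ?thesis
      using True unfolding abs_continuous_def x'_def by auto
  next
    case bT: False
    show ?thesis
    proof (cases "T \<le> a")
      case True
      have "k absolutely_integrable_on {a..b}"
        by (rule absolutely_integrable_on_subinterval[OF k(1)]) (use True ab in auto)
      then show ?thesis
      proof (rule abs_continuousI)
        fix s t assume "a \<le> s" "s \<le> t" "t \<le> b"
        then show "\<rho> (x' s) (x' t) \<le> integral {s..t} k"
          using k(2) True ab by (simp add: x'_def)
      qed
    next
      case aT: False
      \<comment> \<open>The majorant of the old solution before \<open>T\<close> and that of the new
        one after it. Both contribute at the single time \<open>T\<close>, which integrals
        ignore.\<close>
      define K where "K t = (if t \<in> {..T} then J t else 0) + (if t \<in> {T..} then k t else 0)" for t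
      have ab0: "0 \<le> a" "0 \<le> b"
        using ab t0 by auto
      have K1: "(\<lambda>t. if t \<in> {..T} then J t else 0) absolutely_integrable_on {a..b}"
      proof -
        have eq: "(\<lambda>t. indicator {a..b} t *\<^sub>R (if t \<in> {..T} then J t else 0)) = (\<lambda>t. indicator {a..T} t *\<^sub>R J t)"
          by (rule ext) (use aT bT in \<open>auto simp: indicator_def\<close>)
        show ?thesis
          using Jabs[OF ab0(1) T0] unfolding set_integrable_def eq .
      qed
      have K2: "(\<lambda>t. if t \<in> {T..} then k t else 0) absolutely_integrable_on {a..b}"
      proof -
        have eq: "(\<lambda>t. indicator {a..b} t *\<^sub>R (if t \<in> {T..} then k t else 0)) = (\<lambda>t. indicator {T..b} t *\<^sub>R k t)"
          by (rule ext) (use aT bT in \<open>auto simp: indicator_def\<close>)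
        have "k absolutely_integrable_on {T..b}"
          by (rule absolutely_integrable_on_subinterval[OF k(1)]) (use ab in auto)
        then show ?thesis
          unfolding set_integrable_def eq .
      qed
      have Kabs: "K absolutely_integrable_on {a..b}"
        unfolding K_def by (rule set_integral_add(1)[OF K1 K2])
      have KJ: "integral {s..t} K = integral {s..t} J" if "t \<le> T" for s t
        by (rule integral_spike[of "{T}"]) (use that in \<open>auto simp: K_def\<close>)
      have Kk: "integral {s..t} K = integral {s..t} k" if "T \<le> s" for s t
        by (rule integral_spike[of "{T}"]) (use that in \<open>auto simp: K_def\<close>)
      show ?thesis
      proof (rule abs_continuousI[OF Kabs])
        fix s t assume st: "a \<le> s" "s \<le> t" "t \<le> b"
        consider "t < T" | "T \<le> s" | "s < T" "T \<le> t" by linarith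
        then show "\<rho> (x' s) (x' t) \<le> integral {s..t} K"
        proof cases
          case 1
          then show ?thesis
            using xJ[of s t] st ab KJ[of t s] by (simp add: x'_def)
        next
          case 2
          then show ?thesis
            using k(2) st ab Kk[of s t] by (simp add: x'_def)
        next
          case 3
          have "K integrable_on {s..t}"
            by (rule integrable_subinterval_real[OF set_lebesgue_integral_eq_integral(1)[OF Kabs]]) (use st in auto)
          then have "integral {s..T} K + integral {T..t} K = integral {s..t} K"
            by (intro Henstock_Kurzweil_Integration.integral_combine) (use 3 in auto)
          moreover have "\<rho> (x s) (y T) \<le> integral {s..T} J" "\<rho> (y T) (y t) \<le> integral {T..t} k"
            using x'T[of s] k(2) st ab 3 by auto
          moreover have "\<rho> (x s) (y t) \<le> \<rho> (x s) (y T) + \<rho> (y T) (y t)"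
            by (rule dist_triangle)
          ultimately show ?thesis
            using KJ[of T s] Kk[of T t] 3 by (simp add: x'_def)
        qed
      qed
    qed
  qed
  \<comment> \<open>At the gluing time the two pieces need not have a common velocity; one time is
    negligible.\<close>
  have "AE t in lebesgue. t \<notin> {T}"
    by (rule AE_not_in) (simp flip: negligible_iff_null_sets)
  with xvel yvel have vel: "AE t in lebesgue. t0 < t \<and> ereal t < ereal (T + h) \<longrightarrow> has_velocity A x' t (f t (x' t) (u t))"
  proof eventually_elim
    fix t assume 1: "t0 < t \<and> ereal t < ereal T \<longrightarrow> has_velocity A x t (f t (x t) (u t))"
      and 2: "T < t \<and> t < T + h \<longrightarrow> has_velocity A y t (f t (y t) (u t))" and 3: "t \<notin> {T}"
    show "t0 < t \<and> ereal t < ereal (T + h) \<longrightarrow> has_velocity A x' t (f t (x' t) (u t))"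
    proof
      assume t: "t0 < t \<and> ereal t < ereal (T + h)"
      show "has_velocity A x' t (f t (x' t) (u t))"
      proof (cases "t < T")
        case True
        then have "has_velocity A x t (f t (x t) (u t))"
          using 1 t by simp
        then have "has_velocity A x' t (f t (x t) (u t))"
          by (rule has_velocity_cong[where S = "{..<T}"]) (use True in \<open>auto simp: x'_def\<close>)
        then show ?thesis
          using True by (simp add: x'_def)
      next
        case False
        then have "has_velocity A y t (f t (y t) (u t))"
          using 2 3 t by simp
        then have "has_velocity A x' t (f t (y t) (u t))"
          by (rule has_velocity_cong[where S = "{T<..}"]) (use False 3 in \<open>auto simp: x'_def\<close>)
        then show ?thesis
          using False by (simp add: x'_def)
      qed
    qed
  qed
  have "is_solution A g D f u t0 (ereal (T + h)) x'"
    unfolding is_solution_def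
  proof (intro conjI allI impI vel)
    show "ereal t0 < ereal (T + h)"
      using t0T h by simp
    fix t assume t: "t0 \<le> t \<and> ereal t < ereal (T + h)"
    show "x' t \<in> D"
    proof (cases "t < T")
      case True
      then show ?thesis
        using xD t by (simp add: x'_def)
    next
      case False
      then have "y t \<in> y ` {T..T + h}"
        using t by (intro imageI) simp
      then show ?thesis
        using y(2) False by (auto simp: x'_def)
    qed
  next
    fix a b assume "t0 \<le> a \<and> a \<le> b \<and> ereal b < ereal (T + h)"
    then show "abs_continuous A g a b x'"
      by (intro ac) auto
  qed
  then show ?thesis
    using h by (intro that[of "ereal (T + h)" x']) (auto simp: x'_def)
qed

end

subsection \<open>Trajectories and the Lyapunov function\<close>

text \<open>\<open>real_of_ereal\<close> sends infinite values to 0, so the essential supremum must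
  be shown finite: it is bounded above since \<open>u\<close> is essentially bounded, and
  nonnegative since the half line has positive measure.\<close>

lemma Linf_norm_bound:
  fixes u :: "real \<Rightarrow> 'u::euclidean_space"
  assumes u: "L_infinity u" and t0: "0 \<le> t0"
  shows "0 \<le> Linf_norm t0 u" "AE t in lebesgue. t0 \<le> t \<longrightarrow> norm (u t) \<le> Linf_norm t0 u"
proof -
  let ?M = "lebesgue_on {t0..}"
  define E where "E = esssup ?M (\<lambda>t. ereal (norm (u t)))"
  obtain C where C: "AE t in lebesgue_on {0..}. norm (u t) \<le> C" and um: "u \<in> borel_measurable (lebesgue_on {0..})"
    using u unfolding L_infinity_def by blast
  have um': "u \<in> borel_measurable ?M"
    by (rule measurable_restrict_mono[OF um]) (use t0 in auto)
  have nm: "(\<lambda>t. ereal (norm (u t))) \<in> borel_measurable ?M"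
    using um' by measurable
  have "AE t in lebesgue. t \<in> {0..} \<longrightarrow> norm (u t) \<le> C"
    using C by (subst (asm) AE_lebesgue_on_iff) auto
  then have "AE t in lebesgue. t \<in> {t0..} \<longrightarrow> ereal (norm (u t)) \<le> ereal C"
    by eventually_elim (use t0 in auto)
  then have "AE t in ?M. ereal (norm (u t)) \<le> ereal C"
    by (subst AE_lebesgue_on_iff) auto
  then have up: "E \<le> ereal C"
    unfolding E_def by (rule esssup_I[OF nm])
  have "emeasure ?M (space ?M) = emeasure lebesgue {t0..}"
    by (simp add: emeasure_restrict_space)
  moreover have "emeasure lebesgue {t0..t0 + 1} \<le> emeasure lebesgue {t0..}"
    by (rule emeasure_mono) auto
  ultimately have "emeasure ?M (space ?M) \<noteq> 0"
    by auto
  then have "0 = esssup ?M (\<lambda>t. 0 :: ereal)"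
    by (rule esssup_const[symmetric])
  also have "\<dots> \<le> E"
    unfolding E_def by (rule esssup_mono) auto
  finally have lo: "0 \<le> E" .
  have E: "E = ereal (Linf_norm t0 u)"
    using up lo unfolding Linf_norm_def E_def[symmetric] by (cases E) auto
  show "0 \<le> Linf_norm t0 u"
    using lo unfolding E by simp
  have "AE t in ?M. ereal (norm (u t)) \<le> E"
    unfolding E_def by (rule esssup_AE)
  then have "AE t in lebesgue. t \<in> {t0..} \<longrightarrow> ereal (norm (u t)) \<le> E"
    by (subst (asm) AE_lebesgue_on_iff) auto
  then show "AE t in lebesgue. t0 \<le> t \<longrightarrow> norm (u t) \<le> Linf_norm t0 u"
    unfolding E by eventually_elim auto
qed

context riemannian
begin

lemma continuous_on_time_space:
  assumes V: "C1_time_space A B V" and B: "open B" and a: "0 \<le> a" and cont: "continuous_on {a..b} x"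
    and xB: "\<And>t. t \<in> {a..b} \<Longrightarrow> x t \<in> B"
  shows "continuous_on {a..b} (\<lambda>t. V t (x t))"
  unfolding continuous_on_def
proof
  fix t assume t: "t \<in> {a..b}"
  have lim: "(x \<longlongrightarrow> x t) (at t within {a..b})"
    using cont t by (simp add: continuous_on_def)
  have t0: "0 \<le> t"
    using t a by simp
  obtain d C where d: "0 < d" and lip: "\<forall>s\<in>{a..b}. \<forall>s'\<in>{a..b}. 0 \<le> s \<and> 0 \<le> s' \<and> \<bar>s - t\<bar> < d \<and> \<bar>s' - t\<bar> < d \<longrightarrow>
      \<bar>V s (x s) - V s' (x s')\<bar> \<le> C * (\<bar>s - s'\<bar> + \<rho> (x s) (x s'))"
    using time_space_local_lipschitz[where t = t and x = x, OF V B t0 xB[OF t] lim] by blast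
  have "((\<lambda>s. \<rho> (x t) (x s)) \<longlongrightarrow> \<rho> (x t) (x t)) (at t within {a..b})"
    by (rule dist_continuous[OF lim])
  moreover have "((\<lambda>s. \<bar>s - t\<bar>) \<longlongrightarrow> \<bar>t - t\<bar>) (at t within {a..b})"
    by (intro tendsto_intros)
  ultimately have "((\<lambda>s. C * (\<bar>s - t\<bar> + \<rho> (x t) (x s))) \<longlongrightarrow> C * (\<bar>t - t\<bar> + \<rho> (x t) (x t))) (at t within {a..b})"
    by (intro tendsto_intros)
  then have lim0: "((\<lambda>s. C * (\<bar>s - t\<bar> + \<rho> (x t) (x s))) \<longlongrightarrow> 0) (at t within {a..b})"
    by (simp add: dist_self)
  have "\<forall>\<^sub>F s in at t within {a..b}. norm (V s (x s) - V t (x t)) \<le> C * (\<bar>s - t\<bar> + \<rho> (x t) (x s))"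
    unfolding eventually_at
  proof (intro exI[of _ d] conjI ballI impI d)
    fix s assume s: "s \<in> {a..b}" "s \<noteq> t \<and> dist s t < d"
    then show "norm (V s (x s) - V t (x t)) \<le> C * (\<bar>s - t\<bar> + \<rho> (x t) (x s))"
      using lip[rule_format, of s t] t a d dist_sym[of "x s" "x t"] by (simp add: dist_real_def)
  qed
  from Lim_null_comparison[OF this lim0] show "((\<lambda>t. V t (x t)) \<longlongrightarrow> V t (x t)) (at t within {a..b})"
    by (rule LIM_zero_cancel)
qed

lemma open_rball: "open (rball A g y r)"
  unfolding open_subopen[of "rball A g y r"]
proof
  fix z assume z: "z \<in> rball A g y r"
  then have "\<rho> y z \<in> dom0 r"
    by (simp add: rball_def dom0_def dist_nonneg)
  then obtain s where s: "s \<in> dom0 r" "\<rho> y z < s"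
    by (rule dom0_greater)
  have e: "0 < s - \<rho> y z"
    using s(2) by simp
  obtain W where W: "open W" "z \<in> W" "\<forall>w\<in>W. \<rho> z w < s - \<rho> y z"
    by (rule open_subset_dist_ball[OF e])
  have "W \<subseteq> rball A g y r"
  proof
    fix w assume "w \<in> W"
    then have "\<rho> y w < s"
      using W(3) dist_triangle[of y w z] by force
    then have "ereal (\<rho> y w) < ereal s"
      by simp
    also have "ereal s < r"
      using s(1) by (simp add: dom0_def)
    finally show "w \<in> rball A g y r"
      by (simp add: rball_def)
  qed
  then show "\<exists>T. open T \<and> z \<in> T \<and> T \<subseteq> rball A g y r"
    using W by blast
qed

lemma in_rball_iff: "y \<in> rball A g x r \<longleftrightarrow> \<rho> y x \<in> dom0 r"
  using dist_sym[of y x] by (simp add: rball_def dom0_def dist_nonneg)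

end

locale ISS_system = riemannian A g + ISS_comparison r0 \<delta> \<alpha>1 \<alpha>2 \<alpha>3 \<alpha>4
  for A :: "('a::{t2_space, second_countable_topology}, 'e::euclidean_space) chart set"
    and g r0 \<delta> \<alpha>1 \<alpha>2 \<alpha>3 \<alpha>4 +
  fixes D :: "'a set" and f :: "real \<Rightarrow> 'a \<Rightarrow> 'u::euclidean_space \<Rightarrow> ('a, 'e) tangent"
    and xs :: 'a and V :: "real \<Rightarrow> 'a \<Rightarrow> real"
  assumes complete: "M.mcomplete" and open_D: "open D"
    and tangent: "0 \<le> t \<Longrightarrow> x \<in> D \<Longrightarrow> f t x w \<in> tangent_space A x"
    and AA: "assumption_A A g D f xs"
    and r0: "r0 = r_zero A g D xs"
    and lyapunov: "ISS_Lyapunov A g f xs r0 V \<delta> \<alpha>1 \<alpha>2 \<alpha>3 \<alpha>4"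
begin

abbreviation "B \<equiv> rball A g xs r0"

lemma B_subset_D: "B \<subseteq> D"
proof
  fix y assume "y \<in> B"
  then have "ereal (\<rho> xs y) < Sup {r. 0 < r \<and> rball A g xs r \<subseteq> D}"
    using r0 by (simp add: rball_def r_zero_def)
  then obtain r where "rball A g xs r \<subseteq> D" "ereal (\<rho> xs y) < r"
    unfolding less_Sup_iff by blast
  then show "y \<in> D"
    by (auto simp: rball_def)
qed

lemma V_C1: "C1_time_space A B V"
  using lyapunov by (simp add: ISS_Lyapunov_def)

lemma V_bounds:
  assumes "0 \<le> t" "y \<in> B"
  shows "\<alpha>1 (\<rho> y xs) \<le> V t y" "V t y \<le> \<alpha>2 (\<rho> y xs)"
proof -
  have "\<forall>t\<ge>0. \<forall>x\<in>B. \<alpha>1 (\<rho> x xs) \<le> V t x \<and> V t x \<le> \<alpha>2 (\<rho> x xs)"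
    using lyapunov unfolding ISS_Lyapunov_def by (elim conjE)
  then show "\<alpha>1 (\<rho> y xs) \<le> V t y" "V t y \<le> \<alpha>2 (\<rho> y xs)"
    using assms by blast+
qed

lemma V_dissipation:
  assumes "0 \<le> t" "y \<in> B" "ereal (norm w) < \<delta>" "\<alpha>4 (norm w) \<le> \<rho> y xs"
  shows "time_derivative V t y + differential A (V t) y (f t y w) \<le> - \<alpha>3 (\<rho> y xs)"
proof -
  have "\<forall>t\<ge>0. \<forall>x\<in>B. \<forall>u. ereal (norm u) < \<delta> \<and> \<alpha>4 (norm u) \<le> \<rho> x xs \<longrightarrow>
        time_derivative V t x + differential A (V t) x (f t x u) \<le> - \<alpha>3 (\<rho> x xs)"
    using lyapunov unfolding ISS_Lyapunov_def by (elim conjE)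
  then show ?thesis
    using assms by blast
qed

section \<open>A priori estimates along one solution\<close>

context
  fixes u :: "real \<Rightarrow> 'u" and t0 :: real and T :: ereal and x :: "real \<Rightarrow> 'a"
  assumes u: "L_infinity u" and t0: "0 \<le> t0" and small: "ereal (Linf_norm t0 u) < rVhat"
    and sol: "is_solution A g D f u t0 T x" and init: "x t0 \<in> rball A g xs rV"
begin

abbreviation "\<nu> \<equiv> Linf_norm t0 u"
abbreviation "\<mu> \<equiv> \<alpha>2 (\<alpha>4 \<nu>)"
abbreviation "W t \<equiv> V t (x t)"
abbreviation "R t \<equiv> \<rho> (x t) xs"

lemma \<nu>_dom: "\<nu> \<in> dom0 rVhat"
  using small Linf_norm_bound(1)[OF u t0] by (simp add: dom0_def)

lemma \<alpha>4\<nu>_dom: "\<alpha>4 \<nu> \<in> dom0 rV" "\<alpha>4 \<nu> \<in> dom0 r0"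
  using dom0_rVhat(2)[OF \<nu>_dom] dom0_rV(1) by blast+

lemma init_dom: "R t0 \<in> dom0 rV"
  using init by (simp add: in_rball_iff)

lemma solution_abs_continuous: "t0 \<le> a \<Longrightarrow> a \<le> b \<Longrightarrow> ereal b < T \<Longrightarrow> abs_continuous A g a b x"
  using sol by (simp add: is_solution_def)

lemma solution_continuous: "t0 \<le> a \<Longrightarrow> ereal b < T \<Longrightarrow> continuous_on {a..b} x"
  using abs_continuous_imp_continuous_on[OF solution_abs_continuous] by (cases "a \<le> b") auto

text \<open>A value of \<open>W\<close> at or above \<alpha>2 w forces the radius to be at least w,
  hence at least \<alpha>4 of the current input norm. The dissipation inequality then applies almost
  everywhere, and monotonicity of \<alpha>3 makes \<alpha>3 w a uniform rate.\<close>

lemma W_decrease: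
  assumes ab: "t0 \<le> a" "a \<le> b" "ereal b < T" and w: "w \<in> dom0 r0" "\<alpha>4 \<nu> \<le> w"
    and xB: "\<And>t. t \<in> {a..b} \<Longrightarrow> x t \<in> B \<and> \<alpha>2 w \<le> W t"
  shows "W b - W a \<le> - \<alpha>3 w * (b - a)"
proof -
  have "AE t in lebesgue. t0 < t \<and> ereal t < T \<longrightarrow> has_velocity A x t (f t (x t) (u t))"
    using sol by (simp add: is_solution_def)
  then have "AE t in lebesgue. t0 < t \<and> ereal t < T \<longrightarrow> has_velocity A x t (f t (x t) (u t)) \<and> norm (u t) \<le> \<nu>"
    using Linf_norm_bound(2)[OF u t0] by eventually_elim auto
  then obtain N where N: "negligible N"
    and N0: "\<forall>t. t \<notin> N \<longrightarrow> t0 < t \<and> ereal t < T \<longrightarrow> has_velocity A x t (f t (x t) (u t)) \<and> norm (u t) \<le> \<nu>"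
    by (rule AE_lebesgueE)
  have a0: "0 \<le> a"
    using t0 ab(1) by simp
  show ?thesis
  proof (rule lyapunov_decrease[OF V_C1 open_rball a0 ab(2) solution_abs_continuous[OF ab] _ N])
    show "x t \<in> B" if "t \<in> {a..b}" for t
      using xB[OF that] by blast
    fix t assume t: "t \<in> {a<..<b} - N"
    then have t': "t \<in> {a..b}" "0 \<le> t"
      using a0 by auto
    have "ereal t < T"
      using t ab(3) by (auto intro: less_trans[of "ereal t" "ereal b"])
    moreover have "t0 < t \<and> ereal t < T \<longrightarrow> has_velocity A x t (f t (x t) (u t)) \<and> norm (u t) \<le> \<nu>"
      using t N0 by blast
    ultimately have vel: "has_velocity A x t (f t (x t) (u t))" and ut: "norm (u t) \<le> \<nu>"
      using t ab(1) by simp_all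
    have xt: "x t \<in> B" "\<alpha>2 w \<le> W t"
      using xB[OF t'(1)] by auto
    then have Rd: "R t \<in> dom0 r0"
      by (simp add: in_rball_iff)
    have "\<alpha>2 w \<le> \<alpha>2 (R t)"
      using xt(2) V_bounds(2)[OF t'(2) xt(1)] by simp
    then have wR: "w \<le> R t"
      using K_function_le_iff[OF K2 w(1) Rd] by simp
    have \<nu>\<delta>: "\<nu> \<in> dom0 \<delta>"
      by (rule dom0_rVhat(1)[OF \<nu>_dom])
    have u\<delta>: "norm (u t) \<in> dom0 \<delta>"
      by (rule dom0_downward[OF \<nu>\<delta> norm_ge_zero ut])
    have "\<alpha>4 (norm (u t)) \<le> \<alpha>4 \<nu>"
      using K_function_le_iff[OF K4 u\<delta> \<nu>\<delta>] ut by simp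
    then have "\<alpha>4 (norm (u t)) \<le> R t"
      using w(2) wR by simp
    moreover have "ereal (norm (u t)) < \<delta>"
      using u\<delta> by (simp add: dom0_def)
    ultimately have "time_derivative V t (x t) + differential A (V t) (x t) (f t (x t) (u t)) \<le> - \<alpha>3 (R t)"
      using V_dissipation[OF t'(2) xt(1)] by blast
    also have "\<dots> \<le> - \<alpha>3 w"
      using K_function_le_iff[OF K3 w(1) Rd] wR by simp
    finally show "\<exists>v. has_velocity A x t v \<and> time_derivative V t (x t) + differential A (V t) (x t) v \<le> - \<alpha>3 w"
      using vel by blast
  qed
qed

text \<open>After the last time at which \<open>W\<close> is at or below the larger of its initial
  value and \<open>\<mu>\<close>, it would have to rise while lying above \<open>\<mu>\<close>,
  where it can only decrease.\<close>

lemma W_le_max: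
  assumes st: "t0 \<le> s" "s \<le> t" "ereal t < T" and xB: "\<And>r. r \<in> {s..t} \<Longrightarrow> x r \<in> B"
  shows "W t \<le> max (W s) \<mu>"
proof (rule ccontr)
  define m where "m = max (W s) \<mu>"
  assume "\<not> ?thesis"
  then have less: "m < W t"
    unfolding m_def not_le .
  have s0: "0 \<le> s"
    using t0 st(1) by simp
  have cont: "continuous_on {s..t} W"
    by (rule continuous_on_time_space[OF V_C1 open_rball s0 solution_continuous[OF st(1,3)] xB])
  define S where "S = {s..t} \<inter> W -` {..m}"
  have S: "closed S"
    unfolding S_def by (rule continuous_closed_preimage[OF cont]) auto
  have ne: "s \<in> S"
    using st by (simp add: S_def m_def)
  have bdd: "bdd_above S"
    by (rule bdd_aboveI[of _ t]) (simp add: S_def)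
  define \<sigma> where "\<sigma> = Sup S"
  have \<sigma>: "\<sigma> \<in> S"
    unfolding \<sigma>_def by (rule closed_contains_Sup[OF _ bdd S]) (use ne in blast)
  have \<sigma>st: "s \<le> \<sigma>" "\<sigma> \<le> t" "W \<sigma> \<le> m"
    using \<sigma> by (auto simp: S_def)
  have above: "m < W r" if "\<sigma> < r" "r \<le> t" for r
  proof (rule ccontr)
    assume "\<not> m < W r"
    then have "r \<in> S"
      using that \<sigma>st by (simp add: S_def)
    then have "r \<le> \<sigma>"
      unfolding \<sigma>_def by (rule cSup_upper[OF _ bdd])
    then show False
      using that by simp
  qed
  have W\<sigma>: "W \<sigma> = m"
  proof -
    have "continuous_on {\<sigma>..t} W"
      by (rule continuous_on_subset[OF cont]) (use \<sigma>st in auto)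
    then have "\<exists>r\<ge>\<sigma>. r \<le> t \<and> W r = m"
      using \<sigma>st less by (intro IVT') auto
    then obtain r where "\<sigma> \<le> r" "r \<le> t" "W r = m"
      by blast
    then show ?thesis
      using above[of r] by (cases "r = \<sigma>") auto
  qed
  have tB: "x t \<in> B"
    using xB st by simp
  have Rd: "R t \<in> dom0 r0"
    using tB by (simp add: in_rball_iff)
  have m0: "0 \<le> m"
    using K_function_nonneg[OF K2 \<alpha>4\<nu>_dom(2)] by (simp add: m_def)
  have mR: "m \<le> \<alpha>2 (R t)"
    using less V_bounds(2)[OF _ tB, of t] s0 st(2) by simp
  \<comment> \<open>The level \<open>m\<close> is written as \<alpha>2 w so that the decrease
    estimate can be used; its value at \<open>x t\<close> guarantees that such a w exists in the
    domain.\<close>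
  obtain w where w: "0 \<le> w" "w \<le> R t" "w \<in> dom0 r0" "\<alpha>2 w = m"
    by (rule K_function_surj[OF K2 Rd m0 mR])
  have "\<alpha>4 \<nu> \<le> w"
    using K_function_le_iff[OF K2 \<alpha>4\<nu>_dom(2) w(3)] w(4) by (simp add: m_def)
  then have "W t - W \<sigma> \<le> - \<alpha>3 w * (t - \<sigma>)"
  proof (intro W_decrease w(3) st(3))
    fix r assume r: "r \<in> {\<sigma>..t}"
    then have "m \<le> W r"
      using above[of r] W\<sigma> by (cases "r = \<sigma>") auto
    then show "x r \<in> B \<and> \<alpha>2 w \<le> W r"
      using w(4) xB[of r] r \<sigma>st by simp
  qed (use \<sigma>st st in auto)
  moreover have "0 \<le> \<alpha>3 w * (t - \<sigma>)"
    using K_function_nonneg[OF K3 w(3)] \<sigma>st by simp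
  ultimately show False
    using W\<sigma> less by simp
qed

text \<open>If \<open>W\<close> is above \<open>\<mu>\<close> at time \<open>t\<close>, it was at
  least \<open>W t\<close> at every earlier time. The rate belonging to the final level thus holds
  on the whole interval, which gives the inequality solved by \<open>decay\<close> without
  integrating a scalar equation.\<close>

lemma radius_estimate:
  assumes t: "t0 \<le> t" "ereal t < T" and xB: "\<And>r. r \<in> {t0..t} \<Longrightarrow> x r \<in> B"
  shows "R t \<le> \<beta> (R t0) (t - t0) \<or> R t \<le> \<gamma> \<nu>"
proof -
  have tB: "x t \<in> B" "x t0 \<in> B" and t0': "0 \<le> t"
    using xB t t0 by auto
  have Rd: "R t \<in> dom0 r0"
    using tB(1) by (simp add: in_rball_iff)
  show ?thesis
  proof (cases "W t \<le> \<mu>")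
    case True
    then have "\<alpha>1 (R t) \<le> \<alpha>2 (\<alpha>4 \<nu>)"
      using V_bounds(1)[OF t0' tB(1)] by simp
    then show ?thesis
      using le_\<gamma>[OF Rd \<nu>_dom] by simp
  next
    case False
    have W0: "0 \<le> W t"
      using V_bounds(1)[OF t0' tB(1)] K_function_nonneg[OF K1 Rd] by simp
    obtain w where w: "0 \<le> w" "w \<le> R t" "w \<in> dom0 r0" "\<alpha>2 w = W t"
      by (rule K_function_surj[OF K2 Rd W0 V_bounds(2)[OF t0' tB(1)]])
    have "\<alpha>4 \<nu> \<le> w"
      using K_function_le_iff[OF K2 \<alpha>4\<nu>_dom(2) w(3)] w(4) False by simp
    then have "W t - W t0 \<le> - \<alpha>3 w * (t - t0)"
    proof (intro W_decrease w(3) t order_refl)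
      fix r assume r: "r \<in> {t0..t}"
      \<comment> \<open>Invariance is applied from \<open>r\<close> to \<open>t\<close>: as
        \<open>W t\<close> exceeds \<open>\<mu>\<close>, the maximum must be
        \<open>W r\<close>.\<close>
      have "W t \<le> max (W r) \<mu>"
        by (rule W_le_max) (use r t xB in auto)
      then show "x r \<in> B \<and> \<alpha>2 w \<le> W r"
        using False w(4) xB[OF r] by simp
    qed
    then have "\<alpha>2 w + (t - t0) * \<alpha>3 w \<le> W t0"
      using w(4) by (simp add: algebra_simps)
    also have "\<dots> \<le> \<alpha>2 (R t0)"
      by (rule V_bounds(2)[OF t0 tB(2)])
    finally have "R t \<le> \<beta> (R t0) (t - t0)"
      using V_bounds(1)[OF t0' tB(1)] w(4) t(1) by (intro le_\<beta>[OF init_dom _ Rd w(3)]) auto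
    then show ?thesis
      by simp
  qed
qed

text \<open>A continuity argument. Up to the first time the radius reaches r the trajectory is in
  the domain of V, so the estimate for \<open>W\<close> holds and yields a radius strictly below r
  at that very time.\<close>

lemma radius_confined:
  obtains r where "r \<in> dom0 r0" "\<forall>t. t0 \<le> t \<and> ereal t < T \<longrightarrow> R t < r"
proof -
  \<comment> \<open>The level \<alpha>2 s dominates both the initial value of \<open>W\<close> and
    the threshold \<open>\<mu>\<close>, and s is still below r_V.\<close>
  define s where "s = max (R t0) (\<alpha>4 \<nu>)"
  have s: "s \<in> dom0 rV"
    using init_dom \<alpha>4\<nu>_dom(1) by (simp add: s_def max_def)
  have sr: "s \<in> dom0 r0"
    by (rule dom0_rV(1)[OF s])
  obtain r where r: "r \<in> dom0 r0" "\<alpha>2 s < \<alpha>1 r"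
    using dom0_rV(2)[OF s] by blast
  have R0: "R t0 \<in> dom0 r0"
    by (rule dom0_rV(1)[OF init_dom])
  have le_s: "\<alpha>2 (R t0) \<le> \<alpha>2 s" "\<mu> \<le> \<alpha>2 s"
    using K_function_le_iff[OF K2 R0 sr] K_function_le_iff[OF K2 \<alpha>4\<nu>_dom(2) sr] by (simp_all add: s_def)
  have step: "R t < r" if t: "t0 \<le> t" "ereal t < T" and xB: "\<And>r. r \<in> {t0..t} \<Longrightarrow> x r \<in> B" for t
  proof -
    have tB: "x t \<in> B" "x t0 \<in> B" and t0': "0 \<le> t"
      using xB t t0 by auto
    have Rd: "R t \<in> dom0 r0"
      using tB(1) by (simp add: in_rball_iff)
    have "\<alpha>1 (R t) \<le> W t"
      by (rule V_bounds(1)[OF t0' tB(1)])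
    also have "W t \<le> max (W t0) \<mu>"
      by (rule W_le_max[OF order_refl t xB])
    also have "\<dots> \<le> \<alpha>2 s"
      using V_bounds(2)[OF t0 tB(2)] le_s by simp
    also have "\<dots> < \<alpha>1 r"
      by (rule r(2))
    finally show ?thesis
      using K_function_less_iff[OF K1 Rd r(1)] by simp
  qed
  have "R t < r" if t: "t0 \<le> t" "ereal t < T" for t
  proof (rule ccontr)
    assume "\<not> R t < r"
    have contx: "continuous_on {t0..t} x"
      by (rule solution_continuous[OF order_refl t(2)])
    have "continuous_on {t0..t} (\<lambda>t. \<rho> xs (x t))"
      unfolding continuous_on_def using contx dist_continuous[of x _ _ xs] by (simp add: continuous_on_def)
    then have cont: "continuous_on {t0..t} R"
      by (simp only: dist_sym[of xs])
    define S where "S = {t0..t} \<inter> R -` {r..}"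
    have S: "closed S"
      unfolding S_def by (rule continuous_closed_preimage[OF cont]) auto
    have ne: "t \<in> S"
      using t \<open>\<not> R t < r\<close> by (simp add: S_def)
    have bdd: "bdd_below S"
      by (rule bdd_belowI[of _ t0]) (simp add: S_def)
    define \<sigma> where "\<sigma> = Inf S"
    have \<sigma>: "\<sigma> \<in> S"
      unfolding \<sigma>_def by (rule closed_contains_Inf[OF _ bdd S]) (use ne in blast)
    have \<sigma>t: "t0 \<le> \<sigma>" "\<sigma> \<le> t" "r \<le> R \<sigma>"
      using \<sigma> by (auto simp: S_def)
    have below: "R q < r" if "t0 \<le> q" "q < \<sigma>" for q
    proof (rule ccontr)
      assume "\<not> R q < r"
      then have "q \<in> S"
        using that \<sigma>t by (simp add: S_def)
      then have "\<sigma> \<le> q"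
        unfolding \<sigma>_def by (rule cInf_lower[OF _ bdd])
      then show False
        using that by simp
    qed
    have "\<alpha>1 (R t0) < \<alpha>1 r"
      using le12[OF R0] le_s(1) r(2) by simp
    then have R0r: "R t0 < r"
      using K_function_less_iff[OF K1 R0 r(1)] by simp
    have "continuous_on {t0..\<sigma>} R"
      by (rule continuous_on_subset[OF cont]) (use \<sigma>t in auto)
    then have "\<exists>q\<ge>t0. q \<le> \<sigma> \<and> R q = r"
      using \<sigma>t R0r by (intro IVT') auto
    then obtain q where q: "t0 \<le> q" "q \<le> \<sigma>" "R q = r"
      by blast
    then have R\<sigma>: "R \<sigma> = r"
      using below[of q] by (cases "q = \<sigma>") auto
    have "R \<sigma> < r"
    proof (rule step)
      show "ereal \<sigma> < T"
        using \<sigma>t(2) t(2) by (meson ereal_less_eq(3) le_less_trans)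
      fix q assume q: "q \<in> {t0..\<sigma>}"
      then have "R q \<le> r"
        using below[of q] R\<sigma> by (cases "q = \<sigma>") auto
      then have "R q \<in> dom0 r0"
        using dom0_downward[OF r(1)] dist_nonneg by blast
      then show "x q \<in> B"
        by (simp add: in_rball_iff)
    qed (rule \<sigma>t(1))
    then show False
      using R\<sigma> by simp
  qed
  then show ?thesis
    using r(1) by (intro that[of r]) simp_all
qed

lemma confined_in_B: "t0 \<le> t \<Longrightarrow> ereal t < T \<Longrightarrow> x t \<in> B"
proof -
  assume t: "t0 \<le> t" "ereal t < T"
  obtain r where r: "r \<in> dom0 r0" "\<forall>t. t0 \<le> t \<and> ereal t < T \<longrightarrow> R t < r"
    by (rule radius_confined)
  then have "R t \<in> dom0 r0"
    using t dom0_downward[OF r(1) dist_nonneg, of "x t" xs] by force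
  then show "x t \<in> B"
    by (simp add: in_rball_iff)
qed

lemma ISS_estimate:
  assumes t: "t0 \<le> t" "ereal t < T"
  shows "R t \<le> \<beta> (R t0) (t - t0) + \<gamma> \<nu>"
proof -
  have "R t \<le> \<beta> (R t0) (t - t0) \<or> R t \<le> \<gamma> \<nu>"
  proof (rule radius_estimate[OF t])
    fix r assume "r \<in> {t0..t}"
    then show "x r \<in> B"
      using t(2) by (intro confined_in_B) (auto intro: le_less_trans[of "ereal r" "ereal t"])
  qed
  moreover have "0 \<le> \<gamma> \<nu>"
    by (rule K_function_nonneg[OF K_\<gamma> \<nu>_dom])
  moreover have "K_function rV (\<lambda>s. \<beta> s (t - t0))"
    using KL_\<beta> t(1) unfolding KL_function_def by simp
  then have "0 \<le> \<beta> (R t0) (t - t0)"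
    using K_function_nonneg init_dom by blast
  ultimately show ?thesis
    by linarith
qed

text \<open>Confinement provides one radius r < r0 for all times, so the closed ball of radius r
  lies in \<open>D\<close> and contains the limit at a finite end time.\<close>

lemma not_maximal_if_finite:
  assumes "T \<noteq> \<infinity>"
  shows "\<exists>T' x'. T < T' \<and> is_solution A g D f u t0 T' x' \<and> (\<forall>t. t0 \<le> t \<and> ereal t < T \<longrightarrow> x' t = x t)"
proof -
  have "ereal t0 < T"
    using sol by (simp add: is_solution_def)
  then obtain T1 where T1: "T = ereal T1"
    using assms by (cases T) auto
  obtain r where r: "r \<in> dom0 r0" "\<forall>t. t0 \<le> t \<and> ereal t < T \<longrightarrow> R t < r"
    by (rule radius_confined)
  have ball: "p \<in> D" if "\<rho> p xs \<le> r" for p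
  proof -
    have "\<rho> p xs \<in> dom0 r0"
      by (rule dom0_downward[OF r(1) dist_nonneg that])
    then show ?thesis
      using B_subset_D in_rball_iff by blast
  qed
  have bounded: "\<rho> (x t) xs \<le> r" if "t0 \<le> t" "t < T1" for t
    using r(2) that T1 by (intro less_imp_le) simp
  obtain T' x' where "ereal T1 < T'" "is_solution A g D f u t0 T' x'" "\<forall>t. t0 \<le> t \<and> ereal t < ereal T1 \<longrightarrow> x' t = x t"
    by (rule bounded_solution_extends[OF open_D tangent AA u complete sol[unfolded T1] t0 bounded ball])
  then show ?thesis
    unfolding T1 by blast
qed

end

end

theorem theorem2p1:
  fixes A :: "('a::{t2_space, second_countable_topology}, real ^ 'n) chart set"
    and g :: "('a, real ^ 'n) metric"
    and D :: "'a set"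
    and f :: "real \<Rightarrow> 'a \<Rightarrow> real ^ 'm \<Rightarrow> ('a, real ^ 'n) tangent"
    and xs :: 'a
    and V :: "real \<Rightarrow> 'a \<Rightarrow> real"
    and \<delta>\<^sub>V r\<^sub>0 rV rVhat :: ereal
    and \<alpha>\<^sub>1 \<alpha>\<^sub>2 \<alpha>\<^sub>3 \<alpha>\<^sub>4 :: "real \<Rightarrow> real"
  assumes "connected_complete_riemannian A g"
    and "open D"
    and "\<And>t x u. 0 \<le> t \<Longrightarrow> x \<in> D \<Longrightarrow> f t x u \<in> tangent_space A x"
    and "xs \<in> D"
    and "\<And>t. 0 \<le> t \<Longrightarrow> f t xs 0 = (\<lambda>_. 0)"
    and "assumption_A A g D f xs"
    and "r\<^sub>0 = r_zero A g D xs"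
    and "ISS_Lyapunov A g f xs r\<^sub>0 V \<delta>\<^sub>V \<alpha>\<^sub>1 \<alpha>\<^sub>2 \<alpha>\<^sub>3 \<alpha>\<^sub>4"
    and "rV = r_V r\<^sub>0 \<alpha>\<^sub>1 \<alpha>\<^sub>2"
    and "rVhat = r_V_hat \<delta>\<^sub>V \<alpha>\<^sub>4 rV"
  shows "0 < rVhat \<and>
    regionally_ISS A g D f xs (rball A g xs rV) \<and>
    (\<exists>\<beta> \<gamma>. KL_function rV \<beta> \<and> K_function rVhat \<gamma> \<and>
      (\<forall>t\<^sub>0\<ge>0. \<forall>x\<^sub>0\<in>rball A g xs rV. \<forall>u. L_infinity u \<and> ereal (Linf_norm t\<^sub>0 u) < rVhat \<longrightarrow>
        (\<forall>T x. maximal_solution A g D f u t\<^sub>0 T x \<and> x t\<^sub>0 = x\<^sub>0 \<longrightarrow>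
          T = \<infinity> \<and>
          (\<forall>t\<ge>t\<^sub>0. riem_dist A g (x t) xs
             \<le> \<beta> (riem_dist A g (x t\<^sub>0) xs) (t - t\<^sub>0) + \<gamma> (Linf_norm t\<^sub>0 u)) \<and>
          (\<forall>t\<ge>t\<^sub>0. ereal (riem_dist A g xs (x t)) < r\<^sub>0))))"
proof -
  interpret riemannian A g
    using assms(1) by unfold_locales (simp_all add: connected_complete_riemannian_def)
  interpret C: ISS_comparison r\<^sub>0 \<delta>\<^sub>V \<alpha>\<^sub>1 \<alpha>\<^sub>2 \<alpha>\<^sub>3 \<alpha>\<^sub>4
    using assms(8) by unfold_locales (simp_all add: ISS_Lyapunov_def)
  interpret S: ISS_system A g r\<^sub>0 \<delta>\<^sub>V \<alpha>\<^sub>1 \<alpha>\<^sub>2 \<alpha>\<^sub>3 \<alpha>\<^sub>4 D f xs V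
    using assms(1,2,3,6,7,8) by unfold_locales (simp_all add: connected_complete_riemannian_def)
  note rV = assms(9) and rVhat = assms(10)[unfolded assms(9)]
  \<comment> \<open>The same estimate, with the same \<beta> and \<gamma>, yields both the regional
    ISS predicate and the explicit statement with its confinement clause.\<close>
  have est: "T = \<infinity> \<and> (\<forall>t\<ge>t0. riem_dist A g (x t) xs \<le> C.\<beta> (riem_dist A g (x t0) xs) (t - t0) + C.\<gamma> (Linf_norm t0 u)) \<and>
      (\<forall>t\<ge>t0. ereal (riem_dist A g xs (x t)) < r\<^sub>0)"
    if t0: "0 \<le> t0" and u: "L_infinity u" and small: "ereal (Linf_norm t0 u) < rVhat"
      and max: "maximal_solution A g D f u t0 T x" and init: "x t0 \<in> rball A g xs rV" for t0 u T x
  proof -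
    have sol: "is_solution A g D f u t0 T x"
      using max by (simp add: maximal_solution_def)
    note hyps = u t0 small[unfolded rVhat] sol init[unfolded rV]
    have T: "T = \<infinity>"
    proof (rule ccontr)
      assume "T \<noteq> \<infinity>"
      from S.not_maximal_if_finite[OF hyps this] show False
        using max unfolding maximal_solution_def by blast
    qed
    moreover have "riem_dist A g (x t) xs \<le> C.\<beta> (riem_dist A g (x t0) xs) (t - t0) + C.\<gamma> (Linf_norm t0 u)" if "t0 \<le> t" for t
      by (rule S.ISS_estimate[OF hyps that]) (simp add: T)
    moreover have "ereal (riem_dist A g xs (x t)) < r\<^sub>0" if "t0 \<le> t" for t
      using S.confined_in_B[OF hyps that] T by (simp add: rball_def)
    ultimately show ?thesis
      by blast
  qed
  have KL: "KL_function rV C.\<beta>"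
    unfolding rV by (rule C.KL_\<beta>)
  have K: "K_function rVhat C.\<gamma>"
    unfolding rVhat by (rule C.K_\<gamma>)
  have pos: "0 < rVhat"
    unfolding rVhat by (rule C.rVhat_pos)
  have "regionally_ISS A g D f xs (rball A g xs rV)"
    unfolding regionally_ISS_def
  proof (intro conjI)
    show "rball A g xs rV \<subseteq> D"
    proof
      fix y assume "y \<in> rball A g xs rV"
      then have "y \<in> rball A g xs r\<^sub>0"
        using C.dom0_rV(1) unfolding in_rball_iff rV by blast
      then show "y \<in> D"
        using S.B_subset_D by blast
    qed
    have "xs \<in> rball A g xs rV"
      using C.rV_pos by (simp add: rball_def dist_self rV zero_ereal_def)
    then show "xs \<in> interior (rball A g xs rV)"
      using open_rball by (simp add: interior_open)
    show "\<exists>\<delta> r \<beta> \<gamma>. KL_function r \<beta> \<and> (\<forall>x\<in>rball A g xs rV. riem_dist A g x xs \<in> dom0 r) \<and> K_function \<delta> \<gamma> \<and>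
        (\<forall>t\<^sub>0\<ge>0. \<forall>u T x. L_infinity u \<and> ereal (Linf_norm t\<^sub>0 u) < \<delta> \<and>
           maximal_solution A g D f u t\<^sub>0 T x \<and> x t\<^sub>0 \<in> rball A g xs rV \<longrightarrow>
           T = \<infinity> \<and>
           (\<forall>t\<ge>t\<^sub>0. riem_dist A g (x t) xs
              \<le> \<beta> (riem_dist A g (x t\<^sub>0) xs) (t - t\<^sub>0) + \<gamma> (Linf_norm t\<^sub>0 u)))"
    proof (rule exI[of _ rVhat], rule exI[of _ rV], rule exI[of _ C.\<beta>], rule exI[of _ C.\<gamma>], intro conjI KL K allI impI)
      show "\<forall>x\<in>rball A g xs rV. riem_dist A g x xs \<in> dom0 rV"
        by (simp add: in_rball_iff)
    qed (use est in blast)+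
  qed
  moreover have "\<exists>\<beta> \<gamma>. KL_function rV \<beta> \<and> K_function rVhat \<gamma> \<and>
      (\<forall>t\<^sub>0\<ge>0. \<forall>x\<^sub>0\<in>rball A g xs rV. \<forall>u. L_infinity u \<and> ereal (Linf_norm t\<^sub>0 u) < rVhat \<longrightarrow>
        (\<forall>T x. maximal_solution A g D f u t\<^sub>0 T x \<and> x t\<^sub>0 = x\<^sub>0 \<longrightarrow>
          T = \<infinity> \<and>
          (\<forall>t\<ge>t\<^sub>0. riem_dist A g (x t) xs
             \<le> \<beta> (riem_dist A g (x t\<^sub>0) xs) (t - t\<^sub>0) + \<gamma> (Linf_norm t\<^sub>0 u)) \<and>
          (\<forall>t\<ge>t\<^sub>0. ereal (riem_dist A g xs (x t)) < r\<^sub>0)))"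
    by (rule exI[of _ C.\<beta>], rule exI[of _ C.\<gamma>], intro conjI KL K allI ballI impI) (use est in blast)+
  ultimately show ?thesis
    using pos by blast
qed

end
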